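(* Let $W(x,y)=-\log g_\tau(y-(\alpha+\beta x))$, with $\tau$ positive definite, $\alpha\in\mathbb{R}^d$, $\beta\in\mathbb{R}^{d\times d}$ invertible, and let $\mu=\lambda_U$ be a probability measure with $\nabla^2U\ge u_+^{-1}$ for some positive definite matrix $u_+$. Let $\mathcal{K}_0=K_W$, let $\mathcal{K}_1$ be its backward transition with respect to $\mu$, and let $S_1=\mathcal{K}_0\mathcal{K}_1$, with $S_1^n$ its $n$-th iterate. Put $$\kappa:=\|\tau^{-1}\beta\|_2,\quad\rho_0:=\|\tau\|_2,\quad\rho_1:=\|(u_+^{-1}+\beta'\tau^{-1}\beta)^{-1}\|_2,\quad\rho_0^\pi:=\|\tau+\beta u_+\beta'\|_2,$$ $$a_{u_+}(\beta,\tau):=\epsilon_0:=\kappa^2\rho_0\|u_+\|_2,\qquad b_{u_+}(\beta,\tau):=\kappa^2\rho_0\rho_1,\qquad\epsilon_0^\pi:=\kappa^2\rho_0^\pi\rho_1 .$$ Then for every probability measure $\nu$ on $\mathbb{R}^d$ $$\mathcal{D}_2(\nu S_1,\mu)\le b_{u_+}(\beta,\tau)\,\mathcal{D}_2(\nu,\mu),\qquad\mathcal{H}(\nu S_1\,|\,\mu)\le(1\wedge\epsilon_0^\pi)(1\wedge\epsilon_0)\,\mathcal{H}(\nu\,|\,\mu),$$ and for every $n\ge0$ $$\mathcal{H}(\nu S_1^{n+1}\,|\,\mu)\le a_{u_+}(\beta,\tau)\,b_{u_+}(\beta,\tau)^{2n}\,\mathcal{H}(\nu\,|\,\mu).$$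
   Context: $\lambda$ is Lebesgue measure on $\mathbb{R}^d$; $g_\tau$ is the density of the centered Gaussian with covariance $\tau$; $\lambda_U(dx)=e^{-U(x)}\lambda(dx)$ with $U$ smooth; $K_W(x,dy)=e^{-W(x,y)}\lambda(dy)$; $\beta'$ is the transpose. The backward transition $\mathcal{K}_1$ is the conditional law of the first coordinate given the second under $\mu(dx)\mathcal{K}_0(x,dy)$: $\mu(dx)\mathcal{K}_0(x,dy)=(\mu\mathcal{K}_0)(dy)\,\mathcal{K}_1(y,dx)$, i.e. $\mathcal{K}_1(y,dx)\propto e^{-U(x)-W(x,y)}\lambda(dx)$. $(\mathcal{K}_0\mathcal{K}_1)(x,dz)=\int\mathcal{K}_0(x,dy)\mathcal{K}_1(y,dz)$ (the forward/backward Gibbs, or proximal, sampler with invariant measure $\mu$). $\mathcal{H}$ is relative entropy, $\mathcal{D}_2$ the $2$-Wasserstein distance (Euclidean norm), $\|\cdot\|_2$ the spectral norm, $a\wedge b=\min(a,b)$. *)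

theory Defs
  imports "HOL-Probability.Probability"
begin

section \<open>Matrices\<close>

definition positive_definite :: "real^'d^'d \<Rightarrow> bool" where
  "positive_definite A \<longleftrightarrow> transpose A = A \<and> (\<forall>v. v \<noteq> 0 \<longrightarrow> 0 < v \<bullet> (A *v v))"

(* Used for symmetric matrices only, where it is the Loewner order. *)
definition loewner_le :: "real^'d^'d \<Rightarrow> real^'d^'d \<Rightarrow> bool" where
  "loewner_le A B \<longleftrightarrow> (\<forall>v. v \<bullet> (A *v v) \<le> v \<bullet> (B *v v))"

definition spectral_norm :: "real^'d^'d \<Rightarrow> real" where
  "spectral_norm A = onorm (\<lambda>x. A *v x)"

section \<open>Smooth functions and Hessians\<close>

definition partial_deriv :: "'d::finite \<Rightarrow> (real^'d \<Rightarrow> real) \<Rightarrow> real^'d \<Rightarrow> real" where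
  "partial_deriv i f x = frechet_derivative f (at x) (axis i 1)"

primrec Ck :: "nat \<Rightarrow> (real^'d::finite \<Rightarrow> real) \<Rightarrow> bool" where
  "Ck 0 f \<longleftrightarrow> continuous_on UNIV f"
| "Ck (Suc k) f \<longleftrightarrow> (\<forall>x. f differentiable (at x)) \<and> (\<forall>i. Ck k (partial_deriv i f))"

definition smooth :: "(real^'d::finite \<Rightarrow> real) \<Rightarrow> bool" where
  "smooth f \<longleftrightarrow> (\<forall>k. Ck k f)"

definition hessian :: "(real^'d::finite \<Rightarrow> real) \<Rightarrow> real^'d \<Rightarrow> real^'d^'d" where
  "hessian f x = (\<chi> i j. partial_deriv i (partial_deriv j f) x)"

section \<open>Gibbs measures, Gaussian densities and Markov kernels\<close>

definition gibbs_measure :: "(real^'d::finite \<Rightarrow> real) \<Rightarrow> (real^'d) measure" where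
  "gibbs_measure U = density lborel (\<lambda>x. ennreal (exp (- U x)))"

definition gibbs_kernel :: "(real^'d::finite \<Rightarrow> real^'d \<Rightarrow> real) \<Rightarrow> real^'d \<Rightarrow> (real^'d) measure" where
  "gibbs_kernel W x = density lborel (\<lambda>y. ennreal (exp (- W x y)))"

definition gauss_density :: "real^'d^'d \<Rightarrow> real^'d \<Rightarrow> real" where
  "gauss_density \<tau> z =
     exp (- (1/2) * (z \<bullet> (matrix_inv \<tau> *v z))) / sqrt ((2 * pi) ^ CARD('d) * det \<tau>)"

definition markov_kernel :: "('a::topological_space \<Rightarrow> 'a measure) \<Rightarrow> bool" where
  "markov_kernel K \<longleftrightarrow> K \<in> measurable borel (prob_algebra borel)"

definition kernel_comp :: "('a \<Rightarrow> 'a measure) \<Rightarrow> ('a \<Rightarrow> 'a measure) \<Rightarrow> 'a \<Rightarrow> 'a measure" where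
  "kernel_comp K L = (\<lambda>x. K x \<bind> L)"

primrec kernel_pow :: "('a::topological_space \<Rightarrow> 'a measure) \<Rightarrow> nat \<Rightarrow> 'a \<Rightarrow> 'a measure" where
  "kernel_pow K 0 = return borel"
| "kernel_pow K (Suc n) = kernel_comp (kernel_pow K n) K"

(* L(y, dx) is a regular conditional law of the first coordinate given the second under
   \<mu>(dx) K(x, dy):  \<mu>(dx) K(x, dy) = (\<mu> K)(dy) L(y, dx)  as measures in (x, y). *)
definition backward_transition ::
  "('a::topological_space) measure \<Rightarrow> ('a \<Rightarrow> 'a measure) \<Rightarrow> ('a \<Rightarrow> 'a measure) \<Rightarrow> bool" where
  "backward_transition \<mu> K L \<longleftrightarrow> markov_kernel L \<and>
     \<mu> \<bind> (\<lambda>x. K x \<bind> (\<lambda>y. return (borel \<Otimes>\<^sub>M borel) (x, y))) =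
     (\<mu> \<bind> K) \<bind> (\<lambda>y. L y \<bind> (\<lambda>x. return (borel \<Otimes>\<^sub>M borel) (x, y)))"

section \<open>Relative entropy and 2-Wasserstein distance\<close>

(* H(\<nu> | \<mu>) for probability measures. KL_divergence takes the reference measure first, and is a
   Bochner integral, hence 0 without integrability. The negative part of log(d\<nu>/d\<mu>) is always
   \<nu>-integrable, so if log(d\<nu>/d\<mu>) is not \<nu>-integrable its integral is +infinity. *)
definition rel_entropy :: "'a measure \<Rightarrow> 'a measure \<Rightarrow> ereal" where
  "rel_entropy \<nu> \<mu> =
     (if absolutely_continuous \<mu> \<nu> \<and> integrable \<nu> (entropy_density (exp 1) \<mu> \<nu>)
      then ereal (KL_divergence (exp 1) \<mu> \<nu>) else \<infinity>)"

definition couplings ::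
  "('a::topological_space) measure \<Rightarrow> 'a measure \<Rightarrow> ('a \<times> 'a) measure set" where
  "couplings \<mu> \<nu> = {\<pi>. prob_space \<pi> \<and> sets \<pi> = sets (borel \<Otimes>\<^sub>M borel) \<and>
                       distr \<pi> borel fst = \<mu> \<and> distr \<pi> borel snd = \<nu>}"

definition ennreal_sqrt :: "ennreal \<Rightarrow> ennreal" where
  "ennreal_sqrt t = (if t = \<infinity> then \<infinity> else ennreal (sqrt (enn2real t)))"

definition wasserstein2 :: "(real^'d::finite) measure \<Rightarrow> (real^'d) measure \<Rightarrow> ennreal" where
  "wasserstein2 \<mu> \<nu> =
     ennreal_sqrt (INF \<pi>\<in>couplings \<mu> \<nu>. (\<integral>\<^sup>+ p. ennreal ((norm (fst p - snd p))\<^sup>2) \<partial>\<pi>))"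

end

theory Submission
  imports Defs
begin

text \<open>
Both kernels are exponential families \<open>K y (dx) = exp (B y \<bullet> x - V x - \<Lambda> y) dx\<close> with \<open>V\<close> strongly convex.
Sample all the measures \<open>K y\<close> from the same uniform variables \<open>u\<close> by their Knothe-Rosenblatt maps
\<open>Q (y, u)\<close>. For two densities \<open>f\<close>, \<open>g\<close> sampled in this way by \<open>X\<close>, \<open>Y\<close>, the transport proof of the
Prekopa-Leindler inequality gives
\<open>E (p ((1 - t) X + t Y) f(X)^(t - 1) g(Y)^(- t)) \<le> \<integral> p\<close>; taking \<open>p = exp (- V)\<close> and logarithms yields
Talagrand's inequality \<open>E q (X - Y) \<le> 2 H(g | p)\<close> when \<open>f = p\<close> and \<open>V\<close> is strongly convex with respect to \<open>q\<close>.

Applied in both directions to \<open>K y\<close> and \<open>K y'\<close>, whose symmetrised entropy is \<open>E (B (y - y') \<bullet> (X - X'))\<close>,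
it gives \<open>E |X - X'|\<^sup>2 \<le> |B (y - y')|\<^sup>2 / c\<^sup>2\<close>, and from this \<open>H(K y | K y') \<le> |B (y - y')|\<^sup>2 / (2 c)\<close>.
The maps are jointly measurable in \<open>(y, u)\<close>, so these couplings glue, and joint convexity of the entropy
carries the bounds over to mixtures. The entropy contractions combine this with Talagrand's inequality for
\<open>\<mu>\<close> and for \<open>\<mu> K\<^sub>0\<close>, the latter being a marginal of a strongly log-concave joint law.
\<close>

section \<open>Quantile functions and the one-dimensional transport inequality\<close>

text \<open>Triangular maps take the place of optimal ones because they are explicit: each
  coordinate is a quantile function of a conditional law, so measurability in the parameter comes
  for free and the only analytic input is one-dimensional. The log-normaliser \<Lambda> is never
  differentiated: its increments cancel in the symmetrised entropy, and its convexity appears as the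
  nonnegativity of an entropy. Origin of the constants: the two kernels have potentials with
  convexity constants \<open>1 / \<rho>\<^sub>0\<close> and \<open>1 / \<rho>\<^sub>1\<close>, and
  both interaction terms are bounded by \<kappa>. A kernel with constant 1/r multiplies distances by
  \<kappa> r, hence b for a full step, and turns a squared distance into an entropy at the price
  \<kappa>^2 r / 2. Talagrand's inequality goes back at the price \<open>2 * \<rho>\<^sub>u\<close>
  for \<mu> and \<open>2 * \<rho>\<^sub>\<pi>\<close> for the intermediate law; the products are the
  two epsilons. The minima with 1 come from data processing. For the iterates the round trip is made
  only once, with n distance contractions in between, hence the factor a b^(2n).\<close>

lemma emeasure_le_lborel_of_intervals:
  fixes N :: "real measure"
  assumes sets_N[simp, measurable_cong]: "sets N = sets borel"
    and le: "\<And>c d. c \<le> d \<Longrightarrow> emeasure N {c..d} \<le> ennreal (d - c)"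
    and A[measurable]: "A \<in> sets borel"
  shows "emeasure N A \<le> emeasure lborel A"
proof -
  have bounded_case: "emeasure N A \<le> emeasure lborel A"
    if A[measurable]: "A \<in> sets borel" and sub: "A \<subseteq> {a..b}" and ab: "a < b" for A a b
  proof (rule ennreal_le_epsilon)
    fix e :: real assume "0 < e"
    \<comment> \<open>Put \<open>A\<close> into an open \<open>T\<close> of barely larger measure
      and tile it by countably many closed intervals inside \<open>T\<close>: \<open>N\<close>
      charges each tile at most its length, and the lengths add up to at most the measure of
      \<open>T\<close>.\<close>
    from outer_regular_lborel[OF A this]
    obtain T where T: "open T" "A \<subseteq> T" and Te: "emeasure lborel (T - A) < e" by metis
    \<comment> \<open>A tile contains a point \<open>x\<close> of \<open>A\<close> and lies in
      \<open>g x\<close>; this gauge therefore keeps every tile inside \<open>T\<close>.\<close>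
    define g where "g = (\<lambda>x. if x \<in> T then T else UNIV)"
    have g: "gauge g" using T(1) by (auto simp: gauge_def g_def)
    have sub': "A \<subseteq> cbox a b" and ne: "box a b \<noteq> {}" using sub ab by auto
    obtain D where D: "countable D" "\<And>K. K \<in> D \<Longrightarrow> interior K \<noteq> {} \<and> (\<exists>c d. K = cbox c d)"
        "pairwise (\<lambda>A B. interior A \<inter> interior B = {}) D"
        "\<And>K. K \<in> D \<Longrightarrow> \<exists>x\<in>A \<inter> K. K \<subseteq> g x" "A \<subseteq> \<Union>D"
      by (rule covering_lemma[OF sub' ne g]) blast
    have DT: "K \<subseteq> T" if K: "K \<in> D" for K
      proof -
      obtain x where "x \<in> A" "K \<subseteq> g x" using D(4)[OF K] by auto
      moreover from this have "x \<in> T" using T(2) by auto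
      ultimately show ?thesis by (simp add: g_def)
    qed
    have DK: "\<exists>c d. c \<le> d \<and> K = {c..d}" if "K \<in> D" for K
      using D(2)[OF that] interior_empty by (metis atLeastatMost_empty_iff2 box_real(2))
    have [measurable]: "K \<in> sets borel" if "K \<in> D" for K using DK[OF that] by auto
    \<comment> \<open>Tiles may share end points, so the sum is controlled through their pairwise
      disjoint interiors, which have the same lengths.\<close>
    have Kle: "emeasure N K \<le> emeasure lborel (interior K)" if K: "K \<in> D" for K
    proof -
      obtain c d where cd: "c \<le> d" "K = {c..d}" using DK[OF K] by auto
      then show ?thesis using le[OF cd(1)] by (simp add: interior_atLeastAtMost_real)
    qed
    have disj: "disjoint_family_on interior D"
      using D(3) by (auto simp: disjoint_family_on_def pairwise_def)
    have "emeasure N A = (\<integral>\<^sup>+x. indicator A x \<partial>N)" by simp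
    also have "\<dots> \<le> (\<integral>\<^sup>+x. (\<integral>\<^sup>+K. indicator K x \<partial>count_space D) \<partial>N)"
    proof (rule nn_integral_mono)
      fix x
      show "indicator A x \<le> (\<integral>\<^sup>+K. indicator K x \<partial>count_space D)"
      proof (cases "x \<in> A")
        case True
        then obtain K where "K \<in> D" "x \<in> K" using D(5) by blast
        then show ?thesis
          using nn_integral_ge_point[of K D "\<lambda>K. indicator K x"] by (simp add: indicator_def)
      qed simp
    qed
    also have "\<dots> = (\<integral>\<^sup>+K. emeasure N K \<partial>count_space D)"
      using D(1) by (subst nn_integral_count_space_nn_integral) (auto intro!: nn_integral_cong)
    also have "\<dots> \<le> (\<integral>\<^sup>+K. emeasure lborel (interior K) \<partial>count_space D)"
      by (intro nn_integral_mono) (auto intro!: Kle)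
    also have "\<dots> = emeasure lborel (\<Union>K\<in>D. interior K)"
      using disj D(1) by (intro emeasure_UN_countable[symmetric]) auto
    also have "\<dots> \<le> emeasure lborel T"
      proof (rule emeasure_mono)
      show "(\<Union>K\<in>D. interior K) \<subseteq> T" using DT interior_subset by fast
    qed (use T(1) in simp)
    also have "\<dots> \<le> emeasure lborel A + emeasure lborel (T - A)"
      using T by (subst plus_emeasure) (auto simp: Un_absorb1)
    also have "\<dots> \<le> emeasure lborel A + e"
      using Te by (intro add_left_mono) auto
    finally show "emeasure N A \<le> emeasure lborel A + ennreal e" .
  qed
  \<comment> \<open>The tiling requires a bounded set, so \<open>A\<close> is exhausted by bounded
    windows.\<close>
  have "A = (\<Union>n::nat. A \<inter> {-real n - 1..real n + 1})"
  proof -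
    have "\<exists>n::nat. x \<in> {-real n - 1..real n + 1}" for x :: real
    proof -
      obtain n :: nat where "\<bar>x\<bar> \<le> real n" using real_arch_simple by blast
      then show ?thesis by (intro exI[of _ n]) auto
    qed
    then show ?thesis by blast
  qed
  then have "emeasure N A = emeasure N (\<Union>n::nat. A \<inter> {-real n - 1..real n + 1})" by simp
  also have "\<dots> = (SUP n::nat. emeasure N (A \<inter> {-real n - 1..real n + 1}))"
    by (intro SUP_emeasure_incseq[symmetric]) (auto simp: incseq_def)
  also have "\<dots> \<le> emeasure lborel A"
  proof (rule SUP_least)
    fix n :: nat
    have "emeasure N (A \<inter> {-real n - 1..real n + 1}) \<le> emeasure lborel (A \<inter> {-real n - 1..real n + 1})"
      by (rule bounded_case[where a="-real n - 1" and b="real n + 1"]) auto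
    also have "\<dots> \<le> emeasure lborel A" by (intro emeasure_mono) auto
    finally show "emeasure N (A \<inter> {-real n - 1..real n + 1}) \<le> emeasure lborel A" .
  qed
  finally show ?thesis .
qed

lemma nn_integral_mono_emeasure:
  assumes sets: "sets M = sets N" and le: "\<And>A. A \<in> sets N \<Longrightarrow> emeasure M A \<le> emeasure N A"
  shows "(\<integral>\<^sup>+x. f x \<partial>M) \<le> (\<integral>\<^sup>+x. f x \<partial>N)"
  unfolding nn_integral_def
proof (rule SUP_mono)
  have sp: "space M = space N" using sets by (rule sets_eq_imp_space_eq)
  fix g assume g: "g \<in> {g. simple_function M g \<and> g \<le> f}"
  have sf: "simple_function N g"
    using g sets sp by (auto simp: simple_function_def)
  have "integral\<^sup>S M g \<le> integral\<^sup>S N g"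
    unfolding simple_integral_def sp
    using simple_functionD(2)[OF sf]
    by (intro sum_mono mult_left_mono le) auto
  then show "\<exists>g'\<in>{g. simple_function N g \<and> g \<le> f}. integral\<^sup>S M g \<le> integral\<^sup>S N g'"
    using sf g by auto
qed

lemma AE_density_pos_finite:
  assumes [measurable]: "f \<in> borel_measurable M" and int_f: "(\<integral>\<^sup>+x. f x \<partial>M) \<noteq> \<infinity>"
  shows "AE x in density M f. 0 < f x \<and> f x < \<infinity>"
proof -
  have "AE x in M. f x \<noteq> \<infinity>" using int_f by (intro nn_integral_noteq_infinite) auto
  then show ?thesis by (subst AE_density) (auto simp: less_top elim: eventually_mono)
qed

definition unif01 :: "real measure" where
  "unif01 = density lborel (indicator {0<..<1})"

text \<open>The generalised inverse of the distribution function. At levels outside the open unit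
  interval the set may be empty or unbounded below; 0 is a default value on a null set of
  \<open>unif01\<close>.\<close>

definition quantile :: "(real \<Rightarrow> ennreal) \<Rightarrow> real \<Rightarrow> real" where
  "quantile f u = (if 0 < u \<and> u < 1 then Inf {x. u \<le> cdf (density lborel f) x} else 0)"

lemma sets_unif01[simp, measurable_cong]: "sets unif01 = sets borel"
  and space_unif01[simp]: "space unif01 = UNIV"
  by (auto simp: unif01_def)

lemma prob_space_unif01: "prob_space unif01"
  by (intro prob_spaceI) (simp add: unif01_def emeasure_density)

lemma AE_unif01: "AE u in unif01. 0 < u \<and> u < 1"
  unfolding unif01_def by (subst AE_density) (auto simp: indicator_def)

context
  fixes f :: "real \<Rightarrow> ennreal"
  assumes f[measurable]: "f \<in> borel_measurable borel" and int_f: "(\<integral>\<^sup>+x. f x \<partial>lborel) = 1"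
begin

lemma cdf_distribution_density: "cdf_distribution (density lborel f)"
proof -
  have "prob_space (density lborel f)"
    by (intro prob_spaceI) (simp add: emeasure_density int_f)
  then show ?thesis
    unfolding cdf_distribution_def real_distribution_def real_distribution_axioms_def by simp
qed

text \<open>The Galois connection between a quantile function and its right-continuous distribution
  function. Monotonicity and measurability, also jointly with a parameter, are read off from
  it.\<close>

lemma quantile_le_iff:
  "0 < u \<Longrightarrow> u < 1 \<Longrightarrow> quantile f u \<le> x \<longleftrightarrow> u \<le> cdf (density lborel f) x"
proof -
  interpret cdf_distribution "density lborel f" by (rule cdf_distribution_density)
  show "0 < u \<Longrightarrow> u < 1 \<Longrightarrow> quantile f u \<le> x \<longleftrightarrow> u \<le> cdf (density lborel f) x"
    using pseudoinverse[of u x] by (simp add: quantile_def)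
qed

lemma quantile_mono: "0 < u \<Longrightarrow> u \<le> v \<Longrightarrow> v < 1 \<Longrightarrow> quantile f u \<le> quantile f v"
  using quantile_le_iff[of u "quantile f v"] quantile_le_iff[of v "quantile f v"] by auto

lemma borel_measurable_quantile[measurable]: "quantile f \<in> borel_measurable borel"
proof -
  interpret cdf_distribution "density lborel f" by (rule cdf_distribution_density)
  have eq: "{u. quantile f u \<le> a} =
     ({u. 0 < u \<and> u < 1} \<inter> {u. u \<le> C a}) \<union> ({u. \<not> (0 < u \<and> u < 1)} \<inter> {u. 0 \<le> a})" for a
    using quantile_le_iff[of _ a] by (auto simp: quantile_def)
  show ?thesis
    by (intro borel_measurableI_le) (simp add: eq del: Collect_conj_eq)
qed

lemma distr_quantile: "distr unif01 borel (quantile f) = density lborel f"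
proof -
  interpret cdf_distribution "density lborel f" by (rule cdf_distribution_density)
  have "distr unif01 borel (quantile f) = distr (restrict_space lborel {0<..<1::real}) borel I"
  proof (rule measure_eqI)
    fix A assume A: "A \<in> sets (distr unif01 borel (quantile f))"
    then have [measurable]: "A \<in> sets borel" by simp
    have "quantile f -` A \<in> sets borel"
      using measurable_sets_borel[OF borel_measurable_quantile \<open>A \<in> sets borel\<close>] .
    then have [measurable]: "quantile f -` A \<in> sets borel" .
    have "emeasure (distr unif01 borel (quantile f)) A = emeasure lborel ({0<..<1} \<inter> quantile f -` A)"
    proof -
      have "emeasure (distr unif01 borel (quantile f)) A = emeasure unif01 (quantile f -` A)"
        by (subst emeasure_distr) auto
      also have "\<dots> = (\<integral>\<^sup>+u. indicator {0<..<1} u * indicator (quantile f -` A) u \<partial>lborel)"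
        by (simp add: unif01_def emeasure_density)
      also have "\<dots> = (\<integral>\<^sup>+u. indicator ({0<..<1} \<inter> quantile f -` A) u \<partial>lborel)"
        by (simp add: indicator_inter_arith)
      finally show ?thesis by simp
    qed
    also have "{0<..<1} \<inter> quantile f -` A = I -` A \<inter> {0<..<1}"
      by (auto simp: quantile_def)
    also have "emeasure lborel (I -` A \<inter> {0<..<1}) = emeasure (restrict_space lborel {0<..<1}) (I -` A \<inter> {0<..<1})"
      by (subst emeasure_restrict_space) auto
    finally show "emeasure (distr unif01 borel (quantile f)) A
        = emeasure (distr (restrict_space lborel {0<..<1::real}) borel I) A"
      by (simp add: emeasure_distr space_restrict_space)
  qed simp
  then show ?thesis by (simp add: distr_I_eq_M)
qed

lemma nn_integral_quantile:
  "g \<in> borel_measurable borel \<Longrightarrow> (\<integral>\<^sup>+u. g (quantile f u) \<partial>unif01) = (\<integral>\<^sup>+x. f x * g x \<partial>lborel)"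
  using nn_integral_distr[of "quantile f" unif01 borel g]
  by (simp add: distr_quantile nn_integral_density)

text \<open>The image of \<open>du / f (X u)\<close> under \<open>X = quantile f\<close> is Lebesgue measure on \<open>{f > 0}\<close>.\<close>
lemma nn_integral_inverse_density_quantile:
  assumes J: "\<And>u. u \<in> J \<Longrightarrow> 0 < u \<and> u < 1 \<and> a \<le> quantile f u \<and> quantile f u \<le> b" and ab: "a \<le> b"
  shows "(\<integral>\<^sup>+u. inverse (f (quantile f u)) * indicator J u \<partial>unif01) \<le> ennreal (b - a)"
proof -
  have "(\<integral>\<^sup>+u. inverse (f (quantile f u)) * indicator J u \<partial>unif01)
     \<le> (\<integral>\<^sup>+u. (\<lambda>x. inverse (f x) * indicator {a..b} x) (quantile f u) \<partial>unif01)"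
    using J by (intro nn_integral_mono) (auto simp: indicator_def)
  also have "\<dots> = (\<integral>\<^sup>+x. f x * (inverse (f x) * indicator {a..b} x) \<partial>lborel)"
    by (rule nn_integral_quantile) measurable
  also have "\<dots> \<le> (\<integral>\<^sup>+x. indicator {a..b} x \<partial>lborel)"
  proof (intro nn_integral_mono)
    fix x
    have "f x * inverse (f x) \<le> 1"
      by (cases "f x = 0"; cases "f x = \<top>") (auto simp: ennreal_mult_divide_eq simp flip: divide_ennreal_def intro!: order_eq_refl ennreal_divide_self simp: less_top zero_less_iff_neq_zero)
    then show "f x * (inverse (f x) * indicator {a..b} x) \<le> indicator {a..b} x"
      by (auto simp: indicator_def)
  qed
  also have "\<dots> = ennreal (b - a)" using ab by simp
  finally show ?thesis .
qed

end

text \<open>By \<open>quantile_le_iff\<close> a sublevel set at the fixed height \<open>a\<close> is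
  described by the distribution function at \<open>a\<close> alone, and this is measurable in the
  parameter by Tonelli. The gluing of couplings rests on this joint measurability.\<close>

lemma measurable_quantile_param:
  assumes f[measurable]: "f \<in> borel_measurable (M \<Otimes>\<^sub>M borel)"
    and int_f: "\<And>\<theta>. \<theta> \<in> space M \<Longrightarrow> (\<integral>\<^sup>+y. f (\<theta>, y) \<partial>lborel) = 1"
  shows "(\<lambda>(\<theta>, u). quantile (\<lambda>y. f (\<theta>, y)) u) \<in> borel_measurable (M \<Otimes>\<^sub>M borel)"
proof (rule borel_measurableI_le)
  fix a :: real
  define C where "C = (\<lambda>\<theta>. enn2real (\<integral>\<^sup>+y. f (\<theta>, y) * indicator {..a} y \<partial>lborel))"
  have [measurable]: "C \<in> borel_measurable M" unfolding C_def by measurable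
  have Cc: "cdf (density lborel (\<lambda>y. f (\<theta>, y))) a = C \<theta>" if "\<theta> \<in> space M" for \<theta>
  proof -
    have [measurable]: "(\<lambda>y. f (\<theta>, y)) \<in> borel_measurable borel" using that by measurable
    show ?thesis by (simp add: cdf_def measure_def C_def emeasure_density)
  qed
  have "{w \<in> space (M \<Otimes>\<^sub>M borel). (case w of (\<theta>, u) \<Rightarrow> quantile (\<lambda>y. f (\<theta>, y)) u) \<le> a} =
     {w \<in> space (M \<Otimes>\<^sub>M borel). (0 < snd w \<and> snd w < 1 \<and> snd w \<le> C (fst w)) \<or> (\<not> (0 < snd w \<and> snd w < 1) \<and> 0 \<le> a)}"
  proof (intro Collect_cong conj_cong refl)
    fix w assume w: "w \<in> space (M \<Otimes>\<^sub>M (borel::real measure))"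
    obtain \<theta> u where [simp]: "w = (\<theta>, u)" by (cases w)
    from w have th: "\<theta> \<in> space M" by (auto simp: space_pair_measure)
    then have [measurable]: "(\<lambda>y. f (\<theta>, y)) \<in> borel_measurable borel" by measurable
    show "((case w of (\<theta>, u) \<Rightarrow> quantile (\<lambda>y. f (\<theta>, y)) u) \<le> a) =
      ((0 < snd w \<and> snd w < 1 \<and> snd w \<le> C (fst w)) \<or> (\<not> (0 < snd w \<and> snd w < 1) \<and> 0 \<le> a))"
      using quantile_le_iff[of "\<lambda>y. f (\<theta>, y)" u a] int_f[OF th] Cc[OF th]
      by (auto simp: quantile_def)
  qed
  also have "\<dots> \<in> sets (M \<Otimes>\<^sub>M borel)" by measurable
  finally show "{w \<in> space (M \<Otimes>\<^sub>M borel). (case w of (\<theta>, u) \<Rightarrow> quantile (\<lambda>y. f (\<theta>, y)) u) \<le> a} \<in> sets (M \<Otimes>\<^sub>M borel)" .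
qed

text \<open>Weighted arithmetic-geometric mean inequality for the reciprocals. In the smooth case
  they are the derivatives of the two quantile maps and the right side is the derivative of the
  interpolated map: this is the Jacobian estimate of the transport proof.\<close>

lemma weighted_am_gm_inverse:
  fixes a b t :: real
  assumes "0 < a" "0 < b" "0 < t" "t < 1"
  shows "a powr (t - 1) * b powr (- t) \<le> (1 - t) * inverse a + t * inverse b"
proof -
  have "(inverse a) powr (1 - t) * (inverse b) powr t \<le> (1 - t) * inverse a + t * inverse b"
    using assms Youngs_inequality_0[of "1-t" t "inverse a" "inverse b"] by auto
  moreover have "a powr (t - 1) = (inverse a) powr (1 - t)" "b powr (- t) = (inverse b) powr t"
    using assms by (simp_all add: powr_def ln_inverse algebra_simps)
  ultimately show ?thesis by simp
qed

text \<open>The factor a^(t - 1) b^(- t). The conventions of \<open>enn2real\<close> and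
  \<open>powr\<close> give it the value 0 when a or b is 0 or infinite, so that it is multiplicative
  without case distinctions.\<close>

definition pl_weight :: "real \<Rightarrow> ennreal \<Rightarrow> ennreal \<Rightarrow> ennreal" where
  "pl_weight t a b = ennreal (enn2real a powr (t - 1) * enn2real b powr (- t))"

lemma pl_weight_mult: "pl_weight t (a * c) (b * d) = pl_weight t a b * pl_weight t c d"
  by (simp add: pl_weight_def enn2real_mult powr_mult ennreal_mult[symmetric] mult_ac)

lemma measurable_pl_weight[measurable]:
  assumes [measurable]: "f \<in> borel_measurable M" "g \<in> borel_measurable M"
  shows "(\<lambda>x. pl_weight t (f x) (g x)) \<in> borel_measurable M"
  unfolding pl_weight_def by measurable

text \<open>The one-dimensional transport proof of the Prekopa-Leindler inequality. Instead of
  differentiating the monotone maps, one compares the image of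
  \<open>((1 - t) / f (X u) + t / g (X' u)) du\<close> under \<open>Z = (1 - t) X + t X'\<close> with Lebesgue measure
  on intervals.\<close>
lemma prekopa_leindler_quantile:
  fixes f g p :: "real \<Rightarrow> ennreal"
  assumes f[measurable]: "f \<in> borel_measurable borel" and int_f: "(\<integral>\<^sup>+x. f x \<partial>lborel) = 1"
    and g[measurable]: "g \<in> borel_measurable borel" and int_g: "(\<integral>\<^sup>+x. g x \<partial>lborel) = 1"
    and p[measurable]: "p \<in> borel_measurable borel" and t: "0 < t" "t < 1"
  shows "(\<integral>\<^sup>+u. p ((1 - t) * quantile f u + t * quantile g u) *
      pl_weight t (f (quantile f u)) (g (quantile g u)) \<partial>unif01)
    \<le> (\<integral>\<^sup>+x. p x \<partial>lborel)"
proof -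
  let ?X = "quantile f" and ?Y = "quantile g"
  define Z where "Z = (\<lambda>u. (1 - t) * ?X u + t * ?Y u)"
  define m where "m = (\<lambda>u. ennreal (1 - t) * inverse (f (?X u)) + ennreal t * inverse (g (?Y u)))"
  have [measurable]: "?X \<in> borel_measurable borel" "?Y \<in> borel_measurable borel"
    using borel_measurable_quantile[OF f int_f] borel_measurable_quantile[OF g int_g] by auto
  have [measurable]: "Z \<in> borel_measurable borel" "m \<in> borel_measurable borel"
    unfolding Z_def m_def by measurable
  have weight: "AE u in unif01. pl_weight t (f (?X u)) (g (?Y u)) \<le> m u"
  proof -
    have "AE x in density lborel f. 0 < f x \<and> f x < \<infinity>"
      using int_f by (intro AE_density_pos_finite) auto
    then have "AE u in unif01. 0 < f (?X u) \<and> f (?X u) < \<infinity>"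
      unfolding distr_quantile[OF f int_f, symmetric] by (subst (asm) AE_distr_iff) auto
    moreover
    have "AE x in density lborel g. 0 < g x \<and> g x < \<infinity>"
      using int_g by (intro AE_density_pos_finite) auto
    then have "AE u in unif01. 0 < g (?Y u) \<and> g (?Y u) < \<infinity>"
      unfolding distr_quantile[OF g int_g, symmetric] by (subst (asm) AE_distr_iff) auto
    ultimately show ?thesis
    proof eventually_elim
      case (elim u)
      define a b where "a = enn2real (f (?X u))" and "b = enn2real (g (?Y u))"
      have ab: "f (?X u) = ennreal a" "0 < a" "g (?Y u) = ennreal b" "0 < b"
        using elim by (auto simp: a_def b_def ennreal_enn2real less_top enn2real_positive_iff zero_less_iff_neq_zero)
      have "m u = ennreal ((1 - t) * inverse a + t * inverse b)"
        using ab t by (simp add: m_def inverse_ennreal ennreal_mult ennreal_plus)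
      then show ?case
        unfolding pl_weight_def a_def[symmetric] b_def[symmetric]
        using weighted_am_gm_inverse[of a b t] ab t by (simp only: ennreal_leI)
    qed
  qed
  define N where "N = distr (density unif01 m) borel Z"
  have N_int: "emeasure N {c..d} \<le> ennreal (d - c)" if cd: "c \<le> d" for c d
  proof -
    define J where "J = {u. 0 < u \<and> u < 1 \<and> c \<le> Z u \<and> Z u \<le> d}"
    have [measurable]: "J \<in> sets borel" unfolding J_def by measurable
    have "emeasure N {c..d} = (\<integral>\<^sup>+z. indicator {c..d} z \<partial>N)"
      by (simp add: N_def)
    also have "\<dots> = (\<integral>\<^sup>+u. m u * indicator {c..d} (Z u) \<partial>unif01)"
      by (simp add: N_def nn_integral_distr nn_integral_density del: nn_integral_indicator)
    also have "\<dots> = (\<integral>\<^sup>+u. m u * indicator J u \<partial>unif01)"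
      using AE_unif01 by (intro nn_integral_cong_AE) (auto simp: J_def indicator_def)
    also have "\<dots> = (\<integral>\<^sup>+u. ennreal (1 - t) * (inverse (f (?X u)) * indicator J u)
        + ennreal t * (inverse (g (?Y u)) * indicator J u) \<partial>unif01)"
      by (intro nn_integral_cong) (simp add: m_def algebra_simps)
    also have "\<dots> = ennreal (1 - t) * (\<integral>\<^sup>+u. inverse (f (?X u)) * indicator J u \<partial>unif01)
        + ennreal t * (\<integral>\<^sup>+u. inverse (g (?Y u)) * indicator J u \<partial>unif01)"
      by (subst nn_integral_add) (auto simp: nn_integral_cmult)
    also have "\<dots> \<le> ennreal (d - c)"
    proof (cases "J = {}")
      case False
      have mX: "?X u \<le> ?X v" and mY: "?Y u \<le> ?Y v" if "u \<in> J" "v \<in> J" "u \<le> v" for u v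
        using quantile_mono[OF f int_f, of u v] quantile_mono[OF g int_g, of u v] that by (auto simp: J_def)
      \<comment> \<open>The maps may jump, so their increments are not tied to the length of an
        interval. But both are monotone: passing to the common end points \<open>max v1 v2\<close>
        and \<open>min u1 u2\<close> only enlarges the two increments, whose weighted sum is then an
        increment of \<open>Z\<close> on \<open>J\<close>.\<close>
      have key: "(1 - t) * (?X v1 - ?X u1) + t * (?Y v2 - ?Y u2) \<le> d - c"
        if J: "v1 \<in> J" "u1 \<in> J" "v2 \<in> J" "u2 \<in> J" for v1 u1 v2 u2
      proof -
        define v u where "v = max v1 v2" and "u = min u1 u2"
        have "v \<in> J" "u \<in> J" using J by (auto simp: v_def u_def max_def min_def)
        then have "Z v - Z u \<le> d - c" by (auto simp: J_def)
        moreover have "?X v1 \<le> ?X v" "?X u \<le> ?X u1" "?Y v2 \<le> ?Y v" "?Y u \<le> ?Y u2"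
          using J \<open>v \<in> J\<close> \<open>u \<in> J\<close> by (auto intro!: mX mY simp: v_def u_def)
        then have "(1 - t) * (?X v1 - ?X u1) \<le> (1 - t) * (?X v - ?X u)" "t * (?Y v2 - ?Y u2) \<le> t * (?Y v - ?Y u)"
          using t by (auto intro!: mult_left_mono)
        ultimately show ?thesis by (simp add: Z_def algebra_simps)
      qed
      obtain u0 where u0: "u0 \<in> J" using False by auto
      have dX: "?X v - ?X u \<le> (d - c) / (1 - t)" and dY: "?Y v - ?Y u \<le> (d - c) / t" if "u \<in> J" "v \<in> J" for u v
        using key[of v u u0 u0] key[of u0 u0 v u] that u0 t by (auto simp: field_simps)
      have "bdd_above (?X ` J)" "bdd_below (?X ` J)"
        using dX[OF u0] dX[OF _ u0]
        by (auto intro!: bdd_aboveI2[where M="?X u0 + (d - c) / (1 - t)"]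
            bdd_belowI2[where m="?X u0 - (d - c) / (1 - t)"] simp: algebra_simps)
      moreover have "bdd_above (?Y ` J)" "bdd_below (?Y ` J)"
        using dY[OF u0] dY[OF _ u0]
        by (auto intro!: bdd_aboveI2[where M="?Y u0 + (d - c) / t"]
            bdd_belowI2[where m="?Y u0 - (d - c) / t"] simp: algebra_simps)
      ultimately have bdd: "bdd_above (?X ` J)" "bdd_below (?X ` J)" "bdd_above (?Y ` J)" "bdd_below (?Y ` J)"
        by auto
      define a1 b1 a2 b2 where "a1 = Inf (?X ` J)" and "b1 = Sup (?X ` J)"
        and "a2 = Inf (?Y ` J)" and "b2 = Sup (?Y ` J)"
      have i1: "(\<integral>\<^sup>+u. inverse (f (?X u)) * indicator J u \<partial>unif01) \<le> ennreal (b1 - a1)"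
        using bdd u0 by (intro nn_integral_inverse_density_quantile[OF f int_f])
          (auto simp: a1_def b1_def J_def intro!: cINF_lower cSUP_upper intro: order_trans[OF cINF_lower cSUP_upper])
      have i2: "(\<integral>\<^sup>+u. inverse (g (?Y u)) * indicator J u \<partial>unif01) \<le> ennreal (b2 - a2)"
        using bdd u0 by (intro nn_integral_inverse_density_quantile[OF g int_g])
          (auto simp: a2_def b2_def J_def intro!: cINF_lower cSUP_upper intro: order_trans[OF cINF_lower cSUP_upper])
      have ab: "a1 \<le> b1" "a2 \<le> b2"
        using bdd u0 by (auto simp: a1_def b1_def a2_def b2_def intro: order_trans[OF cINF_lower cSUP_upper])
      \<comment> \<open>Since the four points in \<open>key\<close> are independent of each other,
        each can be pushed to its supremum or infimum in turn; \<open>s5\<close> is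
        \<open>key\<close> with the two ranges in place of the two increments.\<close>
      have s1: "b1 \<le> ?X u1 + (d - c - t * (?Y v2 - ?Y u2)) / (1 - t)" if "u1 \<in> J" "v2 \<in> J" "u2 \<in> J" for u1 v2 u2
        unfolding b1_def using False key[of _ u1 v2 u2] that t by (intro cSUP_least) (auto simp: field_simps)
      have s2: "b1 - (d - c - t * (?Y v2 - ?Y u2)) / (1 - t) \<le> a1" if "v2 \<in> J" "u2 \<in> J" for v2 u2
        unfolding a1_def using False s1[of _ v2 u2] that by (intro cINF_greatest) (auto simp: algebra_simps)
      have s3: "b2 \<le> ?Y u2 + (d - c - (1 - t) * (b1 - a1)) / t" if "u2 \<in> J" for u2
        unfolding b2_def using False s2[of _ u2] that t by (intro cSUP_least) (auto simp: field_simps)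
      have s4: "b2 - (d - c - (1 - t) * (b1 - a1)) / t \<le> a2"
        unfolding a2_def using False s3 by (intro cINF_greatest) (auto simp: algebra_simps)
      then have s5: "(1 - t) * (b1 - a1) + t * (b2 - a2) \<le> d - c"
        using t by (simp add: field_simps)
      have "ennreal (1 - t) * (\<integral>\<^sup>+u. inverse (f (?X u)) * indicator J u \<partial>unif01)
        + ennreal t * (\<integral>\<^sup>+u. inverse (g (?Y u)) * indicator J u \<partial>unif01)
        \<le> ennreal (1 - t) * ennreal (b1 - a1) + ennreal t * ennreal (b2 - a2)"
        by (intro add_mono mult_left_mono i1 i2) auto
      also have "\<dots> = ennreal ((1 - t) * (b1 - a1) + t * (b2 - a2))"
        using ab t by (simp add: ennreal_mult ennreal_plus)
      also have "\<dots> \<le> ennreal (d - c)" using s5 by (rule ennreal_leI)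
      finally show ?thesis .
    qed simp
    finally show ?thesis .
  qed
  have "(\<integral>\<^sup>+u. p (Z u) * pl_weight t (f (?X u)) (g (?Y u)) \<partial>unif01)
     \<le> (\<integral>\<^sup>+u. p (Z u) * m u \<partial>unif01)"
    using weight by (intro nn_integral_mono_AE) (auto intro!: mult_left_mono)
  also have "\<dots> = (\<integral>\<^sup>+x. p x \<partial>N)"
    unfolding N_def by (simp add: nn_integral_distr nn_integral_density mult.commute)
  also have "\<dots> \<le> (\<integral>\<^sup>+x. p x \<partial>lborel)"
    by (intro nn_integral_mono_emeasure emeasure_le_lborel_of_intervals) (auto simp: N_def[symmetric] intro: N_int, simp_all add: N_def)
  finally show ?thesis by (simp add: Z_def)
qed

section \<open>The Knothe-Rosenblatt coupling\<close>

lemma product_sigma_finite_unif01: "product_sigma_finite (\<lambda>_::'i. unif01)"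
  by (simp add: product_sigma_finite_def prob_space_unif01 prob_space_imp_sigma_finite)

lemma prob_space_PiM_unif01: "prob_space (PiM I (\<lambda>_. unif01))"
  by (intro prob_space_PiM prob_space_unif01)

lemma mult_divide_cancel_ennreal: "0 < a \<Longrightarrow> a < \<infinity> \<Longrightarrow> a * (b / a) = (b::ennreal)"
  by (simp add: ennreal_times_divide mult.commute[of a] mult_divide_eq_ennreal)

text \<open>The Knothe-Rosenblatt map: the coordinates are sampled one after the other by the quantile
  functions of the conditional densities, from independent uniform variables. Both the law of the
  sample and the Prekopa-Leindler inequality factor along the coordinates.\<close>
lemma knothe_rosenblatt_PiM:
  fixes f :: "'p \<times> ('i \<Rightarrow> real) \<Rightarrow> ennreal"
  assumes "finite I"
    and "f \<in> borel_measurable (M \<Otimes>\<^sub>M PiM I (\<lambda>_. lborel))"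
    and "\<And>\<theta>. \<theta> \<in> space M \<Longrightarrow> (\<integral>\<^sup>+x. f (\<theta>, x) \<partial>PiM I (\<lambda>_. lborel)) = 1"
  shows "\<exists>Q. Q \<in> measurable (M \<Otimes>\<^sub>M PiM I (\<lambda>_. unif01)) (PiM I (\<lambda>_. lborel)) \<and>
    (\<forall>\<theta>\<in>space M. \<forall>h\<in>borel_measurable (PiM I (\<lambda>_. lborel)).
      (\<integral>\<^sup>+u. h (Q (\<theta>, u)) \<partial>PiM I (\<lambda>_. unif01)) = (\<integral>\<^sup>+x. f (\<theta>, x) * h x \<partial>PiM I (\<lambda>_. lborel))) \<and>
    (\<forall>\<theta>\<in>space M. \<forall>\<eta>\<in>space M. \<forall>t p. 0 < t \<longrightarrow> t < 1 \<longrightarrow> p \<in> borel_measurable (PiM I (\<lambda>_. lborel)) \<longrightarrow>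
      (\<integral>\<^sup>+u. p (\<lambda>i\<in>I. (1 - t) * Q (\<theta>, u) i + t * Q (\<eta>, u) i) *
          pl_weight t (f (\<theta>, Q (\<theta>, u))) (f (\<eta>, Q (\<eta>, u))) \<partial>PiM I (\<lambda>_. unif01))
        \<le> (\<integral>\<^sup>+x. p x \<partial>PiM I (\<lambda>_. lborel)))"
  using assms
proof (induction I arbitrary: f rule: finite_induct)
  case empty
  interpret L: product_sigma_finite "\<lambda>_::'i. lborel :: real measure" by standard
  interpret U: product_sigma_finite "\<lambda>_::'i. unif01" by (rule product_sigma_finite_unif01)
  have f1: "f (\<theta>, \<lambda>_. undefined) = 1" if "\<theta> \<in> space M" for \<theta>
    using empty(2)[OF that] by (simp add: L.nn_integral_empty)
  show ?case
    by (intro exI[of _ "\<lambda>_. \<lambda>_. undefined"])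
       (auto simp: L.nn_integral_empty U.nn_integral_empty f1 pl_weight_def space_PiM restrict_def)
next
  case (insert i I)
  let ?L = "\<lambda>I. PiM I (\<lambda>_::'i. lborel :: real measure)" and ?U = "\<lambda>I. PiM I (\<lambda>_::'i. unif01)"
  interpret L: product_sigma_finite "\<lambda>_::'i. lborel :: real measure" by standard
  interpret U: product_sigma_finite "\<lambda>_::'i. unif01" by (rule product_sigma_finite_unif01)
  interpret LI: sigma_finite_measure "?L I" using L.sigma_finite[OF insert(1)] .
  note f[measurable] = insert.prems(1)
  have upd[measurable]: "(\<lambda>w. (X w)(i := Y w)) \<in> measurable N (?L (insert i I))"
    if "X \<in> measurable N (?L I)" "Y \<in> measurable N borel" for N :: "'n measure" and X Y
    using that by (intro measurable_fun_upd[where J=I]) auto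
  have upd1[measurable]: "(\<lambda>w. (X w)(i := Y w)) \<in> measurable N (?L (insert i I))"
    if "X \<in> measurable N (?L I)" "Y \<in> measurable N borel" for N :: "real measure" and X Y
    using that by (intro measurable_fun_upd[where J=I]) auto
  define f1 where "f1 = (\<lambda>w. \<integral>\<^sup>+y. f (fst w, (snd w)(i := y)) \<partial>lborel)"
  \<comment> \<open>\<open>f1\<close> is the marginal density of the coordinates in \<open>I\<close>
    and \<open>f2\<close> the conditional density of coordinate \<open>i\<close>. Where the marginal
    is 0 or infinite, the uniform density is substituted: \<open>measurable_quantile_param\<close>
    asks for a probability density at every parameter.\<close>
  define f2 where "f2 = (\<lambda>z. if 0 < f1 (fst z) \<and> f1 (fst z) < \<infinity>
      then f (fst (fst z), (snd (fst z))(i := snd z)) / f1 (fst z) else indicator {0<..<1} (snd z))"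
  have f1m[measurable]: "f1 \<in> borel_measurable (M \<Otimes>\<^sub>M ?L I)"
    unfolding f1_def by measurable
  have f2m[measurable]: "f2 \<in> borel_measurable ((M \<Otimes>\<^sub>M ?L I) \<Otimes>\<^sub>M borel)"
    unfolding f2_def by measurable
  have fx[measurable]: "(\<lambda>y. f (\<theta>, x(i := y))) \<in> borel_measurable borel" if "\<theta> \<in> space M" "x \<in> space (?L I)" for \<theta> x
    using that by measurable
  have int_f1: "(\<integral>\<^sup>+x. f1 (\<theta>, x) \<partial>?L I) = 1" if "\<theta> \<in> space M" for \<theta>
    using insert.prems(2)[OF that] that insert.hyps
    by (simp add: f1_def L.product_nn_integral_insert)
  have int_f2: "(\<integral>\<^sup>+y. f2 (w, y) \<partial>lborel) = 1" if "w \<in> space (M \<Otimes>\<^sub>M ?L I)" for w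
  proof (cases "0 < f1 w \<and> f1 w < \<infinity>")
    case True
    have [measurable]: "(\<lambda>y. f (fst w, (snd w)(i := y))) \<in> borel_measurable borel"
      using that by (intro fx) (auto simp: space_pair_measure)
    have "(\<integral>\<^sup>+y. f2 (w, y) \<partial>lborel) = f1 w / f1 w"
      using True by (simp add: f2_def f1_def nn_integral_divide)
    also have "\<dots> = 1" using True by (intro ennreal_divide_self) auto
    finally show ?thesis .
  next
    case False
    then have "f2 (w, y) = indicator {0<..<1} y" for y by (auto simp: f2_def)
    then show ?thesis by simp
  qed
  have f_split: "f (\<theta>, x(i := y)) = f1 (\<theta>, x) * f2 ((\<theta>, x), y)" if "0 < f1 (\<theta>, x)" "f1 (\<theta>, x) < \<infinity>" for \<theta> x y
    using that by (simp add: f2_def mult_divide_cancel_ennreal)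
  \<comment> \<open>The induction hypothesis is applied to the marginal, with the parameter space
    unchanged.\<close>
  obtain Q1 where Q1[measurable]: "Q1 \<in> measurable (M \<Otimes>\<^sub>M ?U I) (?L I)"
    and Q1_law: "\<And>\<theta> h. \<theta> \<in> space M \<Longrightarrow> h \<in> borel_measurable (?L I) \<Longrightarrow>
      (\<integral>\<^sup>+u. h (Q1 (\<theta>, u)) \<partial>?U I) = (\<integral>\<^sup>+x. f1 (\<theta>, x) * h x \<partial>?L I)"
    and Q1_pl: "\<And>\<theta> \<eta> t p. \<theta> \<in> space M \<Longrightarrow> \<eta> \<in> space M \<Longrightarrow> 0 < t \<Longrightarrow> t < 1 \<Longrightarrow> p \<in> borel_measurable (?L I) \<Longrightarrow>
      (\<integral>\<^sup>+u. p (\<lambda>i\<in>I. (1 - t) * Q1 (\<theta>, u) i + t * Q1 (\<eta>, u) i) *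
          pl_weight t (f1 (\<theta>, Q1 (\<theta>, u))) (f1 (\<eta>, Q1 (\<eta>, u))) \<partial>?U I) \<le> (\<integral>\<^sup>+x. p x \<partial>?L I)"
    by (rule exE[OF insert.IH[OF f1m int_f1]], assumption)
      (elim conjE, rule that, assumption, blast, blast)
  have Q1_space: "Q1 (\<theta>, u) \<in> space (?L I)" if "\<theta> \<in> space M" "u \<in> space (?U I)" for \<theta> u
    using measurable_space[OF Q1, of "(\<theta>, u)"] that by (simp add: space_pair_measure)
  \<comment> \<open>For the new coordinate the values already sampled join the parameter.\<close>
  define Q2 where "Q2 = (\<lambda>(w, u). quantile (\<lambda>y. f2 (w, y)) u)"
  have [measurable]: "Q2 \<in> borel_measurable ((M \<Otimes>\<^sub>M ?L I) \<Otimes>\<^sub>M borel)"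
    unfolding Q2_def by (rule measurable_quantile_param[OF f2m int_f2])
  define Q where "Q = (\<lambda>(\<theta>, u). let x = Q1 (\<theta>, restrict u I) in x(i := Q2 ((\<theta>, x), u i)))"
  have Q[measurable]: "Q \<in> measurable (M \<Otimes>\<^sub>M ?U (insert i I)) (?L (insert i I))"
    unfolding Q_def Let_def by measurable
  have Q_upd: "Q (\<theta>, w(i := v)) = (Q1 (\<theta>, w))(i := quantile (\<lambda>y. f2 ((\<theta>, Q1 (\<theta>, w)), y)) v)"
    if "w \<in> space (?U I)" for \<theta> w v
  proof -
    have "restrict (w(i := v)) I = w"
      using that insert.hyps by (auto simp: space_PiM PiE_iff restrict_def extensional_def fun_eq_iff)
    then show ?thesis by (simp add: Q_def Q2_def Let_def)
  qed
  have f2x[measurable]: "(\<lambda>y. f2 ((\<theta>, x), y)) \<in> borel_measurable borel" and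
    int_f2x: "(\<integral>\<^sup>+y. f2 ((\<theta>, x), y) \<partial>lborel) = 1" if "\<theta> \<in> space M" "x \<in> space (?L I)" for \<theta> x
  proof -
    have "(\<theta>, x) \<in> space (M \<Otimes>\<^sub>M ?L I)" using that by (simp add: space_pair_measure)
    then show "(\<lambda>y. f2 ((\<theta>, x), y)) \<in> borel_measurable borel" "(\<integral>\<^sup>+y. f2 ((\<theta>, x), y) \<partial>lborel) = 1"
      using int_f2 by measurable
  qed
  have finite_f1: "AE x in ?L I. f1 (\<theta>, x) \<noteq> \<infinity>" if "\<theta> \<in> space M" for \<theta>
    using that int_f1[OF that] by (intro nn_integral_noteq_infinite) auto
  have pos_f1: "AE u in ?U I. 0 < f1 (\<theta>, Q1 (\<theta>, u)) \<and> f1 (\<theta>, Q1 (\<theta>, u)) < \<infinity>" if th: "\<theta> \<in> space M" for \<theta>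
  proof -
    define h :: "('i \<Rightarrow> real) \<Rightarrow> ennreal" where "h = (\<lambda>x. if 0 < f1 (\<theta>, x) \<and> f1 (\<theta>, x) < \<infinity> then 0 else 1)"
    have [measurable]: "h \<in> borel_measurable (?L I)" unfolding h_def using th by measurable
    have "(\<integral>\<^sup>+u. h (Q1 (\<theta>, u)) \<partial>?U I) = (\<integral>\<^sup>+x. f1 (\<theta>, x) * h x \<partial>?L I)"
      by (rule Q1_law[OF th]) simp
    also have "\<dots> = (\<integral>\<^sup>+x. 0 \<partial>?L I)"
      using finite_f1[OF th] by (intro nn_integral_cong_AE) (auto simp: h_def less_top elim!: eventually_mono)
    finally have "(\<integral>\<^sup>+u. h (Q1 (\<theta>, u)) \<partial>?U I) = 0" by simp
    then have "AE u in ?U I. h (Q1 (\<theta>, u)) = 0"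
      using th by (subst (asm) nn_integral_0_iff_AE) auto
    then show ?thesis by (rule eventually_mono) (auto simp: h_def split: if_splits)
  qed
  have law: "(\<integral>\<^sup>+u. h (Q (\<theta>, u)) \<partial>?U (insert i I)) = (\<integral>\<^sup>+x. f (\<theta>, x) * h x \<partial>?L (insert i I))"
    if th[measurable]: "\<theta> \<in> space M" and h[measurable]: "h \<in> borel_measurable (?L (insert i I))" for \<theta> h
  proof -
    have hx[measurable]: "(\<lambda>y. h (x(i := y))) \<in> borel_measurable borel" if "x \<in> space (?L I)" for x
      using that by measurable
    have "(\<integral>\<^sup>+u. h (Q (\<theta>, u)) \<partial>?U (insert i I)) = (\<integral>\<^sup>+w. \<integral>\<^sup>+v. h (Q (\<theta>, w(i := v))) \<partial>unif01 \<partial>?U I)"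
      using insert.hyps by (intro U.product_nn_integral_insert) auto
    also have "\<dots> = (\<integral>\<^sup>+w. (\<lambda>x. \<integral>\<^sup>+y. f2 ((\<theta>, x), y) * h (x(i := y)) \<partial>lborel) (Q1 (\<theta>, w)) \<partial>?U I)"
    proof (rule nn_integral_cong)
      fix w assume w: "w \<in> space (?U I)"
      show "(\<integral>\<^sup>+v. h (Q (\<theta>, w(i := v))) \<partial>unif01)
        = (\<lambda>x. \<integral>\<^sup>+y. f2 ((\<theta>, x), y) * h (x(i := y)) \<partial>lborel) (Q1 (\<theta>, w))"
        unfolding Q_upd[OF w]
        using nn_integral_quantile[OF f2x int_f2x hx, OF th Q1_space[OF th w] th Q1_space[OF th w] Q1_space[OF th w]]
        by simp
    qed
    also have "\<dots> = (\<integral>\<^sup>+x. f1 (\<theta>, x) * (\<integral>\<^sup>+y. f2 ((\<theta>, x), y) * h (x(i := y)) \<partial>lborel) \<partial>?L I)"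
      by (rule Q1_law[OF th]) measurable
    also have "\<dots> = (\<integral>\<^sup>+x. (\<integral>\<^sup>+y. f (\<theta>, x(i := y)) * h (x(i := y)) \<partial>lborel) \<partial>?L I)"
    proof (rule nn_integral_cong_AE)
      show "AE x in ?L I. f1 (\<theta>, x) * (\<integral>\<^sup>+y. f2 ((\<theta>, x), y) * h (x(i := y)) \<partial>lborel)
        = (\<integral>\<^sup>+y. f (\<theta>, x(i := y)) * h (x(i := y)) \<partial>lborel)"
        using finite_f1[OF th] AE_space
      proof eventually_elim
        case (elim x)
        note [measurable] = fx[OF th elim(2)] hx[OF elim(2)] f2x[OF th elim(2)]
        show ?case
        \<comment> \<open>Here the substitute density was used, but \<open>f\<close> itself vanishes
          for almost every value of the new coordinate, so both sides are 0.\<close>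
        proof (cases "f1 (\<theta>, x) = 0")
          case True
          then have "AE y in lborel. f (\<theta>, x(i := y)) = 0"
            by (subst (asm) f1_def) (simp add: nn_integral_0_iff_AE)
          then have "(\<integral>\<^sup>+y. f (\<theta>, x(i := y)) * h (x(i := y)) \<partial>lborel) = (\<integral>\<^sup>+y. 0 \<partial>(lborel :: real measure))"
            by (intro nn_integral_cong_AE) auto
          then show ?thesis using True by simp
        next
          case False
          then have "0 < f1 (\<theta>, x)" "f1 (\<theta>, x) < \<infinity>" using elim by (auto simp: zero_less_iff_neq_zero less_top)
          then show ?thesis by (simp add: f_split nn_integral_cmult[symmetric] mult.assoc)
        qed
      qed
    qed
    also have "\<dots> = (\<integral>\<^sup>+x. f (\<theta>, x) * h x \<partial>?L (insert i I))"
      using insert.hyps by (intro L.product_nn_integral_insert[symmetric]) auto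
    finally show ?thesis .
  qed
  have pl: "(\<integral>\<^sup>+u. p (\<lambda>j\<in>insert i I. (1 - t) * Q (\<theta>, u) j + t * Q (\<eta>, u) j) *
          pl_weight t (f (\<theta>, Q (\<theta>, u))) (f (\<eta>, Q (\<eta>, u))) \<partial>?U (insert i I))
        \<le> (\<integral>\<^sup>+x. p x \<partial>?L (insert i I))"
    if th[measurable]: "\<theta> \<in> space M" and et[measurable]: "\<eta> \<in> space M" and t: "0 < t" "t < 1"
      and p[measurable]: "p \<in> borel_measurable (?L (insert i I))" for \<theta> \<eta> t p
  proof -
    define Z where "Z = (\<lambda>w. \<lambda>j\<in>I. (1 - t) * Q1 (\<theta>, w) j + t * Q1 (\<eta>, w) j)"
    have Qm: "(\<lambda>u. Q (\<theta>, u)) \<in> measurable (?U (insert i I)) (?L (insert i I))" if "\<theta> \<in> space M" for \<theta>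
      using that by measurable
    have Qc: "(\<lambda>u. Q (\<theta>, u) j) \<in> measurable (?U (insert i I)) lborel" if "\<theta> \<in> space M" "j \<in> insert i I" for \<theta> j
      by (rule measurable_compose[OF Qm[OF that(1)] measurable_component_singleton[OF that(2)]])
    have [measurable]: "(\<lambda>u. \<lambda>j\<in>insert i I. (1 - t) * Q (\<theta>, u) j + t * Q (\<eta>, u) j)
        \<in> measurable (?U (insert i I)) (?L (insert i I))"
      using Qc[OF th] Qc[OF et] by (intro measurable_restrict) simp
    have Fm: "(\<lambda>u. p (\<lambda>j\<in>insert i I. (1 - t) * Q (\<theta>, u) j + t * Q (\<eta>, u) j) *
          pl_weight t (f (\<theta>, Q (\<theta>, u))) (f (\<eta>, Q (\<eta>, u)))) \<in> borel_measurable (?U (insert i I))"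
      by measurable
    have Zw: "Z w \<in> space (?L I)" for w by (simp add: Z_def space_PiM)
    \<comment> \<open>Tensorisation: for fixed earlier coordinates the one-dimensional inequality
      integrates \<open>p\<close> out along coordinate \<open>i\<close>, which leaves
      \<open>P\<close>; the weights split into a marginal and a conditional factor, and the marginal
      factor is handled by the induction hypothesis for \<open>P\<close>.\<close>
    define P where "P = (\<lambda>x. \<integral>\<^sup>+y. p (x(i := y)) \<partial>lborel)"
    have [measurable]: "P \<in> borel_measurable (?L I)" unfolding P_def by measurable
    have "(\<integral>\<^sup>+u. p (\<lambda>j\<in>insert i I. (1 - t) * Q (\<theta>, u) j + t * Q (\<eta>, u) j) *
          pl_weight t (f (\<theta>, Q (\<theta>, u))) (f (\<eta>, Q (\<eta>, u))) \<partial>?U (insert i I))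
       = (\<integral>\<^sup>+w. \<integral>\<^sup>+v. p (\<lambda>j\<in>insert i I. (1 - t) * Q (\<theta>, w(i := v)) j + t * Q (\<eta>, w(i := v)) j) *
          pl_weight t (f (\<theta>, Q (\<theta>, w(i := v)))) (f (\<eta>, Q (\<eta>, w(i := v)))) \<partial>unif01 \<partial>?U I)"
      by (rule U.product_nn_integral_insert[OF insert.hyps Fm])
    also have "\<dots> \<le> (\<integral>\<^sup>+w. P (Z w) * pl_weight t (f1 (\<theta>, Q1 (\<theta>, w))) (f1 (\<eta>, Q1 (\<eta>, w))) \<partial>?U I)"
    proof (rule nn_integral_mono_AE)
      show "AE w in ?U I. (\<integral>\<^sup>+v. p (\<lambda>j\<in>insert i I. (1 - t) * Q (\<theta>, w(i := v)) j + t * Q (\<eta>, w(i := v)) j) *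
          pl_weight t (f (\<theta>, Q (\<theta>, w(i := v)))) (f (\<eta>, Q (\<eta>, w(i := v)))) \<partial>unif01)
        \<le> P (Z w) * pl_weight t (f1 (\<theta>, Q1 (\<theta>, w))) (f1 (\<eta>, Q1 (\<eta>, w)))"
        using pos_f1[OF th] pos_f1[OF et] AE_space
      proof eventually_elim
        case (elim w)
        define x y where "x = Q1 (\<theta>, w)" and "y = Q1 (\<eta>, w)"
        have xy: "x \<in> space (?L I)" "y \<in> space (?L I)"
          using Q1_space elim(3) th et by (auto simp: x_def y_def)
        let ?g = "\<lambda>z. f2 ((\<theta>, x), z)" and ?k = "\<lambda>z. f2 ((\<eta>, y), z)"
        have px[measurable]: "(\<lambda>z. p ((Z w)(i := z))) \<in> borel_measurable borel"
          using Zw by measurable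
        note [measurable] = f2x[OF th xy(1)] f2x[OF et xy(2)]
        have [measurable]: "quantile ?g \<in> borel_measurable borel" "quantile ?k \<in> borel_measurable borel"
          using th et xy by (auto intro!: borel_measurable_quantile int_f2x)
        have comb: "(\<lambda>j\<in>insert i I. (1 - t) * (x(i := a)) j + t * (y(i := b)) j) = (Z w)(i := (1 - t) * a + t * b)" for a b
          using insert.hyps by (auto simp: Z_def x_def y_def fun_eq_iff)
        have "(\<integral>\<^sup>+v. p (\<lambda>j\<in>insert i I. (1 - t) * Q (\<theta>, w(i := v)) j + t * Q (\<eta>, w(i := v)) j) *
            pl_weight t (f (\<theta>, Q (\<theta>, w(i := v)))) (f (\<eta>, Q (\<eta>, w(i := v)))) \<partial>unif01)
          = (\<integral>\<^sup>+v. pl_weight t (f1 (\<theta>, x)) (f1 (\<eta>, y)) *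
             (p ((Z w)(i := (1 - t) * quantile ?g v + t * quantile ?k v)) *
              pl_weight t (?g (quantile ?g v)) (?k (quantile ?k v))) \<partial>unif01)"
          unfolding Q_upd[OF elim(3)] x_def[symmetric] y_def[symmetric] comb
          using elim by (simp add: f_split x_def[symmetric] y_def[symmetric] pl_weight_mult mult_ac)
        also have "\<dots> = pl_weight t (f1 (\<theta>, x)) (f1 (\<eta>, y)) *
           (\<integral>\<^sup>+v. p ((Z w)(i := (1 - t) * quantile ?g v + t * quantile ?k v)) *
              pl_weight t (?g (quantile ?g v)) (?k (quantile ?k v)) \<partial>unif01)"
          by (intro nn_integral_cmult) measurable
        also have "\<dots> \<le> pl_weight t (f1 (\<theta>, x)) (f1 (\<eta>, y)) * P (Z w)"
          unfolding P_def using th et xy t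
          by (intro mult_left_mono prekopa_leindler_quantile[of ?g ?k "\<lambda>z. p ((Z w)(i := z))" t] int_f2x) auto
        finally show ?case by (simp add: x_def y_def mult.commute)
      qed
    qed
    also have "\<dots> \<le> (\<integral>\<^sup>+x. P x \<partial>?L I)"
      using Q1_pl[OF th et t, of P] by (simp add: Z_def)
    also have "\<dots> = (\<integral>\<^sup>+x. p x \<partial>?L (insert i I))"
      unfolding P_def using insert.hyps by (intro L.product_nn_integral_insert[symmetric]) auto
    finally show ?thesis .
  qed
  show ?case
    using Q law pl by (intro exI[of _ Q]) blast
qed

definition basis_sum :: "('a::euclidean_space \<Rightarrow> real) \<Rightarrow> 'a" where
  "basis_sum x = (\<Sum>b\<in>Basis. x b *\<^sub>R b)"

lemma measurable_basis_sum[measurable]: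
  "basis_sum \<in> borel_measurable (PiM Basis (\<lambda>_. lborel))"
  unfolding basis_sum_def by measurable

lemma nn_integral_lborel_basis_sum:
  "h \<in> borel_measurable borel \<Longrightarrow>
    (\<integral>\<^sup>+x. h x \<partial>lborel) = (\<integral>\<^sup>+x. h (basis_sum x) \<partial>PiM Basis (\<lambda>_. lborel))"
  using nn_integral_distr[of basis_sum "PiM Basis (\<lambda>_. lborel)" borel h]
  by (subst lborel_eq) (simp add: basis_sum_def[abs_def, symmetric])

text \<open>\<open>basis_sum\<close> carries convex combinations of coordinate functions to convex
  combinations of vectors and the product measure to Lebesgue measure, so the product version
  transfers unchanged.\<close>

lemma knothe_rosenblatt:
  fixes f :: "'p \<times> 'a::euclidean_space \<Rightarrow> ennreal"
  assumes f[measurable]: "f \<in> borel_measurable (M \<Otimes>\<^sub>M borel)"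
    and int_f: "\<And>\<theta>. \<theta> \<in> space M \<Longrightarrow> (\<integral>\<^sup>+x. f (\<theta>, x) \<partial>lborel) = 1"
  obtains N :: "('a \<Rightarrow> real) measure" and Q where "prob_space N"
    and "Q \<in> borel_measurable (M \<Otimes>\<^sub>M N)"
    and "\<And>\<theta> h. \<theta> \<in> space M \<Longrightarrow> h \<in> borel_measurable borel \<Longrightarrow>
      (\<integral>\<^sup>+u. h (Q (\<theta>, u)) \<partial>N) = (\<integral>\<^sup>+x. f (\<theta>, x) * h x \<partial>lborel)"
    and "\<And>\<theta> \<eta> t p. \<theta> \<in> space M \<Longrightarrow> \<eta> \<in> space M \<Longrightarrow> 0 < t \<Longrightarrow> t < 1 \<Longrightarrow> p \<in> borel_measurable borel \<Longrightarrow>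
      (\<integral>\<^sup>+u. p ((1 - t) *\<^sub>R Q (\<theta>, u) + t *\<^sub>R Q (\<eta>, u)) *
          pl_weight t (f (\<theta>, Q (\<theta>, u))) (f (\<eta>, Q (\<eta>, u))) \<partial>N) \<le> (\<integral>\<^sup>+x. p x \<partial>lborel)"
proof -
  let ?L = "PiM (Basis::'a set) (\<lambda>_. lborel :: real measure)" and ?U = "PiM (Basis::'a set) (\<lambda>_. unif01)"
  define f' where "f' = (\<lambda>(\<theta>, x). f (\<theta>, basis_sum x))"
  have f'm[measurable]: "f' \<in> borel_measurable (M \<Otimes>\<^sub>M ?L)"
    unfolding f'_def by measurable
  have int_f': "(\<integral>\<^sup>+x. f' (\<theta>, x) \<partial>?L) = 1" if "\<theta> \<in> space M" for \<theta>
    using int_f[OF that] that by (simp add: f'_def nn_integral_lborel_basis_sum)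
  obtain Q where Q[measurable]: "Q \<in> measurable (M \<Otimes>\<^sub>M ?U) ?L"
    and law: "\<And>\<theta> h. \<theta> \<in> space M \<Longrightarrow> h \<in> borel_measurable ?L \<Longrightarrow>
      (\<integral>\<^sup>+u. h (Q (\<theta>, u)) \<partial>?U) = (\<integral>\<^sup>+x. f' (\<theta>, x) * h x \<partial>?L)"
    and pl: "\<And>\<theta> \<eta> t p. \<theta> \<in> space M \<Longrightarrow> \<eta> \<in> space M \<Longrightarrow> 0 < t \<Longrightarrow> t < 1 \<Longrightarrow> p \<in> borel_measurable ?L \<Longrightarrow>
      (\<integral>\<^sup>+u. p (\<lambda>i\<in>Basis. (1 - t) * Q (\<theta>, u) i + t * Q (\<eta>, u) i) *
          pl_weight t (f' (\<theta>, Q (\<theta>, u))) (f' (\<eta>, Q (\<eta>, u))) \<partial>?U) \<le> (\<integral>\<^sup>+x. p x \<partial>?L)"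
    by (rule exE[OF knothe_rosenblatt_PiM[OF finite_Basis f'm int_f']], assumption)
      (elim conjE, rule that, assumption, blast, blast)
  show thesis
  proof
    show "prob_space ?U" by (rule prob_space_PiM_unif01)
    show "(\<lambda>w. basis_sum (Q w)) \<in> borel_measurable (M \<Otimes>\<^sub>M ?U)" by measurable
    show "(\<integral>\<^sup>+u. h (basis_sum (Q (\<theta>, u))) \<partial>?U) = (\<integral>\<^sup>+x. f (\<theta>, x) * h x \<partial>lborel)"
      if "\<theta> \<in> space M" and [measurable]: "h \<in> borel_measurable borel" for \<theta> h
      using law[OF that(1), of "\<lambda>x. h (basis_sum x)"] that(1)
      by (simp add: f'_def nn_integral_lborel_basis_sum)
    show "(\<integral>\<^sup>+u. p ((1 - t) *\<^sub>R basis_sum (Q (\<theta>, u)) + t *\<^sub>R basis_sum (Q (\<eta>, u))) *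
          pl_weight t (f (\<theta>, basis_sum (Q (\<theta>, u)))) (f (\<eta>, basis_sum (Q (\<eta>, u)))) \<partial>?U) \<le> (\<integral>\<^sup>+x. p x \<partial>lborel)"
      if "\<theta> \<in> space M" "\<eta> \<in> space M" "0 < t" "t < 1" and [measurable]: "p \<in> borel_measurable borel" for \<theta> \<eta> t p
    proof -
      have "basis_sum (\<lambda>i\<in>Basis. (1 - t) * x i + t * y i) = (1 - t) *\<^sub>R basis_sum x + t *\<^sub>R (basis_sum y :: 'a)" for x y
        by (simp add: basis_sum_def scaleR_sum_right sum.distrib[symmetric] scaleR_left_distrib)
      then show ?thesis
        using pl[OF that(1-4), of "\<lambda>x. p (basis_sum x)"]
        by (simp add: f'_def nn_integral_lborel_basis_sum)
    qed
  qed
qed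

section \<open>Relative entropy as a nonnegative integral, and Talagrand's inequality\<close>

definition kl_integrand :: "real \<Rightarrow> real \<Rightarrow> real" where
  "kl_integrand a b = a * ln (a / b) - a + b"

lemma measurable_kl_integrand[measurable]:
  assumes [measurable]: "f \<in> borel_measurable M" "g \<in> borel_measurable M"
  shows "(\<lambda>x. kl_integrand (f x) (g x)) \<in> borel_measurable M"
  unfolding kl_integrand_def by measurable

lemma kl_integrand_nonneg: "0 \<le> a \<Longrightarrow> 0 < b \<Longrightarrow> 0 \<le> kl_integrand a b"
proof (cases "a = 0")
  case False
  assume "0 \<le> a" "0 < b"
  then have "0 < a" using False by simp
  have "ln (b / a) \<le> b / a - 1" using \<open>0 < a\<close> \<open>0 < b\<close> by (intro ln_le_minus_one) simp
  then have "a * ln (b / a) \<le> a * (b / a - 1)" using \<open>0 < a\<close> by (intro mult_left_mono) auto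
  then show ?thesis using \<open>0 < a\<close> \<open>0 < b\<close> by (simp add: kl_integrand_def ln_div algebra_simps)
qed (simp add: kl_integrand_def)

text \<open>The terms - a + b of the integrand cancel between probability densities and make it
  nonnegative pointwise. Entropy thus becomes an extended nonnegative integral, to which Tonelli
  applies and for which infinite values need no separate treatment.\<close>

definition kl :: "('a::euclidean_space \<Rightarrow> real) \<Rightarrow> ('a \<Rightarrow> real) \<Rightarrow> ennreal" where
  "kl f g = (\<integral>\<^sup>+x. ennreal (kl_integrand (f x) (g x)) \<partial>lborel)"

text \<open>For smooth \<open>V\<close> and q v = v . H v this expresses that the Hessian is at
  least H, but without derivatives. The modulus is an arbitrary function so that it may be
  degenerate: for the joint law of a transition it will see the second component only.\<close>

definition strongly_convex :: "('a::real_vector \<Rightarrow> real) \<Rightarrow> ('a \<Rightarrow> real) \<Rightarrow> bool" where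
  "strongly_convex q V \<longleftrightarrow> (\<forall>x y t. 0 < t \<longrightarrow> t < 1 \<longrightarrow>
     V ((1 - t) *\<^sub>R x + t *\<^sub>R y) \<le> (1 - t) * V x + t * V y - t * (1 - t) / 2 * q (x - y))"

text \<open>Dividing by the density cancels it, but the sample never visits the zero set of
  \<open>f\<close>. The missing mass is added on the left, as subtraction is unsafe for infinite
  integrals.\<close>

lemma nn_integral_divide_density:
  assumes [measurable]: "f \<in> borel_measurable borel" "F \<in> borel_measurable borel" and f: "\<And>x. 0 \<le> f x" and F: "\<And>x. 0 \<le> F x"
    and law: "\<And>h. h \<in> borel_measurable borel \<Longrightarrow>
      (\<integral>\<^sup>+u. h (X u) \<partial>N) = (\<integral>\<^sup>+x. ennreal (f x) * h x \<partial>(lborel :: 'a::euclidean_space measure))"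
  shows "(\<integral>\<^sup>+u. ennreal (F (X u) / f (X u)) \<partial>N) + (\<integral>\<^sup>+x. ennreal (F x) * indicator {x. f x = 0} x \<partial>lborel)
    = (\<integral>\<^sup>+x. ennreal (F x) \<partial>lborel)"
proof -
  have "(\<integral>\<^sup>+u. ennreal (F (X u) / f (X u)) \<partial>N) = (\<integral>\<^sup>+x. ennreal (f x) * ennreal (F x / f x) \<partial>lborel)"
    by (rule law) measurable
  also have "\<dots> = (\<integral>\<^sup>+x. ennreal (F x) * indicator {x. f x \<noteq> 0} x \<partial>lborel)"
    using f F by (intro nn_integral_cong) (auto simp: indicator_def ennreal_mult[symmetric] zero_less_divide_iff)
  finally show ?thesis
    by (simp add: nn_integral_add[symmetric] indicator_def) (intro nn_integral_cong, auto)
qed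

lemma AE_density_pos:
  fixes f :: "'a::euclidean_space \<Rightarrow> real"
  assumes [measurable]: "f \<in> borel_measurable borel" "X \<in> borel_measurable N" and f: "\<And>x. 0 \<le> f x"
    and X: "\<And>h. h \<in> borel_measurable borel \<Longrightarrow> (\<integral>\<^sup>+u. h (X u) \<partial>N) = (\<integral>\<^sup>+x. ennreal (f x) * h x \<partial>lborel)"
  shows "AE u in N. 0 < f (X u)"
proof -
  have "(\<integral>\<^sup>+u. indicator {x. f x = 0} (X u) \<partial>N) = (\<integral>\<^sup>+x. ennreal (f x) * indicator {x. f x = 0} x \<partial>lborel)"
    by (rule X) measurable
  also have "\<dots> = (\<integral>\<^sup>+x. 0 \<partial>(lborel :: 'a measure))" by (intro nn_integral_cong) (auto simp: indicator_def)
  finally have "(\<integral>\<^sup>+u. indicator {x. f x = 0} (X u) \<partial>N) = 0" by simp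
  then have "AE u in N. indicator {x. f x = 0} (X u) = (0::ennreal)"
    by (subst (asm) nn_integral_0_iff_AE) auto
  then show ?thesis by (rule eventually_mono) (use f in \<open>auto simp: indicator_def less_le split: if_splits\<close>)
qed

lemma nn_integral_affine_combination:
  fixes F G H :: "'u \<Rightarrow> real"
  assumes [measurable]: "F \<in> borel_measurable N" "G \<in> borel_measurable N" "H \<in> borel_measurable N"
    and "\<And>u. 0 \<le> F u" "\<And>u. 0 \<le> G u" "\<And>u. 0 \<le> H u" "0 \<le> r" "0 \<le> s"
  shows "(\<integral>\<^sup>+u. ennreal (F u + r * G u + s * H u) \<partial>N)
    = (\<integral>\<^sup>+u. ennreal (F u) \<partial>N) + ennreal r * (\<integral>\<^sup>+u. ennreal (G u) \<partial>N) + ennreal s * (\<integral>\<^sup>+u. ennreal (H u) \<partial>N)"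
  using assms(4-) by (simp add: ennreal_plus ennreal_mult nn_integral_add nn_integral_cmult)

text \<open>Integrate \<open>1 + L \<le> exp L\<close> for the logarithm \<open>L\<close> of the Prekopa-Leindler integrand. Dividing by
  the densities, rather than taking their logarithms, keeps every term nonnegative.\<close>
lemma transport_inequality:
  fixes V q f g :: "'a::euclidean_space \<Rightarrow> real"
  assumes [measurable]: "V \<in> borel_measurable borel" "q \<in> borel_measurable borel"
    and [measurable]: "f \<in> borel_measurable borel" "g \<in> borel_measurable borel"
    and [measurable]: "X \<in> borel_measurable N" "Y \<in> borel_measurable N"
    and f: "\<And>x. 0 \<le> f x" and g: "\<And>x. 0 \<le> g x" and q: "\<And>x. 0 \<le> q x"
    and sc: "strongly_convex q V" and int_V: "(\<integral>\<^sup>+x. ennreal (exp (- V x)) \<partial>lborel) = 1"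
    and X: "\<And>h. h \<in> borel_measurable borel \<Longrightarrow> (\<integral>\<^sup>+u. h (X u) \<partial>N) = (\<integral>\<^sup>+x. ennreal (f x) * h x \<partial>lborel)"
    and Y: "\<And>h. h \<in> borel_measurable borel \<Longrightarrow> (\<integral>\<^sup>+u. h (Y u) \<partial>N) = (\<integral>\<^sup>+x. ennreal (g x) * h x \<partial>lborel)"
    and t: "0 < t" "t < 1"
    and pl: "(\<integral>\<^sup>+u. ennreal (exp (- V ((1 - t) *\<^sub>R X u + t *\<^sub>R Y u))) *
      pl_weight t (ennreal (f (X u))) (ennreal (g (Y u))) \<partial>N) \<le> 1"
  shows "(\<integral>\<^sup>+u. ennreal (t * (1 - t) / 2 * q (X u - Y u)) \<partial>N)
    \<le> ennreal (1 - t) * kl f (\<lambda>x. exp (- V x)) + ennreal t * kl g (\<lambda>x. exp (- V x))"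
proof -
  define p where "p = (\<lambda>x. exp (- V x))"
  have [measurable]: "p \<in> borel_measurable borel" unfolding p_def by measurable
  have p: "0 < p x" for x by (simp add: p_def)
  note kf = kl_integrand_nonneg[OF f p] and kg = kl_integrand_nonneg[OF g p]
  define e where "e = (\<lambda>u. p ((1 - t) *\<^sub>R X u + t *\<^sub>R Y u) * (f (X u) powr (t - 1) * g (Y u) powr (- t)))"
  have [measurable]: "e \<in> borel_measurable N" unfolding e_def by measurable
  have e_nonneg: "0 \<le> e u" for u by (simp add: e_def p_def)
  define A0 where "A0 = (\<integral>\<^sup>+u. ennreal (p (X u) / f (X u)) \<partial>N)"
  define A1 where "A1 = (\<integral>\<^sup>+u. ennreal (p (Y u) / g (Y u)) \<partial>N)"
  define B0 where "B0 = (\<integral>\<^sup>+u. ennreal (kl_integrand (f (X u)) (p (X u)) / f (X u)) \<partial>N)"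
  define B1 where "B1 = (\<integral>\<^sup>+u. ennreal (kl_integrand (g (Y u)) (p (Y u)) / g (Y u)) \<partial>N)"
  \<comment> \<open>The masses that the samples cannot see. On the zero set of the density the
    entropy integrand equals \<open>p\<close>, so the same correction completes \<open>A0\<close> to
    1 and \<open>B0\<close> to the entropy, and likewise for \<open>d1\<close>.\<close>
  define d0 where "d0 = (\<integral>\<^sup>+x. ennreal (p x) * indicator {x. f x = 0} x \<partial>lborel)"
  define d1 where "d1 = (\<integral>\<^sup>+x. ennreal (p x) * indicator {x. g x = 0} x \<partial>lborel)"
  define D where "D = (\<integral>\<^sup>+u. ennreal (t * (1 - t) / 2 * q (X u - Y u)) \<partial>N)"
  have AE_X: "AE u in N. 0 < f (X u)" by (rule AE_density_pos[OF _ _ f X]) auto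
  have AE_Y: "AE u in N. 0 < g (Y u)" by (rule AE_density_pos[OF _ _ g Y]) auto
  \<comment> \<open>In place of ln f + V, which has no sign, stands the nonnegative
    \<open>kl_integrand\<close> divided by f, which exceeds it by p/f - 1. The terms p/f on the left
    and the 1 in 1 + L \<le> exp L compensate this exactly.\<close>
  have pointwise: "t * (1 - t) / 2 * q (X u - Y u) + (1 - t) * (p (X u) / f (X u)) + t * (p (Y u) / g (Y u))
      \<le> e u + (1 - t) * (kl_integrand (f (X u)) (p (X u)) / f (X u)) + t * (kl_integrand (g (Y u)) (p (Y u)) / g (Y u))"
    if fg: "0 < f (X u)" "0 < g (Y u)" for u
  proof -
    define L where "L = - V ((1 - t) *\<^sub>R X u + t *\<^sub>R Y u) + ((t - 1) * ln (f (X u)) - t * ln (g (Y u)))"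
    have "e u = exp L"
      using fg by (simp add: e_def p_def L_def powr_def exp_add[symmetric])
    then have 1: "1 + (- V ((1 - t) *\<^sub>R X u + t *\<^sub>R Y u) + ((t - 1) * ln (f (X u)) - t * ln (g (Y u)))) \<le> e u"
      using exp_ge_add_one_self[of L] by (simp add: L_def)
    have 2: "V ((1 - t) *\<^sub>R X u + t *\<^sub>R Y u)
        \<le> (1 - t) * V (X u) + t * V (Y u) - t * (1 - t) / 2 * q (X u - Y u)"
      using sc t by (simp add: strongly_convex_def)
    have 3: "kl_integrand (f (X u)) (p (X u)) / f (X u) = ln (f (X u)) + V (X u) - 1 + p (X u) / f (X u)"
      "kl_integrand (g (Y u)) (p (Y u)) / g (Y u) = ln (g (Y u)) + V (Y u) - 1 + p (Y u) / g (Y u)"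
      using fg p by (simp_all add: kl_integrand_def add_divide_distrib diff_divide_distrib ln_div) (simp_all add: p_def)
    have "t * (1 - t) / 2 * r + (1 - t) * x + t * y \<le> w + (1 - t) * k + t * l"
      if "k = a + b - 1 + x" "l = c + d - 1 + y" "1 + (- v + ((t - 1) * a - t * c)) \<le> w"
        "v \<le> (1 - t) * b + t * d - t * (1 - t) / 2 * r" for r x y w k l a b c d v :: real
      unfolding that(1,2) using that(3,4) by (simp add: algebra_simps)
    from this[OF 3 1 2] show ?thesis .
  qed
  have "D + ennreal (1 - t) * A0 + ennreal t * A1
    = (\<integral>\<^sup>+u. ennreal (t * (1 - t) / 2 * q (X u - Y u) + (1 - t) * (p (X u) / f (X u)) + t * (p (Y u) / g (Y u))) \<partial>N)"
    unfolding D_def A0_def A1_def using t q f g less_imp_le[OF p]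
    by (intro nn_integral_affine_combination[symmetric]) auto
  also have "\<dots> \<le> (\<integral>\<^sup>+u. ennreal (e u + (1 - t) * (kl_integrand (f (X u)) (p (X u)) / f (X u))
      + t * (kl_integrand (g (Y u)) (p (Y u)) / g (Y u))) \<partial>N)"
    by (intro nn_integral_mono_AE eventually_elim2[OF AE_X AE_Y] ennreal_leI pointwise)
  also have "\<dots> = (\<integral>\<^sup>+u. ennreal (e u) \<partial>N) + ennreal (1 - t) * B0 + ennreal t * B1"
    unfolding B0_def B1_def using t e_nonneg f g kf kg
    by (intro nn_integral_affine_combination) auto
  also have "(\<integral>\<^sup>+u. ennreal (e u) \<partial>N) \<le> 1"
    using pl f g by (simp add: e_def pl_weight_def p_def ennreal_mult)
  finally have main: "D + ennreal (1 - t) * A0 + ennreal t * A1 \<le> 1 + ennreal (1 - t) * B0 + ennreal t * B1"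
    by (simp add: add_mono)
  have A: "A0 + d0 = 1" "A1 + d1 = 1"
    using nn_integral_divide_density[of f p N X] nn_integral_divide_density[of g p N Y] X Y f g less_imp_le[OF p] int_V
    by (auto simp: A0_def A1_def d0_def d1_def p_def)
  have B: "B0 + d0 = kl f p" "B1 + d1 = kl g p"
  proof -
    have "(\<integral>\<^sup>+x. ennreal (kl_integrand (f x) (p x)) * indicator {x. f x = 0} x \<partial>lborel) = d0"
      "(\<integral>\<^sup>+x. ennreal (kl_integrand (g x) (p x)) * indicator {x. g x = 0} x \<partial>lborel) = d1"
      unfolding d0_def d1_def by (intro nn_integral_cong; simp add: indicator_def kl_integrand_def)+
    then show "B0 + d0 = kl f p" "B1 + d1 = kl g p"
      using nn_integral_divide_density[of f "\<lambda>x. kl_integrand (f x) (p x)" N X]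
        nn_integral_divide_density[of g "\<lambda>x. kl_integrand (g x) (p x)" N Y] X Y f g kf kg
      by (auto simp: B0_def B1_def kl_def)
  qed
  \<comment> \<open>The comparison is made after adding 1 to both sides, so that only a finite
    summand has to be cancelled.\<close>
  have "D + 1 = D + (ennreal (1 - t) * (A0 + d0) + ennreal t * (A1 + d1))"
    using t by (simp add: A ennreal_plus[symmetric] del: ennreal_plus)
  also have "\<dots> = (D + ennreal (1 - t) * A0 + ennreal t * A1) + (ennreal (1 - t) * d0 + ennreal t * d1)"
    by (simp add: algebra_simps)
  also have "\<dots> \<le> (1 + ennreal (1 - t) * B0 + ennreal t * B1) + (ennreal (1 - t) * d0 + ennreal t * d1)"
    by (rule add_right_mono[OF main])
  also have "\<dots> = (ennreal (1 - t) * kl f p + ennreal t * kl g p) + 1"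
    by (simp add: B[symmetric] algebra_simps)
  finally show ?thesis by (simp add: D_def p_def)
qed

lemma kl_same: "kl g g = 0"
  by (simp add: kl_def kl_integrand_def ennreal_neg)

lemma strongly_convex_affine:
  assumes "strongly_convex q V"
  shows "strongly_convex q (\<lambda>x. V x - l \<bullet> x + r)"
  using assms unfolding strongly_convex_def
  by (auto simp: inner_add_right algebra_simps) 

lemma ennreal_le_if_scaled_le:
  fixes a b :: ennreal
  assumes "\<And>z. 0 < z \<Longrightarrow> z < 1 \<Longrightarrow> ennreal z * a \<le> b"
  shows "a \<le> b"
proof (cases b)
  case (real r)
  have "ennreal (1/2) * a \<le> b" by (rule assms) auto
  then have "a \<noteq> \<top>" using real by (auto simp: ennreal_mult_top top_unique)
  then obtain s where s: "a = ennreal s" "0 \<le> s" by (cases a) auto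
  have "s \<le> r"
  proof (rule field_le_mult_one_interval)
    fix z :: real assume z: "0 < z" "z < 1"
    then show "z * s \<le> r"
      using assms[OF z] s real by (simp add: ennreal_mult[symmetric])
  qed
  then show ?thesis using s real by (simp add: ennreal_leI)
qed simp

text \<open>With f = p the first entropy of \<open>transport_inequality\<close> vanishes. Dividing
  by t/2 leaves the factor 1 - t in front of the cost, and t tends to 0.\<close>

lemma talagrand_inequality:
  fixes V q g :: "'a::euclidean_space \<Rightarrow> real"
  assumes [measurable]: "V \<in> borel_measurable borel" "q \<in> borel_measurable borel" "g \<in> borel_measurable borel"
    and [measurable]: "X \<in> borel_measurable N" "Y \<in> borel_measurable N"
    and g: "\<And>x. 0 \<le> g x" and q: "\<And>x. 0 \<le> q x"
    and sc: "strongly_convex q V" and int_V: "(\<integral>\<^sup>+x. ennreal (exp (- V x)) \<partial>lborel) = 1"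
    and X: "\<And>h. h \<in> borel_measurable borel \<Longrightarrow> (\<integral>\<^sup>+u. h (X u) \<partial>N) = (\<integral>\<^sup>+x. ennreal (exp (- V x)) * h x \<partial>lborel)"
    and Y: "\<And>h. h \<in> borel_measurable borel \<Longrightarrow> (\<integral>\<^sup>+u. h (Y u) \<partial>N) = (\<integral>\<^sup>+x. ennreal (g x) * h x \<partial>lborel)"
    and pl: "\<And>t. 0 < t \<Longrightarrow> t < 1 \<Longrightarrow> (\<integral>\<^sup>+u. ennreal (exp (- V ((1 - t) *\<^sub>R X u + t *\<^sub>R Y u))) *
      pl_weight t (ennreal (exp (- V (X u)))) (ennreal (g (Y u))) \<partial>N) \<le> 1"
  shows "(\<integral>\<^sup>+u. ennreal (q (X u - Y u)) \<partial>N) \<le> 2 * kl g (\<lambda>x. exp (- V x))"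
proof (rule ennreal_le_if_scaled_le)
  fix z :: real assume z: "0 < z" "z < 1"
  define t where "t = 1 - z"
  have t: "0 < t" "t < 1" using z by (auto simp: t_def)
  let ?E = "\<integral>\<^sup>+u. ennreal (q (X u - Y u)) \<partial>N" and ?H = "kl g (\<lambda>x. exp (- V x))"
  have "(\<integral>\<^sup>+u. ennreal (t * (1 - t) / 2 * q (X u - Y u)) \<partial>N)
    \<le> ennreal (1 - t) * kl (\<lambda>x. exp (- V x)) (\<lambda>x. exp (- V x)) + ennreal t * ?H"
    by (rule transport_inequality) (use g q sc int_V X Y pl t in auto)
  also have "(\<integral>\<^sup>+u. ennreal (t * (1 - t) / 2 * q (X u - Y u)) \<partial>N) = ennreal (t / 2) * (ennreal z * ?E)"
  proof -
    have "ennreal (t * (1 - t) / 2 * q (X u - Y u)) = ennreal (t / 2) * (ennreal z * ennreal (q (X u - Y u)))" for u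
      using t z q by (simp add: ennreal_mult[symmetric] t_def)
    then show ?thesis by (simp only:) (simp add: nn_integral_cmult)
  qed
  finally have "ennreal (t / 2) * (ennreal z * ?E) \<le> ennreal t * ?H" by (simp add: kl_same)
  then have "ennreal (2 / t) * (ennreal (t / 2) * (ennreal z * ?E)) \<le> ennreal (2 / t) * (ennreal t * ?H)"
    by (intro mult_left_mono) auto
  then show "ennreal z * ?E \<le> 2 * ?H"
    using t by (simp add: mult.assoc[symmetric] ennreal_mult[symmetric])
qed

lemma distr_eq_densityI:
  fixes X :: "'u \<Rightarrow> 'a::euclidean_space"
  assumes [measurable]: "X \<in> borel_measurable N" "g \<in> borel_measurable borel"
    and law: "\<And>h. h \<in> borel_measurable borel \<Longrightarrow> (\<integral>\<^sup>+u. h (X u) \<partial>N) = (\<integral>\<^sup>+x. g x * h x \<partial>lborel)"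
  shows "distr N borel X = density lborel g"
proof (rule measure_eqI)
  fix A assume "A \<in> sets (distr N borel X)"
  then have [measurable]: "A \<in> sets borel" by simp
  have "emeasure (distr N borel X) A = (\<integral>\<^sup>+x. indicator A x \<partial>distr N borel X)" by simp
  also have "\<dots> = (\<integral>\<^sup>+u. indicator A (X u) \<partial>N)" by (rule nn_integral_distr) measurable
  also have "\<dots> = emeasure (density lborel g) A" by (simp add: law emeasure_density)
  finally show "emeasure (distr N borel X) A = emeasure (density lborel g) A" .
qed simp

lemma talagrand_coupling:
  fixes V q g :: "'a::euclidean_space \<Rightarrow> real"
  assumes V[measurable]: "V \<in> borel_measurable borel" and q[measurable]: "q \<in> borel_measurable borel"
    and g[measurable]: "g \<in> borel_measurable borel"
    and g0: "\<And>x. 0 \<le> g x" and q0: "\<And>x. 0 \<le> q x"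
    and sc: "strongly_convex q V" and int_V: "(\<integral>\<^sup>+x. ennreal (exp (- V x)) \<partial>lborel) = 1"
    and int_g: "(\<integral>\<^sup>+x. ennreal (g x) \<partial>lborel) = 1"
  obtains \<gamma> where "\<gamma> \<in> couplings (density lborel g) (density lborel (\<lambda>x. exp (- V x)))"
    and "(\<integral>\<^sup>+p. ennreal (q (snd p - fst p)) \<partial>\<gamma>) \<le> 2 * kl g (\<lambda>x. exp (- V x))"
proof -
  \<comment> \<open>A two-point parameter space: \<open>False\<close> selects the reference law,
    \<open>True\<close> the law with density \<open>g\<close>, both sampled from the same uniform
    variables.\<close>
  define f where "f = (\<lambda>(b, x). if b then ennreal (g x) else ennreal (exp (- V x)))"
  have fm: "f \<in> borel_measurable (count_space UNIV \<Otimes>\<^sub>M borel)"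
    unfolding f_def by measurable
  have int_f: "(\<integral>\<^sup>+x. f (b, x) \<partial>lborel) = 1" for b
    using int_V int_g by (cases b) (auto simp: f_def)
  obtain N :: "('a \<Rightarrow> real) measure" and Q where N: "prob_space N"
    and Qm: "Q \<in> borel_measurable (count_space UNIV \<Otimes>\<^sub>M N)"
    and law: "\<And>b h. b \<in> space (count_space UNIV) \<Longrightarrow> h \<in> borel_measurable borel \<Longrightarrow>
      (\<integral>\<^sup>+u. h (Q (b, u)) \<partial>N) = (\<integral>\<^sup>+x. f (b, x) * h x \<partial>lborel)"
    and pl: "\<And>b b' t p. b \<in> space (count_space UNIV) \<Longrightarrow> b' \<in> space (count_space UNIV) \<Longrightarrow> 0 < t \<Longrightarrow> t < 1 \<Longrightarrow> p \<in> borel_measurable borel \<Longrightarrow>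
      (\<integral>\<^sup>+u. p ((1 - t) *\<^sub>R Q (b, u) + t *\<^sub>R Q (b', u)) *
          pl_weight t (f (b, Q (b, u))) (f (b', Q (b', u))) \<partial>N) \<le> (\<integral>\<^sup>+x. p x \<partial>lborel)"
    by (rule knothe_rosenblatt[OF fm int_f]) (rule that, assumption, assumption, blast, blast)
  define X Y where "X = (\<lambda>u. Q (False, u))" and "Y = (\<lambda>u. Q (True, u))"
  have [measurable]: "X \<in> borel_measurable N" "Y \<in> borel_measurable N"
    unfolding X_def Y_def by (rule measurable_Pair2[OF Qm], simp)+
  have lawX: "(\<integral>\<^sup>+u. h (X u) \<partial>N) = (\<integral>\<^sup>+x. ennreal (exp (- V x)) * h x \<partial>lborel)"
    and lawY: "(\<integral>\<^sup>+u. h (Y u) \<partial>N) = (\<integral>\<^sup>+x. ennreal (g x) * h x \<partial>lborel)" if "h \<in> borel_measurable borel" for h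
    using law[of False h] law[of True h] that by (auto simp: f_def X_def Y_def)
  have E: "(\<integral>\<^sup>+u. ennreal (q (X u - Y u)) \<partial>N) \<le> 2 * kl g (\<lambda>x. exp (- V x))"
  proof (rule talagrand_inequality)
    fix t :: real assume t: "0 < t" "t < 1"
    show "(\<integral>\<^sup>+u. ennreal (exp (- V ((1 - t) *\<^sub>R X u + t *\<^sub>R Y u))) *
      pl_weight t (ennreal (exp (- V (X u)))) (ennreal (g (Y u))) \<partial>N) \<le> 1"
      using pl[of False True t "\<lambda>x. ennreal (exp (- V x))"] t int_V by (simp add: f_def X_def Y_def)
  qed (use g0 q0 sc int_V lawX lawY in auto)
  define \<gamma> where "\<gamma> = distr N (borel \<Otimes>\<^sub>M borel) (\<lambda>u. (Y u, X u))"
  have distrX: "distr N borel X = density lborel (\<lambda>x. exp (- V x))"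
    and distrY: "distr N borel Y = density lborel g"
  proof -
    show "distr N borel X = density lborel (\<lambda>x. exp (- V x))" by (rule distr_eq_densityI) (auto simp: lawX)
    show "distr N borel Y = density lborel g" by (rule distr_eq_densityI) (auto simp: lawY)
  qed
  show thesis
  proof
    show "\<gamma> \<in> couplings (density lborel g) (density lborel (\<lambda>x. exp (- V x)))"
      using N by (simp add: couplings_def \<gamma>_def prob_space.prob_space_distr distr_distr comp_def distrX distrY)
    show "(\<integral>\<^sup>+p. ennreal (q (snd p - fst p)) \<partial>\<gamma>) \<le> 2 * kl g (\<lambda>x. exp (- V x))"
      using E by (simp add: \<gamma>_def nn_integral_distr)
  qed
qed

section \<open>Joint convexity of relative entropy\<close>

lemma kl_integrand_tangent:
  assumes "0 \<le> a" "0 < b" "0 < r"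
  shows "a * ln r - b * r + b \<le> kl_integrand a b"
proof (cases "a = 0")
  case False
  then have a: "0 < a" using assms by simp
  have "ln (r * b / a) \<le> r * b / a - 1" using a assms by (intro ln_le_minus_one) simp
  then have "a * ln (r * b / a) \<le> a * (r * b / a - 1)" using a by (intro mult_left_mono) auto
  then show ?thesis using a assms by (simp add: kl_integrand_def ln_div ln_mult algebra_simps)
qed (use assms in \<open>simp add: kl_integrand_def\<close>)

lemma ennreal_integral_le_nn_integral:
  fixes f :: "'a \<Rightarrow> real"
  assumes f: "integrable M f"
  shows "ennreal (integral\<^sup>L M f) \<le> (\<integral>\<^sup>+x. ennreal (f x) \<partial>M)"
proof -
  have "ennreal (integral\<^sup>L M f) \<le> ennreal (\<integral>x. max 0 (f x) \<partial>M)"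
    using f by (intro ennreal_leI integral_mono) auto
  also have "\<dots> = (\<integral>\<^sup>+x. ennreal (max 0 (f x)) \<partial>M)"
    using f by (intro nn_integral_eq_integral[symmetric]) auto
  also have "(\<lambda>x. ennreal (max 0 (f x))) = (\<lambda>x. ennreal (f x))"
    by (auto simp: max_def ennreal_neg)
  finally show ?thesis .
qed

lemma (in prob_space) kl_integrand_expectation_le:
  assumes A: "integrable M A" and B: "integrable M B"
    and A0: "\<And>x. 0 \<le> A x" and B0: "\<And>x. 0 < B x"
  shows "ennreal (kl_integrand (expectation A) (expectation B)) \<le> (\<integral>\<^sup>+x. ennreal (kl_integrand (A x) (B x)) \<partial>M)"
proof -
  note [measurable] = borel_measurable_integrable[OF A] borel_measurable_integrable[OF B]
  have a: "0 \<le> expectation A" using A0 by (intro Bochner_Integration.integral_nonneg) auto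
  have b: "0 < expectation B"
  proof -
    have "0 \<le> expectation B" using B0 by (intro Bochner_Integration.integral_nonneg) (auto intro: less_imp_le)
    moreover have "expectation B \<noteq> 0"
    proof
      assume "expectation B = 0"
      then have "AE x in M. B x = 0"
        using integral_nonneg_eq_0_iff_AE[OF B] B0 by (auto intro: less_imp_le)
      then have "AE x in M. False" by (rule eventually_mono) (use B0 in \<open>auto simp: less_le\<close>)
      then show False by simp
    qed
    ultimately show ?thesis by simp
  qed
  show ?thesis
  proof (cases "expectation A = 0")
    case True
    then have "AE x in M. A x = 0" using integral_nonneg_eq_0_iff_AE[OF A] A0 by auto
    then have "(\<integral>\<^sup>+x. ennreal (kl_integrand (A x) (B x)) \<partial>M) = (\<integral>\<^sup>+x. ennreal (B x) \<partial>M)"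
      by (intro nn_integral_cong_AE) (auto simp: kl_integrand_def elim!: eventually_mono)
    also have "\<dots> = ennreal (expectation B)"
      using B B0 by (intro nn_integral_eq_integral) (auto intro: less_imp_le)
    finally show ?thesis using True by (simp add: kl_integrand_def)
  next
    case False
    then have a: "0 < expectation A" using a by simp
    define r where "r = expectation A / expectation B"
    have r: "0 < r" using a b by (simp add: r_def)
    have int: "integrable M (\<lambda>x. A x * ln r - B x * r + B x)" using A B by auto
    have "expectation (\<lambda>x. A x * ln r - B x * r + B x) = expectation A * ln r - expectation B * r + expectation B"
      using A B by simp
    also have "\<dots> = kl_integrand (expectation A) (expectation B)"
      using b by (simp add: r_def kl_integrand_def)
    finally have "ennreal (kl_integrand (expectation A) (expectation B)) = ennreal (expectation (\<lambda>x. A x * ln r - B x * r + B x))" by simp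
    also have "\<dots> \<le> (\<integral>\<^sup>+x. ennreal (A x * ln r - B x * r + B x) \<partial>M)"
      by (rule ennreal_integral_le_nn_integral[OF int])
    also have "\<dots> \<le> (\<integral>\<^sup>+x. ennreal (kl_integrand (A x) (B x)) \<partial>M)"
      using A0 B0 r by (intro nn_integral_mono ennreal_leI kl_integrand_tangent)
    finally show ?thesis .
  qed
qed

text \<open>Jensen's inequality at almost every point, followed by Tonelli. Data processing and the
  passage from pairs of starting points to their couplings are both instances, with different mixing
  measures.\<close>

lemma (in prob_space) kl_mixture_le:
  fixes A B :: "'a \<times> 'b::euclidean_space \<Rightarrow> real"
  assumes A[measurable]: "A \<in> borel_measurable (M \<Otimes>\<^sub>M borel)" and B[measurable]: "B \<in> borel_measurable (M \<Otimes>\<^sub>M borel)"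
    and A0: "\<And>\<omega> x. 0 \<le> A (\<omega>, x)" and B0: "\<And>\<omega> x. 0 < B (\<omega>, x)"
    and finA: "AE x in lborel. (\<integral>\<^sup>+\<omega>. ennreal (A (\<omega>, x)) \<partial>M) \<noteq> \<infinity>"
    and finB: "AE x in lborel. (\<integral>\<^sup>+\<omega>. ennreal (B (\<omega>, x)) \<partial>M) \<noteq> \<infinity>"
  shows "kl (\<lambda>x. enn2real (\<integral>\<^sup>+\<omega>. ennreal (A (\<omega>, x)) \<partial>M)) (\<lambda>x. enn2real (\<integral>\<^sup>+\<omega>. ennreal (B (\<omega>, x)) \<partial>M))
    \<le> (\<integral>\<^sup>+\<omega>. kl (\<lambda>x. A (\<omega>, x)) (\<lambda>x. B (\<omega>, x)) \<partial>M)"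
proof -
  interpret P: pair_sigma_finite M "lborel :: 'b measure" by standard
  have "kl (\<lambda>x. enn2real (\<integral>\<^sup>+\<omega>. ennreal (A (\<omega>, x)) \<partial>M)) (\<lambda>x. enn2real (\<integral>\<^sup>+\<omega>. ennreal (B (\<omega>, x)) \<partial>M))
     \<le> (\<integral>\<^sup>+x. (\<integral>\<^sup>+\<omega>. ennreal (kl_integrand (A (\<omega>, x)) (B (\<omega>, x))) \<partial>M) \<partial>lborel)"
    unfolding kl_def
  proof (rule nn_integral_mono_AE)
    show "AE x in lborel. ennreal (kl_integrand (enn2real (\<integral>\<^sup>+\<omega>. ennreal (A (\<omega>, x)) \<partial>M)) (enn2real (\<integral>\<^sup>+\<omega>. ennreal (B (\<omega>, x)) \<partial>M)))
      \<le> (\<integral>\<^sup>+\<omega>. ennreal (kl_integrand (A (\<omega>, x)) (B (\<omega>, x))) \<partial>M)"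
      using finA finB
    proof eventually_elim
      case (elim x)
      have [measurable]: "(\<lambda>\<omega>. A (\<omega>, x)) \<in> borel_measurable M" "(\<lambda>\<omega>. B (\<omega>, x)) \<in> borel_measurable M" by measurable
      have "integrable M (\<lambda>\<omega>. A (\<omega>, x))" "integrable M (\<lambda>\<omega>. B (\<omega>, x))"
        using elim A0 less_imp_le[OF B0] by (auto intro!: integrableI_nonneg simp: less_top)
      moreover have "enn2real (\<integral>\<^sup>+\<omega>. ennreal (A (\<omega>, x)) \<partial>M) = expectation (\<lambda>\<omega>. A (\<omega>, x))"
        "enn2real (\<integral>\<^sup>+\<omega>. ennreal (B (\<omega>, x)) \<partial>M) = expectation (\<lambda>\<omega>. B (\<omega>, x))"
        using A0 less_imp_le[OF B0] by (simp_all add: integral_eq_nn_integral)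
      ultimately show ?case
        using kl_integrand_expectation_le[of "\<lambda>\<omega>. A (\<omega>, x)" "\<lambda>\<omega>. B (\<omega>, x)"] A0 B0 by simp
    qed
  qed
  also have "\<dots> = (\<integral>\<^sup>+\<omega>. kl (\<lambda>x. A (\<omega>, x)) (\<lambda>x. B (\<omega>, x)) \<partial>M)"
    unfolding kl_def by (intro P.Fubini') measurable
  finally show ?thesis .
qed

section \<open>Exponential family kernels\<close>

text \<open>The forward and the backward kernel are both instances. Since \<open>V\<close> does not
  involve the parameter, log ratios of two members are affine, and \<Lambda> is the log-normaliser.
  \<open>c\<close> is a lower bound for the curvature and \<kappa> bounds the interaction.\<close>

locale exp_family_kernel =
  fixes B :: "'y::euclidean_space \<Rightarrow> 'a::euclidean_space" and V :: "'a \<Rightarrow> real" and \<Lambda> :: "'y \<Rightarrow> real"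
    and c \<kappa> :: real
  assumes linear_B: "linear B" and B_bound: "\<And>v. norm (B v) \<le> \<kappa> * norm v" and \<kappa>_pos: "0 < \<kappa>"
    and V_measurable[measurable]: "V \<in> borel_measurable borel"
    and \<Lambda>_measurable[measurable]: "\<Lambda> \<in> borel_measurable borel"
    and c_pos: "0 < c"
    and convex_V: "strongly_convex (\<lambda>v. c * (norm v)\<^sup>2) V"
    and normalised: "\<And>y. (\<integral>\<^sup>+x. ennreal (exp (B y \<bullet> x - V x - \<Lambda> y)) \<partial>lborel) = 1"
begin

definition k :: "'y \<Rightarrow> 'a \<Rightarrow> real" where
  "k y x = exp (B y \<bullet> x - V x - \<Lambda> y)"

definition K :: "'y \<Rightarrow> 'a measure" where
  "K y = density lborel (\<lambda>x. ennreal (k y x))"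

text \<open>Formally the derivative of \<Lambda> at \<open>y\<close> in direction
  \<open>v\<close>.\<close>

definition mean :: "'y \<Rightarrow> 'y \<Rightarrow> real" where
  "mean y v = (\<integral>x. k y x * (B v \<bullet> x) \<partial>lborel)"

lemma B_measurable[measurable]: "B \<in> borel_measurable borel"
  by (intro borel_measurable_continuous_onI linear_continuous_on linear_conv_bounded_linear[THEN iffD1] linear_B)

lemma measurable_k[measurable]: "(\<lambda>(y, x). k y x) \<in> borel_measurable (borel \<Otimes>\<^sub>M borel)"
  unfolding k_def by measurable

lemma measurable_k2[measurable]: "k y \<in> borel_measurable borel"
  unfolding k_def by measurable

lemma k_pos: "0 < k y x" by (simp add: k_def)

lemma k_nonneg: "0 \<le> k y x" by (simp add: k_def)

lemma int_k: "(\<integral>\<^sup>+x. ennreal (k y x) \<partial>lborel) = 1" by (simp add: k_def normalised)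

lemma integrable_k: "integrable lborel (k y)" and integral_k: "(\<integral>x. k y x \<partial>lborel) = 1"
proof -
  show "integrable lborel (k y)"
    using int_k k_nonneg by (intro integrableI_nonneg) auto
  show "(\<integral>x. k y x \<partial>lborel) = 1"
    using int_k k_nonneg by (subst integral_eq_nn_integral) auto
qed

lemma k_tilt: "k (y + v) x = k y x * exp (B v \<bullet> x - (\<Lambda> (y + v) - \<Lambda> y))"
  by (simp add: k_def exp_add[symmetric] linear_add[OF linear_B] inner_add_left)

text \<open>The tilts by \<open>\<plusminus> B v\<close> stay in the family, so \<open>B v \<bullet> x\<close> has finite exponential moments.\<close>
lemma integrable_tilt: "integrable lborel (\<lambda>x. k y x * (B v \<bullet> x))"
proof (rule Bochner_Integration.integrable_bound)
  let ?g = "\<lambda>x. k (y + v) x * exp (\<Lambda> (y + v) - \<Lambda> y) + k (y - v) x * exp (\<Lambda> (y - v) - \<Lambda> y)"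
  show "integrable lborel ?g" using integrable_k by auto
  have "\<bar>k y x * (B v \<bullet> x)\<bar> \<le> ?g x" for x
  proof -
    have e: "k (y + v) x * exp (\<Lambda> (y + v) - \<Lambda> y) = k y x * exp (B v \<bullet> x)"
      "k (y - v) x * exp (\<Lambda> (y - v) - \<Lambda> y) = k y x * exp (- (B v \<bullet> x))"
      by (simp_all add: k_def exp_add[symmetric] linear_add[OF linear_B] linear_diff[OF linear_B]
          inner_add_left inner_diff_left)
    have "\<bar>B v \<bullet> x\<bar> \<le> exp (B v \<bullet> x) + exp (- (B v \<bullet> x))"
      using exp_ge_add_one_self[of "B v \<bullet> x"] exp_ge_add_one_self[of "- (B v \<bullet> x)"]
        exp_gt_zero[of "B v \<bullet> x"] exp_gt_zero[of "- (B v \<bullet> x)"] by linarith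
    then have "k y x * \<bar>B v \<bullet> x\<bar> \<le> k y x * (exp (B v \<bullet> x) + exp (- (B v \<bullet> x)))"
      using k_pos[of y x] by (intro mult_left_mono) auto
    then show ?thesis using k_pos[of y x] by (simp add: e abs_mult distrib_left)
  qed
  then show "AE x in lborel. norm (k y x * (B v \<bullet> x)) \<le> norm (?g x)"
    by (intro AE_I2) (metis abs_ge_self order_trans real_norm_def)
qed measurable

lemma mean_scale: "mean y (r *\<^sub>R v) = r * mean y v"
proof -
  have "k y x * (B (r *\<^sub>R v) \<bullet> x) = r * (k y x * (B v \<bullet> x))" for x
    by (simp add: linear_scale[OF linear_B])
  then show ?thesis by (simp only: mean_def integral_mult_right_zero)
qed

text \<open>The log ratio is affine, so the entropy is the Bregman divergence of \<Lambda>; its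
  nonnegativity is the tangent inequality for the convex function \<Lambda>.\<close>

lemma kl_k:
  shows "kl (k (y + v)) (k y) = ennreal (mean (y + v) v - (\<Lambda> (y + v) - \<Lambda> y))"
    and "0 \<le> mean (y + v) v - (\<Lambda> (y + v) - \<Lambda> y)"
proof -
  define D where "D = \<Lambda> (y + v) - \<Lambda> y"
  have eq: "kl_integrand (k (y + v) x) (k y x) = k (y + v) x * (B v \<bullet> x) - D * k (y + v) x - k (y + v) x + k y x" for x
  proof -
    have "ln (k (y + v) x / k y x) = B v \<bullet> x - D"
      using k_pos[of y x] by (simp add: k_tilt[of y v] D_def)
    then show ?thesis by (simp only: kl_integrand_def) (simp add: algebra_simps)
  qed
  have int: "integrable lborel (\<lambda>x. kl_integrand (k (y + v) x) (k y x))"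
    unfolding eq using integrable_k integrable_tilt by auto
  have "(\<integral>x. kl_integrand (k (y + v) x) (k y x) \<partial>lborel) = mean (y + v) v - D"
    unfolding eq mean_def using integrable_k integrable_tilt by (simp add: integral_k)
  then show "kl (k (y + v)) (k y) = ennreal (mean (y + v) v - (\<Lambda> (y + v) - \<Lambda> y))"
    "0 \<le> mean (y + v) v - (\<Lambda> (y + v) - \<Lambda> y)"
    unfolding kl_def D_def[symmetric] using nn_integral_eq_integral[OF int]
      Bochner_Integration.integral_nonneg[of lborel "\<lambda>x. kl_integrand (k (y + v) x) (k y x)"]
      kl_integrand_nonneg[OF less_imp_le[OF k_pos] k_pos] by auto
qed

lemma coupling_map:
  obtains N :: "('a \<Rightarrow> real) measure" and Q where "prob_space N" and "Q \<in> borel_measurable (borel \<Otimes>\<^sub>M N)"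
    and "\<And>y h. h \<in> borel_measurable borel \<Longrightarrow> (\<integral>\<^sup>+u. h (Q (y, u)) \<partial>N) = (\<integral>\<^sup>+x. ennreal (k y x) * h x \<partial>lborel)"
    and "\<And>y v. (\<integral>\<^sup>+u. ennreal (c * (norm (Q (y + v, u) - Q (y, u)))\<^sup>2) \<partial>N) \<le> ennreal ((norm (B v))\<^sup>2 / c)"
    and "\<And>y v. mean (y + v) v - mean y v \<le> (norm (B v))\<^sup>2 / c"
proof -
  define f where "f = (\<lambda>(y, x). ennreal (k y x))"
  have fm: "f \<in> borel_measurable (borel \<Otimes>\<^sub>M borel)" unfolding f_def by measurable
  have int_f: "(\<integral>\<^sup>+x. f (y, x) \<partial>lborel) = 1" for y by (simp add: f_def int_k)
  obtain N :: "('a \<Rightarrow> real) measure" and Q where N: "prob_space N"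
    and Qm: "Q \<in> borel_measurable (borel \<Otimes>\<^sub>M N)"
    and law0: "\<And>b h. b \<in> space (borel::'y measure) \<Longrightarrow> h \<in> borel_measurable borel \<Longrightarrow>
      (\<integral>\<^sup>+u. h (Q (b, u)) \<partial>N) = (\<integral>\<^sup>+x. f (b, x) * h x \<partial>lborel)"
    and pl: "\<And>b b' t p. b \<in> space (borel::'y measure) \<Longrightarrow> b' \<in> space (borel::'y measure) \<Longrightarrow> 0 < t \<Longrightarrow> t < 1 \<Longrightarrow> p \<in> borel_measurable borel \<Longrightarrow>
      (\<integral>\<^sup>+u. p ((1 - t) *\<^sub>R Q (b, u) + t *\<^sub>R Q (b', u)) *
          pl_weight t (f (b, Q (b, u))) (f (b', Q (b', u))) \<partial>N) \<le> (\<integral>\<^sup>+x. p x \<partial>lborel)"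
    by (rule knothe_rosenblatt[OF fm int_f]) (rule that, assumption, assumption, blast, blast)
  have law: "(\<integral>\<^sup>+u. h (Q (y, u)) \<partial>N) = (\<integral>\<^sup>+x. ennreal (k y x) * h x \<partial>lborel)"
    if "h \<in> borel_measurable borel" for y h
    using law0[of y h] that by (simp add: f_def)
  interpret N: prob_space N by (rule N)
  have Qy[measurable]: "(\<lambda>u. Q (y, u)) \<in> borel_measurable N" for y
    by (rule measurable_Pair2[OF Qm]) simp
  have T: "(\<integral>\<^sup>+u. ennreal (c * (norm (Q (y, u) - Q (y', u)))\<^sup>2) \<partial>N) \<le> 2 * kl (k y') (k y)" for y y'
  proof -
    \<comment> \<open>Each member of the family has the potential \<open>V\<close> up to an affine
      function, hence the same strong convexity.\<close>
    define V' where "V' = (\<lambda>x. V x - B y \<bullet> x + \<Lambda> y)"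
    have [measurable]: "V' \<in> borel_measurable borel" unfolding V'_def by measurable
    have kV: "k y x = exp (- V' x)" for x by (simp add: k_def V'_def)
    have "(\<integral>\<^sup>+u. ennreal (c * (norm (Q (y, u) - Q (y', u)))\<^sup>2) \<partial>N) \<le> 2 * kl (k y') (\<lambda>x. exp (- V' x))"
    proof (rule talagrand_inequality[where V=V' and q="\<lambda>v. c * (norm v)\<^sup>2"])
      show "strongly_convex (\<lambda>v. c * (norm v)\<^sup>2) V'"
        unfolding V'_def by (rule strongly_convex_affine[OF convex_V])
      fix t :: real assume t: "0 < t" "t < 1"
      show "(\<integral>\<^sup>+u. ennreal (exp (- V' ((1 - t) *\<^sub>R Q (y, u) + t *\<^sub>R Q (y', u)))) *
        pl_weight t (ennreal (exp (- V' (Q (y, u))))) (ennreal (k y' (Q (y', u)))) \<partial>N) \<le> 1"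
        using pl[of y y' t "\<lambda>x. ennreal (k y x)"] t int_k[of y] by (simp add: f_def kV)
    qed (use c_pos int_k law k_nonneg in \<open>auto simp: kV[symmetric]\<close>)
    then show ?thesis by (simp add: kV[abs_def])
  qed
  have main: "(\<integral>\<^sup>+u. ennreal (c * (norm (Q (y + v, u) - Q (y, u)))\<^sup>2) \<partial>N) \<le> ennreal ((norm (B v))\<^sup>2 / c)
      \<and> mean (y + v) v - mean y v \<le> (norm (B v))\<^sup>2 / c" for y v
  proof -
    define \<Delta> where "\<Delta> = (\<lambda>u. Q (y + v, u) - Q (y, u))"
    have [measurable]: "\<Delta> \<in> borel_measurable N" unfolding \<Delta>_def by measurable
    define D where "D = (\<integral>\<^sup>+u. ennreal (c * (norm (\<Delta> u))\<^sup>2) \<partial>N)"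
    \<comment> \<open>The entropies in the two directions. In their sum the increments of \<Lambda>
      cancel and only the increment of \<open>mean\<close> is left.\<close>
    define h1 h2 where "h1 = mean (y + v) v - (\<Lambda> (y + v) - \<Lambda> y)" and "h2 = - mean y v - (\<Lambda> y - \<Lambda> (y + v))"
    have h1: "kl (k (y + v)) (k y) = ennreal h1" "0 \<le> h1" using kl_k[of y v] by (auto simp: h1_def)
    have h2: "kl (k y) (k (y + v)) = ennreal h2" "0 \<le> h2"
      using kl_k[of "y + v" "- v"] mean_scale[of y "-1" v] by (auto simp: h2_def)
    have D1: "D \<le> 2 * ennreal h1"
      using T[of y "y + v"] by (simp add: D_def h1 \<Delta>_def norm_minus_commute)
    have D2: "D \<le> 2 * ennreal h2"
      using T[of "y + v" y] by (simp add: D_def h2 \<Delta>_def)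
    \<comment> \<open>Finiteness is essential: \<open>D\<close> will be absorbed by itself
      below.\<close>
    have "D \<noteq> \<top>" using D1 h1(2) by (auto simp: top_unique ennreal_mult_eq_top_iff)
    then obtain d where d: "D = ennreal d" "0 \<le> d" by (cases D) auto
    have "d \<le> 2 * h1" "d \<le> 2 * h2"
      using D1 D2 d h1(2) h2(2) by (simp_all add: ennreal_mult[symmetric] ennreal_numeral[symmetric] del: ennreal_numeral)
    then have d_le: "d \<le> mean (y + v) v - mean y v" by (simp add: h1_def h2_def)
    have intD: "integrable N (\<lambda>u. c * (norm (\<Delta> u))\<^sup>2)"
      using d c_pos by (intro integrableI_nonneg) (auto simp: D_def[symmetric])
    have D_int: "(\<integral>u. c * (norm (\<Delta> u))\<^sup>2 \<partial>N) = d"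
      using d c_pos by (subst integral_eq_nn_integral) (auto simp: D_def[symmetric])
    have distr: "distr N borel (\<lambda>u. Q (z, u)) = density lborel (\<lambda>x. ennreal (k z x))" for z
      by (rule distr_eq_densityI) (auto simp: law)
    have m: "integrable N (\<lambda>u. B v \<bullet> Q (z, u))" "(\<integral>u. B v \<bullet> Q (z, u) \<partial>N) = mean z v" for z
    proof -
      have "integrable (distr N borel (\<lambda>u. Q (z, u))) (\<lambda>x. B v \<bullet> x)"
        unfolding distr using integrable_tilt[of z v] k_nonneg[of z] by (subst integrable_density) auto
      then show "integrable N (\<lambda>u. B v \<bullet> Q (z, u))" by (subst (asm) integrable_distr_eq) auto
      have "(\<integral>u. B v \<bullet> Q (z, u) \<partial>N) = (\<integral>x. B v \<bullet> x \<partial>distr N borel (\<lambda>u. Q (z, u)))"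
        by (subst integral_distr) auto
      also have "\<dots> = mean z v"
        unfolding distr mean_def using k_nonneg[of z] by (subst integral_density) auto
      finally show "(\<integral>u. B v \<bullet> Q (z, u) \<partial>N) = mean z v" .
    qed
    have "mean (y + v) v - mean y v = (\<integral>u. B v \<bullet> Q (y + v, u) - B v \<bullet> Q (y, u) \<partial>N)"
      using m by simp
    also have "\<dots> = (\<integral>u. B v \<bullet> \<Delta> u \<partial>N)"
      by (simp add: \<Delta>_def inner_diff_right)
    also have "\<dots> \<le> (\<integral>u. (norm (B v))\<^sup>2 / (2 * c) + (1/2) * (c * (norm (\<Delta> u))\<^sup>2) \<partial>N)"
    proof (rule integral_mono)
      show "integrable N (\<lambda>u. B v \<bullet> \<Delta> u)"
        using m by (simp add: \<Delta>_def inner_diff_right)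
      show "integrable N (\<lambda>u. (norm (B v))\<^sup>2 / (2 * c) + (1/2) * (c * (norm (\<Delta> u))\<^sup>2))"
        using intD by auto
      fix u
      have "B v \<bullet> \<Delta> u \<le> norm (B v) * norm (\<Delta> u)" by (rule norm_cauchy_schwarz)
      \<comment> \<open>Young's inequality with weight \<open>c\<close>, so that exactly half of the
        cost appears.\<close>
      also have "\<dots> \<le> (norm (B v))\<^sup>2 / (2 * c) + (1/2) * (c * (norm (\<Delta> u))\<^sup>2)"
        using zero_le_power2[of "norm (B v) - c * norm (\<Delta> u)"] c_pos
        by (simp add: field_simps power2_eq_square)
      finally show "B v \<bullet> \<Delta> u \<le> (norm (B v))\<^sup>2 / (2 * c) + (1/2) * (c * (norm (\<Delta> u))\<^sup>2)" .
    qed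
    also have "\<dots> = (norm (B v))\<^sup>2 / (2 * c) + d / 2"
    proof -
      define w where "w = (\<lambda>u. c * (norm (\<Delta> u))\<^sup>2)"
      have "integrable N w" "integral\<^sup>L N w = d" using intD D_int by (simp_all add: w_def)
      then have "(\<integral>u. (norm (B v))\<^sup>2 / (2 * c) + (1/2) * w u \<partial>N) = (norm (B v))\<^sup>2 / (2 * c) + d / 2"
        by (simp add: N.prob_space)
      then show ?thesis by (simp only: w_def)
    qed
    finally have m_le: "mean (y + v) v - mean y v \<le> (norm (B v))\<^sup>2 / (2 * c) + d / 2" .
    \<comment> \<open>Self-improvement: d is at most the increment of \<open>mean\<close>, which is
      at most half of the target plus d/2. Putting the bound for d back into \<open>m_le\<close>
      gives the bound for the increment.\<close>
    then have "d \<le> (norm (B v))\<^sup>2 / c" using d_le by simp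
    then show ?thesis using m_le d by (auto simp: D_def \<Delta>_def ennreal_leI)
  qed
  show thesis
    by (rule that[OF N Qm law]) (use main in auto)
qed

lemma mean_increment: "mean (y + v) v - mean y v \<le> (norm (B v))\<^sup>2 / c"
  by (rule coupling_map) blast

text \<open>With \<open>m s = mean (y + s v) v\<close> the derivative of \<open>\<Lambda>\<close> along the segment: \<open>m\<close> increases at rate at
  most \<open>C = |B v|\<^sup>2 / c\<close>, and a Riemann sum replaces the integral of \<open>m\<close>.\<close>
lemma kl_k_le: "kl (k (y + v)) (k y) \<le> ennreal ((norm (B v))\<^sup>2 / (2 * c))"
proof -
  define C where "C = (norm (B v))\<^sup>2 / c"
  define m where "m = (\<lambda>s. mean (y + s *\<^sub>R v) v)"
  define L where "L = (\<lambda>s. \<Lambda> (y + s *\<^sub>R v))"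
  have C: "0 \<le> C" using c_pos by (simp add: C_def)
  \<comment> \<open>\<open>mean_increment\<close> is quadratic in the displacement; for a multiple
    of \<open>v\<close> one factor \<open>s' - s\<close> can be cancelled, which leaves a one-sided
    Lipschitz bound.\<close>
  have inc: "m s' - m s \<le> (s' - s) * C" if "s < s'" for s s'
  proof -
    have e: "y + s *\<^sub>R v + (s' - s) *\<^sub>R v = y + s' *\<^sub>R v" by (simp add: algebra_simps)
    have "(s' - s) * m s' - (s' - s) * m s \<le> (norm (B ((s' - s) *\<^sub>R v)))\<^sup>2 / c"
      using mean_increment[of "y + s *\<^sub>R v" "(s' - s) *\<^sub>R v"] by (simp only: e mean_scale m_def)
    also have "\<dots> = (s' - s) * ((s' - s) * C)"
      by (simp only: linear_scale[OF linear_B] norm_scaleR) (simp add: C_def power_mult_distrib power2_eq_square)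
    finally have "(s' - s) * (m s' - m s) \<le> (s' - s) * ((s' - s) * C)" by (simp only: right_diff_distrib)
    then show ?thesis using that by (simp add: mult_le_cancel_left)
  qed
  \<comment> \<open>The tangent inequality for \<Lambda> at \<open>s\<close>, obtained from the
    nonnegativity of an entropy.\<close>
  have low: "L s' - L s \<ge> (s' - s) * m s" for s s'
  proof -
    have e: "y + s' *\<^sub>R v + (s - s') *\<^sub>R v = y + s *\<^sub>R v" by (simp add: algebra_simps)
    have "0 \<le> (s - s') * m s - (L s - L s')"
      using kl_k(2)[of "y + s' *\<^sub>R v" "(s - s') *\<^sub>R v"] by (simp only: e mean_scale m_def L_def)
    then show ?thesis by (simp add: algebra_simps)
  qed
  \<comment> \<open>Left end points are used, and the average of 1 - i/n over i < n is 1/2 + 1/(2n):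
    this is the source of the error term.\<close>
  have bound: "m 1 - (L 1 - L 0) \<le> C / 2 + C / (2 * real n)" if n: "0 < n" for n :: nat
  proof -
    have "L 1 - L 0 = (\<Sum>i<n. L (real (Suc i) / n) - L (real i / n))"
      using sum_lessThan_telescope[of "\<lambda>i. L (real i / n)" n] n by simp
    also have "\<dots> \<ge> (\<Sum>i<n. (m 1 - (1 - real i / n) * C) / n)"
    proof (rule sum_mono)
      fix i assume i: "i \<in> {..<n}"
      have "m 1 - (1 - real i / n) * C \<le> m (real i / n)"
        using inc[of "real i / n" 1] i n by (simp add: field_simps)
      then have "(m 1 - (1 - real i / n) * C) / n \<le> m (real i / n) / n" using n by (simp add: divide_right_mono)
      also have "\<dots> = (real (Suc i) / n - real i / n) * m (real i / n)" using n by (simp add: field_simps)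
      also have "\<dots> \<le> L (real (Suc i) / n) - L (real i / n)" by (rule low)
      finally show "(m 1 - (1 - real i / n) * C) / n \<le> L (real (Suc i) / n) - L (real i / n)" .
    qed
    also have "(\<Sum>i<n. (m 1 - (1 - real i / n) * C) / n) = m 1 - C / 2 - C / (2 * real n)"
    proof -
      have gauss: "(\<Sum>i<n. real i) = real n * (real n - 1) / 2"
        by (induction n) (auto simp: field_simps)
      have "(\<Sum>i<n. (m 1 - (1 - real i / n) * C) / n) = (\<Sum>i<n. (m 1 - C) / n + real i * (C / (n * n)))"
        using n by (intro sum.cong) (auto simp: field_simps)
      also have "\<dots> = (m 1 - C) + (real n * (real n - 1) / 2) * (C / (n * n))"
        using n by (simp only: sum.distrib sum_distrib_right[symmetric] gauss) simp
      also have "\<dots> = m 1 - C / 2 - C / (2 * real n)" using n by (simp add: field_simps)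
      finally show ?thesis .
    qed
    finally show ?thesis by simp
  qed
  have "(\<lambda>n. C / 2 + C / (2 * real n)) \<longlonglongrightarrow> C / 2 + 0"
    by (intro tendsto_add tendsto_const) real_asymp
  then have "m 1 - (L 1 - L 0) \<le> C / 2"
    using bound by (intro LIMSEQ_le_const[where X="\<lambda>n. C / 2 + C / (2 * real n)"]) (auto intro!: exI[of _ 1])
  then show ?thesis
    using kl_k(1)[of y v] by (simp add: m_def L_def C_def ennreal_leI)
qed

end

section \<open>Relative entropy and transport cost of mixtures\<close>

text \<open>The bridge to \<open>rel_entropy\<close>. As \<open>p\<close> is positive almost
  everywhere, g/p is a density with respect to the reference law. The two integrands differ by the
  integrable g - p, so they are integrable together, and the infinite cases of the two notions
  coincide.\<close>

lemma rel_entropy_density: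
  fixes p g :: "'a::euclidean_space \<Rightarrow> real"
  assumes p[measurable]: "p \<in> borel_measurable borel" and g[measurable]: "g \<in> borel_measurable borel"
    and p0: "\<And>x. 0 \<le> p x" and g0: "\<And>x. 0 \<le> g x" and p_pos: "AE x in lborel. 0 < p x"
    and int_p: "(\<integral>\<^sup>+x. ennreal (p x) \<partial>lborel) = 1" and int_g: "(\<integral>\<^sup>+x. ennreal (g x) \<partial>lborel) = 1"
  shows "rel_entropy (density lborel g) (density lborel p) = enn2ereal (kl g p)"
proof -
  define \<mu> where "\<mu> = density lborel (\<lambda>x. ennreal (p x))"
  define h where "h = (\<lambda>x. g x / p x)"
  define w where "w = (\<lambda>x. g x * ln (g x / p x))"
  have [measurable]: "h \<in> borel_measurable borel" "w \<in> borel_measurable borel"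
    unfolding h_def w_def by measurable
  have sets_\<mu>[simp, measurable_cong]: "sets \<mu> = sets borel" by (simp add: \<mu>_def)
  have h0: "0 \<le> h x" for x using p0 g0 by (simp add: h_def)
  interpret M: prob_space \<mu>
    by (intro prob_spaceI) (simp add: \<mu>_def emeasure_density int_p)
  have \<nu>: "density lborel g = density \<mu> h"
    unfolding \<mu>_def using p_pos
    by (subst density_density_eq) (auto intro!: density_cong simp: h_def ennreal_mult[symmetric] p0 g0 elim!: eventually_mono)
  have ac: "absolutely_continuous \<mu> (density lborel g)"
    unfolding \<nu> by (intro absolutely_continuousI_density) simp
  have RN: "AE x in \<mu>. RN_deriv \<mu> (density lborel g) x = ennreal (h x)"
    using M.RN_deriv_unique[of h "density lborel g"] \<nu> by (auto elim!: eventually_mono)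
  have AE_\<nu>: "AE x in density lborel g. P x" if "AE x in \<mu>. P x" for P
  proof -
    have "AE x in lborel. P x"
      using that p_pos unfolding \<mu>_def by (subst (asm) AE_density) (auto elim!: eventually_elim2)
    then show ?thesis by (subst AE_density) (auto elim!: eventually_mono)
  qed
  have ED: "AE x in density lborel g. entropy_density (exp 1) \<mu> (density lborel g) x = ln (h x)"
    by (rule AE_\<nu>[OF eventually_mono[OF RN]]) (simp add: entropy_density_def h0 log_ln)
  have edm: "entropy_density (exp 1) \<mu> (density lborel g) \<in> borel_measurable (density lborel g)"
  proof -
    have "entropy_density (exp 1) \<mu> (density lborel g) \<in> borel_measurable \<mu>" by measurable
    then show ?thesis by simp
  qed
  have "integrable (density lborel g) (entropy_density (exp 1) \<mu> (density lborel g))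
      \<longleftrightarrow> integrable (density lborel g) (\<lambda>x. ln (h x))"
    using ED edm by (intro integrable_cong_AE) auto
  also have "\<dots> \<longleftrightarrow> integrable lborel w"
    using g0 by (subst integrable_density) (auto simp: w_def h_def)
  finally have int_iff: "integrable (density lborel g) (entropy_density (exp 1) \<mu> (density lborel g))
      \<longleftrightarrow> integrable lborel w" .
  have KL: "KL_divergence (exp 1) \<mu> (density lborel g) = integral\<^sup>L lborel w"
    unfolding KL_divergence_def
    using g0 by (subst integral_cong_AE[OF edm _ ED]) (auto simp: integral_density w_def h_def)
  have intp: "integrable lborel p" "integral\<^sup>L lborel p = 1"
    using int_p p0 by (auto intro!: integrableI_nonneg simp: integral_eq_nn_integral)
  have intg: "integrable lborel g" "integral\<^sup>L lborel g = 1"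
    using int_g g0 by (auto intro!: integrableI_nonneg simp: integral_eq_nn_integral)
  have kn: "AE x in lborel. 0 \<le> kl_integrand (g x) (p x)"
    using p_pos by (rule eventually_mono) (rule kl_integrand_nonneg[OF g0])
  have int_kl: "integrable lborel (\<lambda>x. kl_integrand (g x) (p x)) \<longleftrightarrow> integrable lborel w"
  proof
    assume "integrable lborel (\<lambda>x. kl_integrand (g x) (p x))"
    then have "integrable lborel (\<lambda>x. kl_integrand (g x) (p x) + g x - p x)" using intp intg by auto
    then show "integrable lborel w" by (simp add: kl_integrand_def w_def)
  next
    assume "integrable lborel w"
    then show "integrable lborel (\<lambda>x. kl_integrand (g x) (p x))"
      unfolding kl_integrand_def using intp intg by (auto simp: w_def)
  qed
  show ?thesis
  proof (cases "integrable lborel w")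
    case True
    have "kl g p = ennreal (\<integral>x. kl_integrand (g x) (p x) \<partial>lborel)"
      unfolding kl_def using kn int_kl True by (intro nn_integral_eq_integral) auto
    also have "(\<integral>x. kl_integrand (g x) (p x) \<partial>lborel) = integral\<^sup>L lborel w"
      unfolding kl_integrand_def using True intp intg by (simp add: w_def)
    finally have k: "kl g p = ennreal (integral\<^sup>L lborel w)" .
    have "0 \<le> integral\<^sup>L lborel w"
      unfolding \<open>(\<integral>x. kl_integrand (g x) (p x) \<partial>lborel) = integral\<^sup>L lborel w\<close>[symmetric]
      using kn by (rule integral_nonneg_AE)
    then show ?thesis
      using True int_iff ac KL k by (simp add: rel_entropy_def \<mu>_def[symmetric] enn2ereal_ennreal)
  next
    case False
    have "kl g p = \<top>"
    proof (rule ccontr)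
      assume "kl g p \<noteq> \<top>"
      then have "integrable lborel (\<lambda>x. kl_integrand (g x) (p x))"
        using kn by (intro integrableI_nonneg) (auto simp: kl_def less_top)
      then show False using False int_kl by simp
    qed
    then show ?thesis using False int_iff by (simp add: rel_entropy_def \<mu>_def[symmetric])
  qed
qed

text \<open>Finite entropy includes absolute continuity, so Radon-Nikodym supplies a density, and
  the reference law has one with respect to Lebesgue measure.\<close>

lemma rel_entropy_finite_density:
  fixes p :: "'a::euclidean_space \<Rightarrow> real"
  assumes p[measurable]: "p \<in> borel_measurable borel" and p0: "\<And>x. 0 \<le> p x"
    and int_p: "(\<integral>\<^sup>+x. ennreal (p x) \<partial>lborel) = 1"
    and \<nu>: "prob_space \<nu>" "sets \<nu> = sets borel"
    and fin: "rel_entropy \<nu> (density lborel p) \<noteq> \<infinity>"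
  obtains g where "g \<in> borel_measurable borel" "\<And>x. 0 \<le> g x" "\<nu> = density lborel (\<lambda>x. ennreal (g x))"
proof -
  define \<mu> where "\<mu> = density lborel (\<lambda>x. ennreal (p x))"
  have sets_\<mu>[simp, measurable_cong]: "sets \<mu> = sets borel" by (simp add: \<mu>_def)
  interpret M: prob_space \<mu>
    by (intro prob_spaceI) (simp add: \<mu>_def emeasure_density int_p)
  have ac: "absolutely_continuous \<mu> \<nu>" using fin by (auto simp: rel_entropy_def \<mu>_def split: if_splits)
  obtain D where D: "D \<in> borel_measurable \<mu>" "AE x in \<mu>. RN_deriv \<mu> \<nu> x = ennreal (D x)" "\<And>x. 0 \<le> D x"
    by (rule M.real_RN_deriv[OF _ ac]) (use \<nu> prob_space.finite_measure in auto)
  have [measurable]: "D \<in> borel_measurable borel" using D(1) by simp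
  have "\<nu> = density \<mu> (RN_deriv \<mu> \<nu>)" using M.density_RN_deriv[OF ac] \<nu> by simp
  also have "\<dots> = density \<mu> (\<lambda>x. ennreal (D x))" using D by (intro density_cong) auto
  also have "\<dots> = density lborel (\<lambda>x. ennreal (p x * D x))"
    unfolding \<mu>_def using p0 D(3) by (subst density_density_eq) (auto simp: ennreal_mult)
  finally show thesis using p0 D(3) by (intro that[of "\<lambda>x. p x * D x"]) auto
qed

text \<open>The square of the 2-Wasserstein distance. Working with squares postpones all square
  roots to the final statement.\<close>

definition transport_cost :: "('a::euclidean_space) measure \<Rightarrow> 'a measure \<Rightarrow> ennreal" where
  "transport_cost \<mu> \<nu> = (INF \<pi>\<in>couplings \<mu> \<nu>. (\<integral>\<^sup>+ p. ennreal ((norm (fst p - snd p))\<^sup>2) \<partial>\<pi>))"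

lemma transport_cost_le:
  "\<pi> \<in> couplings \<mu> \<nu> \<Longrightarrow> transport_cost \<mu> \<nu> \<le> (\<integral>\<^sup>+ p. ennreal ((norm (fst p - snd p))\<^sup>2) \<partial>\<pi>)"
  unfolding transport_cost_def by (rule INF_lower)

lemma le_mult_transport_cost:
  assumes C: "0 < C"
    and le: "\<And>\<pi>. \<pi> \<in> couplings \<mu> \<nu> \<Longrightarrow> a \<le> ennreal C * (\<integral>\<^sup>+ p. ennreal ((norm (fst p - snd p))\<^sup>2) \<partial>\<pi>)"
  shows "a \<le> ennreal C * transport_cost \<mu> \<nu>"
proof -
  have one: "ennreal (1 / C) * ennreal C = 1" using C by (simp add: ennreal_mult[symmetric])
  have "ennreal (1 / C) * a \<le> transport_cost \<mu> \<nu>"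
    unfolding transport_cost_def
  proof (rule INF_greatest)
    fix \<pi> assume "\<pi> \<in> couplings \<mu> \<nu>"
    then have "ennreal (1 / C) * a \<le> ennreal (1 / C) * (ennreal C * (\<integral>\<^sup>+ p. ennreal ((norm (fst p - snd p))\<^sup>2) \<partial>\<pi>))"
      by (intro mult_left_mono le) auto
    then show "ennreal (1 / C) * a \<le> (\<integral>\<^sup>+ p. ennreal ((norm (fst p - snd p))\<^sup>2) \<partial>\<pi>)"
      by (simp add: mult.assoc[symmetric] one)
  qed
  then have "ennreal C * (ennreal (1 / C) * a) \<le> ennreal C * transport_cost \<mu> \<nu>"
    by (intro mult_left_mono) auto
  also have "ennreal C * (ennreal (1 / C) * a) = (ennreal (1 / C) * ennreal C) * a"
    by (simp only: mult_ac)
  finally show ?thesis by (simp only: one mult_1_left)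
qed

lemma wasserstein2_eq: "wasserstein2 \<mu> \<nu> = ennreal_sqrt (transport_cost \<mu> \<nu>)"
  by (simp add: wasserstein2_def transport_cost_def)

lemma ennreal_sqrt_mono: "a \<le> b \<Longrightarrow> ennreal_sqrt a \<le> ennreal_sqrt b"
  by (cases a; cases b) (auto simp: ennreal_sqrt_def top_unique intro!: ennreal_leI)

lemma ennreal_sqrt_mult_power2: "0 < r \<Longrightarrow> ennreal_sqrt (ennreal (r\<^sup>2) * a) = ennreal r * ennreal_sqrt a"
  by (cases a) (auto simp: ennreal_sqrt_def ennreal_mult[symmetric] real_sqrt_mult ennreal_mult_top)

context exp_family_kernel
begin

lemma prob_space_K: "prob_space (K y)"
  by (intro prob_spaceI) (simp add: K_def emeasure_density int_k)

lemma sets_K[simp]: "sets (K y) = sets borel"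
  by (simp add: K_def)

lemma K_measurable: "K \<in> measurable borel (prob_algebra borel)"
proof (rule measurable_prob_algebraI)
  show "K \<in> measurable borel (subprob_algebra borel)"
  proof (rule measurable_subprob_algebra)
    show "subprob_space (K y)" for y by (intro prob_space_imp_subprob_space prob_space_K)
    fix A :: "'a set" assume [measurable]: "A \<in> sets borel"
    have "(\<lambda>y. emeasure (K y) A) = (\<lambda>y. \<integral>\<^sup>+x. ennreal (k y x) * indicator A x \<partial>lborel)"
      by (simp add: K_def emeasure_density)
    also have "\<dots> \<in> borel_measurable borel" by measurable
    finally show "(\<lambda>y. emeasure (K y) A) \<in> borel_measurable borel" .
  qed simp
qed (rule prob_space_K)

text \<open>The Lebesgue density of the law after one transition. The integral may be infinite on a
  null set, where the value becomes 0.\<close>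

definition mixture :: "'y measure \<Rightarrow> 'a \<Rightarrow> real" where
  "mixture \<nu> x = enn2real (\<integral>\<^sup>+y. ennreal (k y x) \<partial>\<nu>)"

lemma mixture_nonneg: "0 \<le> mixture \<nu> x" by (simp add: mixture_def)

context
  fixes \<nu> :: "'y measure"
  assumes \<nu>: "prob_space \<nu>" and sets_\<nu>[simp, measurable_cong]: "sets \<nu> = sets borel"
begin

lemma \<nu>_space: "\<nu> \<in> space (prob_algebra borel)"
  using \<nu> by (simp add: space_prob_algebra)

lemma prob_space_bind_K: "prob_space (\<nu> \<bind> K)" and sets_bind_K: "sets (\<nu> \<bind> K) = sets borel"
  using prob_space_bind'[OF \<nu>_space K_measurable] sets_bind'[OF \<nu>_space K_measurable] by auto

lemma measurable_mixture[measurable]: "mixture \<nu> \<in> borel_measurable borel"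
proof -
  interpret prob_space \<nu> by (rule \<nu>)
  have [measurable]: "(\<lambda>(x, y). ennreal (k y x)) \<in> borel_measurable (borel \<Otimes>\<^sub>M \<nu>)"
    unfolding k_def by measurable
  show ?thesis unfolding mixture_def[abs_def] by measurable
qed

lemma nn_integral_mixture:
  assumes [measurable]: "h \<in> borel_measurable borel"
  shows "(\<integral>\<^sup>+x. (\<integral>\<^sup>+y. ennreal (k y x) \<partial>\<nu>) * h x \<partial>lborel) = (\<integral>\<^sup>+x. h x \<partial>(\<nu> \<bind> K))"
proof -
  interpret prob_space \<nu> by (rule \<nu>)
  interpret P: pair_sigma_finite \<nu> "lborel :: 'a measure" by standard
  have "(\<integral>\<^sup>+x. (\<integral>\<^sup>+y. ennreal (k y x) \<partial>\<nu>) * h x \<partial>lborel) = (\<integral>\<^sup>+x. (\<integral>\<^sup>+y. ennreal (k y x) * h x \<partial>\<nu>) \<partial>lborel)"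
    by (intro nn_integral_cong nn_integral_multc[symmetric]) (simp add: k_def)
  also have "\<dots> = (\<integral>\<^sup>+y. (\<integral>\<^sup>+x. ennreal (k y x) * h x \<partial>lborel) \<partial>\<nu>)"
    by (rule P.Fubini') (simp add: k_def)
  also have "\<dots> = (\<integral>\<^sup>+y. (\<integral>\<^sup>+x. h x \<partial>K y) \<partial>\<nu>)"
    by (simp add: K_def nn_integral_density)
  also have "\<dots> = (\<integral>\<^sup>+x. h x \<partial>(\<nu> \<bind> K))"
    using measurable_prob_algebraD[OF K_measurable]
    by (intro nn_integral_bind[symmetric, where B=borel]) (auto cong: measurable_cong_sets)
  finally show ?thesis .
qed

lemma mixture_finite: "AE x in lborel. (\<integral>\<^sup>+y. ennreal (k y x) \<partial>\<nu>) \<noteq> \<infinity>"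
proof -
  interpret prob_space \<nu> by (rule \<nu>)
  interpret bK: prob_space "\<nu> \<bind> K" by (rule prob_space_bind_K)
  have [measurable]: "(\<lambda>(x, y). ennreal (k y x)) \<in> borel_measurable (borel \<Otimes>\<^sub>M \<nu>)"
    unfolding k_def by measurable
  have "(\<integral>\<^sup>+x. (\<integral>\<^sup>+y. ennreal (k y x) \<partial>\<nu>) \<partial>lborel) = 1"
    using nn_integral_mixture[of "\<lambda>_. 1"] bK.emeasure_space_1 by simp
  then show ?thesis by (intro nn_integral_noteq_infinite) auto
qed

lemma mixture_eq: "AE x in lborel. ennreal (mixture \<nu> x) = (\<integral>\<^sup>+y. ennreal (k y x) \<partial>\<nu>)"
  using mixture_finite by (rule eventually_mono) (simp add: mixture_def less_top)

lemma mixture_pos: "AE x in lborel. 0 < mixture \<nu> x"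
  using mixture_finite
proof eventually_elim
  case (elim x)
  interpret prob_space \<nu> by (rule \<nu>)
  have [measurable]: "(\<lambda>y. ennreal (k y x)) \<in> borel_measurable \<nu>" unfolding k_def by measurable
  have "(\<integral>\<^sup>+y. ennreal (k y x) \<partial>\<nu>) \<noteq> 0"
  proof
    assume "(\<integral>\<^sup>+y. ennreal (k y x) \<partial>\<nu>) = 0"
    then have "AE y in \<nu>. ennreal (k y x) = 0" by (subst (asm) nn_integral_0_iff_AE) auto
    then have "AE y in \<nu>. False" by (rule eventually_mono) (use k_pos[of _ x] in \<open>simp add: ennreal_eq_0_iff not_le[symmetric]\<close>)
    then show False by simp
  qed
  then show ?case using elim by (simp add: mixture_def enn2real_positive_iff zero_less_iff_neq_zero less_top)
qed

lemma bind_K_eq: "\<nu> \<bind> K = density lborel (\<lambda>x. ennreal (mixture \<nu> x))"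
proof (rule measure_eqI)
  fix A assume "A \<in> sets (\<nu> \<bind> K)"
  then have [measurable]: "A \<in> sets borel" by (simp add: sets_bind_K)
  have "emeasure (\<nu> \<bind> K) A = (\<integral>\<^sup>+x. indicator A x \<partial>(\<nu> \<bind> K))"
    by (simp add: sets_bind_K)
  also have "\<dots> = (\<integral>\<^sup>+x. (\<integral>\<^sup>+y. ennreal (k y x) \<partial>\<nu>) * indicator A x \<partial>lborel)"
    by (rule nn_integral_mixture[symmetric]) measurable
  also have "\<dots> = (\<integral>\<^sup>+x. ennreal (mixture \<nu> x) * indicator A x \<partial>lborel)"
    using mixture_eq by (intro nn_integral_cong_AE) (auto elim!: eventually_mono)
  finally show "emeasure (\<nu> \<bind> K) A = emeasure (density lborel (\<lambda>x. ennreal (mixture \<nu> x))) A"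
    by (simp add: emeasure_density)
qed (simp add: sets_bind_K)

lemma int_mixture: "(\<integral>\<^sup>+x. ennreal (mixture \<nu> x) \<partial>lborel) = 1"
proof -
  interpret prob_space "density lborel (\<lambda>x. ennreal (mixture \<nu> x))"
    using prob_space_bind_K by (simp add: bind_K_eq)
  show ?thesis using emeasure_space_1 by (simp add: emeasure_density)
qed

text \<open>On the product space the uniform variables are independent of the starting point, so
  that, given the starting point, the sample has law \<open>K\<close>.\<close>

lemma distr_coupling_map:
  assumes N: "prob_space N" and Q[measurable]: "Q \<in> borel_measurable (borel \<Otimes>\<^sub>M N)"
    and law: "\<And>y h. h \<in> borel_measurable borel \<Longrightarrow> (\<integral>\<^sup>+u. h (Q (y, u)) \<partial>N) = (\<integral>\<^sup>+x. ennreal (k y x) * h x \<partial>lborel)"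
    and X[measurable]: "X \<in> borel_measurable \<gamma>" and distr_X: "distr \<gamma> borel X = \<nu>"
  shows "distr (\<gamma> \<Otimes>\<^sub>M N) borel (\<lambda>w. Q (X (fst w), snd w)) = \<nu> \<bind> K"
proof (rule measure_eqI)
  interpret N: prob_space N by (rule N)
  fix A assume "A \<in> sets (distr (\<gamma> \<Otimes>\<^sub>M N) borel (\<lambda>w. Q (X (fst w), snd w)))"
  then have [measurable]: "A \<in> sets borel" by simp
  have "emeasure (distr (\<gamma> \<Otimes>\<^sub>M N) borel (\<lambda>w. Q (X (fst w), snd w))) A
      = (\<integral>\<^sup>+z. indicator A z \<partial>distr (\<gamma> \<Otimes>\<^sub>M N) borel (\<lambda>w. Q (X (fst w), snd w)))" by simp
  also have "\<dots> = (\<integral>\<^sup>+w. indicator A (Q (X (fst w), snd w)) \<partial>(\<gamma> \<Otimes>\<^sub>M N))"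
    by (rule nn_integral_distr) measurable
  also have "\<dots> = (\<integral>\<^sup>+p. (\<integral>\<^sup>+u. indicator A (Q (X p, u)) \<partial>N) \<partial>\<gamma>)"
    by (subst N.nn_integral_fst[symmetric]) simp_all
  also have "\<dots> = (\<integral>\<^sup>+p. emeasure (K (X p)) A \<partial>\<gamma>)"
    by (simp add: law K_def emeasure_density)
  also have "\<dots> = (\<integral>\<^sup>+y. emeasure (K y) A \<partial>distr \<gamma> borel X)"
    using measurable_prob_algebraD[OF K_measurable]
    by (subst nn_integral_distr) (auto intro!: measurable_compose[OF _ measurable_emeasure_subprob_algebra])
  also have "\<dots> = emeasure (\<nu> \<bind> K) A"
    unfolding distr_X by (rule emeasure_bind_prob_algebra[symmetric, OF \<nu>_space K_measurable]) simp
  finally show "emeasure (distr (\<gamma> \<Otimes>\<^sub>M N) borel (\<lambda>w. Q (X (fst w), snd w))) A = emeasure (\<nu> \<bind> K) A" .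
qed (simp add: sets_bind_K)

end

context
  fixes \<mu> \<nu> :: "'y measure"
  assumes \<mu>: "prob_space \<mu>" "sets \<mu> = sets borel" and \<nu>: "prob_space \<nu>" "sets \<nu> = sets borel"
begin

text \<open>Couple the starting points arbitrarily and run both with the same uniform variables.
  \<open>coupling_map\<close> bounds c times the conditional cost by (\<kappa> |y - y'|)^2 / c,
  hence the factor (\<kappa>/c)^2.\<close>

lemma transport_cost_bind_le:
  "transport_cost (\<nu> \<bind> K) (\<mu> \<bind> K) \<le> ennreal ((\<kappa> / c)\<^sup>2) * transport_cost \<nu> \<mu>"
proof (rule le_mult_transport_cost)
  show "0 < (\<kappa> / c)\<^sup>2" using \<kappa>_pos c_pos by simp
  fix \<gamma> assume \<gamma>: "\<gamma> \<in> couplings \<nu> \<mu>"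
  then interpret \<gamma>: prob_space \<gamma> by (simp add: couplings_def)
  have [measurable_cong]: "sets \<gamma> = sets (borel \<Otimes>\<^sub>M borel)" and
    marg: "distr \<gamma> borel fst = \<nu>" "distr \<gamma> borel snd = \<mu>" using \<gamma> by (auto simp: couplings_def)
  obtain N :: "('a \<Rightarrow> real) measure" and Q where N: "prob_space N" and Q[measurable]: "Q \<in> borel_measurable (borel \<Otimes>\<^sub>M N)"
    and law: "\<And>y h. h \<in> borel_measurable borel \<Longrightarrow> (\<integral>\<^sup>+u. h (Q (y, u)) \<partial>N) = (\<integral>\<^sup>+x. ennreal (k y x) * h x \<partial>lborel)"
    and D: "\<And>y v. (\<integral>\<^sup>+u. ennreal (c * (norm (Q (y + v, u) - Q (y, u)))\<^sup>2) \<partial>N) \<le> ennreal ((norm (B v))\<^sup>2 / c)"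
    by (rule coupling_map) (rule that, assumption, assumption, blast, blast)
  interpret N: prob_space N by (rule N)
  interpret P: pair_prob_space \<gamma> N ..
  have [measurable]: "(\<lambda>u. Q (y, u)) \<in> borel_measurable N" for y by (rule measurable_Pair2[OF Q]) simp
  have D': "(\<integral>\<^sup>+u. ennreal ((norm (Q (y, u) - Q (y', u)))\<^sup>2) \<partial>N) \<le> ennreal ((\<kappa> / c)\<^sup>2) * ennreal ((norm (y - y'))\<^sup>2)" for y y'
  proof -
    let ?I = "\<integral>\<^sup>+u. ennreal ((norm (Q (y, u) - Q (y', u)))\<^sup>2) \<partial>N"
    have "ennreal c * ?I = (\<integral>\<^sup>+u. ennreal (c * (norm (Q (y' + (y - y'), u) - Q (y', u)))\<^sup>2) \<partial>N)"
      using c_pos by (simp add: ennreal_mult nn_integral_cmult)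
    also have "\<dots> \<le> ennreal ((norm (B (y - y')))\<^sup>2 / c)" by (rule D)
    also have "\<dots> \<le> ennreal ((\<kappa> * norm (y - y'))\<^sup>2 / c)"
      using c_pos B_bound[of "y - y'"] by (intro ennreal_leI divide_right_mono power_mono) auto
    finally have "ennreal (1 / c) * (ennreal c * ?I) \<le> ennreal (1 / c) * ennreal ((\<kappa> * norm (y - y'))\<^sup>2 / c)"
      by (intro mult_left_mono) auto
    moreover have "ennreal (1 / c) * (ennreal c * ?I) = ?I"
      using c_pos by (simp add: mult.assoc[symmetric] ennreal_mult[symmetric])
    moreover have "ennreal (1 / c) * ennreal ((\<kappa> * norm (y - y'))\<^sup>2 / c) = ennreal ((\<kappa> / c)\<^sup>2) * ennreal ((norm (y - y'))\<^sup>2)"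
    proof -
      have "1 / c * ((\<kappa> * norm (y - y'))\<^sup>2 / c) = (\<kappa> / c)\<^sup>2 * (norm (y - y'))\<^sup>2"
        by (simp add: power_mult_distrib power_divide power2_eq_square)
      then show ?thesis using c_pos by (simp only: ennreal_mult[symmetric] zero_le_power2 divide_nonneg_pos zero_le_one)
    qed
    ultimately show ?thesis by simp
  qed
  define \<gamma>' where "\<gamma>' = distr (\<gamma> \<Otimes>\<^sub>M N) (borel \<Otimes>\<^sub>M borel) (\<lambda>w. (Q (fst (fst w), snd w), Q (snd (fst w), snd w)))"
  have "\<gamma>' \<in> couplings (\<nu> \<bind> K) (\<mu> \<bind> K)"
  proof -
    have "distr \<gamma>' borel fst = distr (\<gamma> \<Otimes>\<^sub>M N) borel (\<lambda>w. Q (fst (fst w), snd w))"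
      unfolding \<gamma>'_def by (subst distr_distr) (auto simp: comp_def)
    also have "\<dots> = \<nu> \<bind> K"
      by (rule distr_coupling_map[OF \<nu> N Q law _ marg(1)]) auto
    finally have 1: "distr \<gamma>' borel fst = \<nu> \<bind> K" .
    have "distr \<gamma>' borel snd = distr (\<gamma> \<Otimes>\<^sub>M N) borel (\<lambda>w. Q (snd (fst w), snd w))"
      unfolding \<gamma>'_def by (subst distr_distr) (auto simp: comp_def)
    also have "\<dots> = \<mu> \<bind> K"
      by (rule distr_coupling_map[OF \<mu> N Q law _ marg(2)]) auto
    finally have 2: "distr \<gamma>' borel snd = \<mu> \<bind> K" .
    have "prob_space \<gamma>'" unfolding \<gamma>'_def by (rule P.prob_space_distr) measurable
    then show ?thesis using 1 2 by (simp add: couplings_def) (simp add: \<gamma>'_def)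
  qed
  then have "transport_cost (\<nu> \<bind> K) (\<mu> \<bind> K) \<le> (\<integral>\<^sup>+ p. ennreal ((norm (fst p - snd p))\<^sup>2) \<partial>\<gamma>')"
    by (rule transport_cost_le)
  also have "\<dots> = (\<integral>\<^sup>+p. (\<integral>\<^sup>+u. ennreal ((norm (Q (fst p, u) - Q (snd p, u)))\<^sup>2) \<partial>N) \<partial>\<gamma>)"
    unfolding \<gamma>'_def by (subst nn_integral_distr) (auto simp: N.nn_integral_fst[symmetric])
  also have "\<dots> \<le> (\<integral>\<^sup>+p. ennreal ((\<kappa> / c)\<^sup>2) * ennreal ((norm (fst p - snd p))\<^sup>2) \<partial>\<gamma>)"
    by (intro nn_integral_mono D')
  also have "\<dots> = ennreal ((\<kappa> / c)\<^sup>2) * (\<integral>\<^sup>+p. ennreal ((norm (fst p - snd p))\<^sup>2) \<partial>\<gamma>)"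
    by (rule nn_integral_cmult) measurable
  finally show "transport_cost (\<nu> \<bind> K) (\<mu> \<bind> K) \<le> ennreal ((\<kappa> / c)\<^sup>2) * (\<integral>\<^sup>+p. ennreal ((norm (fst p - snd p))\<^sup>2) \<partial>\<gamma>)" .
qed

lemma rel_entropy_bind: "rel_entropy (\<nu> \<bind> K) (\<mu> \<bind> K) = enn2ereal (kl (mixture \<nu>) (mixture \<mu>))"
  unfolding bind_K_eq[OF \<nu>] bind_K_eq[OF \<mu>]
  by (rule rel_entropy_density)
    (auto simp: mixture_nonneg int_mixture[OF \<nu>] int_mixture[OF \<mu>] mixture_pos[OF \<mu>]
      intro: measurable_mixture[OF \<nu>] measurable_mixture[OF \<mu>])

text \<open>The smoothing step, from distance to entropy. Any coupling of the starting laws presents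
  both mixtures as mixtures over the same pairs, and joint convexity reduces the claim to
  \<open>kl_k_le\<close> for each pair.\<close>

lemma kl_bind_le_transport_cost:
  "kl (mixture \<nu>) (mixture \<mu>) \<le> ennreal (\<kappa>\<^sup>2 / (2 * c)) * transport_cost \<nu> \<mu>"
proof (rule le_mult_transport_cost)
  show "0 < \<kappa>\<^sup>2 / (2 * c)" using \<kappa>_pos c_pos by simp
  fix \<gamma> assume \<gamma>: "\<gamma> \<in> couplings \<nu> \<mu>"
  then interpret \<gamma>: prob_space \<gamma> by (simp add: couplings_def)
  have [measurable_cong]: "sets \<gamma> = sets (borel \<Otimes>\<^sub>M borel)" and
    marg: "distr \<gamma> borel fst = \<nu>" "distr \<gamma> borel snd = \<mu>" using \<gamma> by (auto simp: couplings_def)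
  have [measurable]: "(\<lambda>y. ennreal (k y x)) \<in> borel_measurable borel" for x unfolding k_def by measurable
  have m1: "(\<integral>\<^sup>+p. ennreal (k (fst p) x) \<partial>\<gamma>) = (\<integral>\<^sup>+y. ennreal (k y x) \<partial>\<nu>)" for x
    unfolding marg(1)[symmetric] by (subst nn_integral_distr) auto
  have m2: "(\<integral>\<^sup>+p. ennreal (k (snd p) x) \<partial>\<gamma>) = (\<integral>\<^sup>+y. ennreal (k y x) \<partial>\<mu>)" for x
    unfolding marg(2)[symmetric] by (subst nn_integral_distr) auto
  have "kl (mixture \<nu>) (mixture \<mu>) \<le> (\<integral>\<^sup>+p. kl (k (fst p)) (k (snd p)) \<partial>\<gamma>)"
  proof -
    have "(\<lambda>(p, x). k (fst p) x) \<in> borel_measurable (\<gamma> \<Otimes>\<^sub>M borel)" "(\<lambda>(p, x). k (snd p) x) \<in> borel_measurable (\<gamma> \<Otimes>\<^sub>M borel)"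
      unfolding k_def by measurable
    from \<gamma>.kl_mixture_le[OF this] show ?thesis
      using mixture_finite[OF \<nu>] mixture_finite[OF \<mu>]
      by (simp add: k_pos k_nonneg m1 m2 mixture_def[abs_def])
  qed
  also have "\<dots> \<le> (\<integral>\<^sup>+p. ennreal (\<kappa>\<^sup>2 / (2 * c)) * ennreal ((norm (fst p - snd p))\<^sup>2) \<partial>\<gamma>)"
  proof (rule nn_integral_mono)
    fix p :: "'y \<times> 'y"
    have "kl (k (fst p)) (k (snd p)) \<le> ennreal ((norm (B (fst p - snd p)))\<^sup>2 / (2 * c))"
      using kl_k_le[of "snd p" "fst p - snd p"] by simp
    also have "\<dots> \<le> ennreal ((\<kappa> * norm (fst p - snd p))\<^sup>2 / (2 * c))"
      using c_pos B_bound[of "fst p - snd p"] by (intro ennreal_leI divide_right_mono power_mono) auto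
    finally show "kl (k (fst p)) (k (snd p)) \<le> ennreal (\<kappa>\<^sup>2 / (2 * c)) * ennreal ((norm (fst p - snd p))\<^sup>2)"
      using c_pos by (simp add: ennreal_mult[symmetric] power_mult_distrib)
  qed
  also have "\<dots> = ennreal (\<kappa>\<^sup>2 / (2 * c)) * (\<integral>\<^sup>+p. ennreal ((norm (fst p - snd p))\<^sup>2) \<partial>\<gamma>)"
    by (rule nn_integral_cmult) measurable
  finally show "kl (mixture \<nu>) (mixture \<mu>) \<le> ennreal (\<kappa>\<^sup>2 / (2 * c)) * (\<integral>\<^sup>+p. ennreal ((norm (fst p - snd p))\<^sup>2) \<partial>\<gamma>)" .
qed

end

text \<open>Data processing: both output laws are mixed over the reference law, one of them with the
  relative density h = g/p as weight.\<close>

lemma kl_bind_le: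
  assumes p[measurable]: "p \<in> borel_measurable borel" and g[measurable]: "g \<in> borel_measurable borel"
    and p_pos: "\<And>y. 0 < p y" and g0: "\<And>y. 0 \<le> g y"
    and int_p: "(\<integral>\<^sup>+y. ennreal (p y) \<partial>lborel) = 1"
    and int_g: "(\<integral>\<^sup>+y. ennreal (g y) \<partial>lborel) = 1"
  shows "kl (mixture (density lborel g)) (mixture (density lborel p)) \<le> kl g p"
proof -
  define \<mu> where "\<mu> = density lborel (\<lambda>y. ennreal (p y))"
  define \<nu> where "\<nu> = density lborel (\<lambda>y. ennreal (g y))"
  have [simp, measurable_cong]: "sets \<mu> = sets borel" "sets \<nu> = sets borel" by (simp_all add: \<mu>_def \<nu>_def)
  have \<nu>: "prob_space \<nu>" by (intro prob_spaceI) (simp add: \<nu>_def emeasure_density int_g)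
  interpret M: prob_space \<mu> by (intro prob_spaceI) (simp add: \<mu>_def emeasure_density int_p)
  define h where "h = (\<lambda>y. g y / p y)"
  have [measurable]: "h \<in> borel_measurable borel" unfolding h_def by measurable
  have h0: "0 \<le> h y" for y using p_pos[of y] g0[of y] by (simp add: h_def)
  have [measurable]: "(\<lambda>y. ennreal (k y x)) \<in> borel_measurable borel" for x unfolding k_def by measurable
  have [measurable]: "(\<lambda>y. k y x) \<in> borel_measurable borel" for x unfolding k_def by measurable
  have m: "(\<integral>\<^sup>+y. ennreal (h y * k y x) \<partial>\<mu>) = (\<integral>\<^sup>+y. ennreal (k y x) \<partial>\<nu>)" for x
  proof -
    have "ennreal (p y) * ennreal (h y * k y x) = ennreal (g y) * ennreal (k y x)" for y
      using p_pos[of y] g0[of y] k_nonneg[of y x] by (simp add: h_def ennreal_mult[symmetric])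
    then show ?thesis by (simp add: \<mu>_def \<nu>_def nn_integral_density)
  qed
  have "kl (mixture \<nu>) (mixture \<mu>) \<le> (\<integral>\<^sup>+y. kl (\<lambda>x. h y * k y x) (k y) \<partial>\<mu>)"
  proof -
    have "(\<lambda>(y, x). h y * k y x) \<in> borel_measurable (\<mu> \<Otimes>\<^sub>M borel)" "(\<lambda>(y, x). k y x) \<in> borel_measurable (\<mu> \<Otimes>\<^sub>M borel)"
      unfolding k_def by measurable
    from M.kl_mixture_le[OF this] show ?thesis
      using mixture_finite[OF \<nu>] mixture_finite[OF M.prob_space_axioms]
      by (simp add: k_pos k_nonneg h0 m mixture_def[abs_def])
  qed
  also have "\<dots> = (\<integral>\<^sup>+y. ennreal (kl_integrand (h y) 1) \<partial>\<mu>)"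
  proof (rule nn_integral_cong)
    fix y
    \<comment> \<open>Homogeneity of degree one: the kernel density factors out and integrates to
      1.\<close>
    have "kl_integrand (h y * k y x) (k y x) = kl_integrand (h y) 1 * k y x" for x
      using k_pos[of y x] by (simp add: kl_integrand_def algebra_simps)
    then have "kl (\<lambda>x. h y * k y x) (k y) = (\<integral>\<^sup>+x. ennreal (kl_integrand (h y) 1) * ennreal (k y x) \<partial>lborel)"
      using kl_integrand_nonneg[OF h0, of 1 y] k_nonneg by (simp add: kl_def ennreal_mult)
    then show "kl (\<lambda>x. h y * k y x) (k y) = ennreal (kl_integrand (h y) 1)"
      by (simp add: nn_integral_cmult int_k)
  qed
  also have "\<dots> = kl g p"
  proof -
    have "ennreal (p y) * ennreal (kl_integrand (h y) 1) = ennreal (kl_integrand (g y) (p y))" for y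
    proof -
      have "p y * kl_integrand (h y) 1 = kl_integrand (g y) (p y)"
        using p_pos[of y] by (simp add: kl_integrand_def h_def field_simps)
      then show ?thesis
        using p_pos[of y] kl_integrand_nonneg[OF h0, of 1 y] by (simp add: ennreal_mult[symmetric])
    qed
    then show ?thesis by (simp add: \<mu>_def nn_integral_density kl_def)
  qed
  finally show ?thesis by (simp add: \<mu>_def \<nu>_def)
qed

end

section \<open>Gaussian densities and positive definite matrices\<close>

lemma nn_integral_lborel_swap:
  fixes h :: "real^'n \<Rightarrow> ennreal"
  assumes h[measurable]: "h \<in> borel_measurable borel"
  shows "(\<integral>\<^sup>+x. h (\<chi> i. x $ Transposition.transpose m n i) \<partial>lborel) = (\<integral>\<^sup>+x. h x \<partial>lborel)"
proof -
  define T where "T = (\<lambda>x :: real^'n. \<chi> i. x $ Transposition.transpose m n i)"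
  have lin: "linear T" by (rule linearI) (simp_all add: T_def vec_eq_iff)
  have [measurable]: "T \<in> borel_measurable borel"
    by (intro borel_measurable_continuous_onI linear_continuous_on linear_conv_bounded_linear[THEN iffD1] lin)
  have inner: "T x \<bullet> y = x \<bullet> T y" for x y
    unfolding inner_vec_def T_def
    using sum.permute[OF permutes_swap_id, of m UNIV n "\<lambda>i. x $ i \<bullet> y $ Transposition.transpose m n i"]
    by (simp add: o_def)
  have TT: "T (T x) = x" for x by (simp add: T_def vec_eq_iff)
  have bij: "bij_betw T Basis Basis"
  proof (rule bij_betwI[where g=T])
    have "T (axis i 1) = axis (Transposition.transpose m n i) 1" for i
      by (auto simp: T_def vec_eq_iff axis_def transpose_def)
    then show "T \<in> Basis \<rightarrow> Basis" "T \<in> Basis \<rightarrow> Basis" by (auto simp: Basis_vec_def)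
  qed (auto simp: TT)
  have "lborel = distr lborel borel T"
  proof (rule lborel_eqI)
    fix l u :: "real^'n" assume lu: "\<And>b. b \<in> Basis \<Longrightarrow> l \<bullet> b \<le> u \<bullet> b"
    have TB: "T b \<in> Basis" if "b \<in> Basis" for b using bij that by (auto simp: bij_betw_def)
    have "T -` box l u = box (T l) (T u)"
    proof (intro set_eqI)
      fix x
      have "(\<forall>b\<in>Basis. T l \<bullet> b < x \<bullet> b \<and> x \<bullet> b < T u \<bullet> b) \<longleftrightarrow> (\<forall>b\<in>Basis. T l \<bullet> T b < x \<bullet> T b \<and> x \<bullet> T b < T u \<bullet> T b)"
        using TB TT by metis
      then show "x \<in> T -` box l u \<longleftrightarrow> x \<in> box (T l) (T u)"
        by (simp add: mem_box inner[symmetric] TT)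
    qed
    then have "emeasure (distr lborel borel T) (box l u) = emeasure lborel (box (T l) (T u))"
      by (subst emeasure_distr) auto
    also have "\<dots> = (\<Prod>b\<in>Basis. (T u - T l) \<bullet> b)"
      using lu TB by (intro emeasure_lborel_box) (simp add: inner)
    also have "\<dots> = (\<Prod>b\<in>Basis. (u - l) \<bullet> b)"
      using prod.reindex_bij_betw[OF bij, of "\<lambda>b. (u - l) \<bullet> b"] by (simp add: inner inner_diff_left)
    finally show "emeasure (distr lborel borel T) (box l u) = (\<Prod>b\<in>Basis. (u - l) \<bullet> b)" .
  qed simp
  then have "(\<integral>\<^sup>+x. h x \<partial>lborel) = (\<integral>\<^sup>+x. h x \<partial>distr lborel borel T)" by simp
  also have "\<dots> = (\<integral>\<^sup>+x. h (T x) \<partial>lborel)" by (rule nn_integral_distr) measurable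
  finally show ?thesis by (simp add: T_def)
qed

lemma nn_integral_lborel_stretch:
  fixes h :: "real^'n \<Rightarrow> ennreal"
  assumes h[measurable]: "h \<in> borel_measurable borel" and c: "\<And>i. c i \<noteq> 0"
  shows "(\<integral>\<^sup>+x. h (\<chi> i. c i * x $ i) \<partial>lborel) * ennreal \<bar>\<Prod>i\<in>UNIV. c i\<bar> = (\<integral>\<^sup>+x. h x \<partial>lborel)"
proof -
  define d where "d = (\<lambda>j. (\<chi> i. c i) \<bullet> (j :: real^'n))"
  define T where "T = (\<lambda>x :: real^'n. 0 + (\<Sum>j\<in>Basis. (d j * (x \<bullet> j)) *\<^sub>R j))"
  have d: "d j \<noteq> 0" if "j \<in> Basis" for j
    using that c by (auto simp: d_def Basis_vec_def inner_axis)
  have T: "T x = (\<chi> i. c i * x $ i)" for x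
  proof -
    have "T x $ i = c i * x $ i" for i
    proof -
      have "T x $ i = T x \<bullet> axis i 1" by (simp add: inner_axis)
      also have "\<dots> = d (axis i 1) * (x \<bullet> axis i 1)"
        by (simp add: T_def inner_sum_left inner_Basis if_distrib cong: if_cong)
      finally show ?thesis by (simp add: d_def inner_axis)
    qed
    then show ?thesis by (simp add: vec_eq_iff)
  qed
  have [measurable]: "T \<in> borel_measurable borel" unfolding T_def by measurable
  have prod: "(\<Prod>j\<in>Basis. \<bar>d j\<bar>) = \<bar>\<Prod>i\<in>UNIV. c i\<bar>"
  proof -
    have "inj (\<lambda>i::'n. axis i (1::real))" by (auto simp: inj_on_def axis_eq_axis)
    moreover have B: "Basis = range (\<lambda>i::'n. axis i (1::real))" by (auto simp: Basis_vec_def)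
    ultimately show ?thesis unfolding B by (simp add: prod.reindex d_def inner_axis abs_prod)
  qed
  have "(\<integral>\<^sup>+x. h x \<partial>lborel) = (\<integral>\<^sup>+x. h x \<partial>density (distr lborel borel T) (\<lambda>_. (\<Prod>j\<in>Basis. \<bar>d j\<bar>)))"
    using lborel_affine_euclidean[of d 0] d by (simp add: T_def)
  also have "\<dots> = ennreal \<bar>\<Prod>i\<in>UNIV. c i\<bar> * (\<integral>\<^sup>+x. h (T x) \<partial>lborel)"
    unfolding prod by (simp add: nn_integral_density nn_integral_distr nn_integral_cmult)
  finally show ?thesis by (simp add: T mult.commute)
qed

text \<open>With the other coordinates fixed, a shear is a translation of coordinate
  \<open>m\<close>, so Tonelli reduces it to one-dimensional translation invariance.\<close>

lemma nn_integral_lborel_shear: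
  fixes h :: "real^'n \<Rightarrow> ennreal"
  assumes h[measurable]: "h \<in> borel_measurable borel" and mn: "m \<noteq> n"
  shows "(\<integral>\<^sup>+x. h (\<chi> i. if i = m then x $ m + x $ n else x $ i) \<partial>lborel) = (\<integral>\<^sup>+x. h x \<partial>lborel)"
proof -
  interpret L: product_sigma_finite "\<lambda>_::real^'n. lborel :: real measure" by standard
  let ?L = "\<lambda>I. PiM I (\<lambda>_::real^'n. lborel :: real measure)"
  define b b' :: "real^'n" where "b = axis m 1" and "b' = axis n 1"
  define I where "I = Basis - {b}"
  have b: "b \<in> Basis" "b' \<in> I" "b \<noteq> b'" using mn by (auto simp: b_def b'_def I_def Basis_vec_def axis_eq_axis)
  have I: "finite I" "b \<notin> I" "insert b I = Basis" using b by (auto simp: I_def)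
  define T where "T = (\<lambda>x :: real^'n. x + (x \<bullet> b') *\<^sub>R b)"
  have T: "T x = (\<chi> i. if i = m then x $ m + x $ n else x $ i)" for x
    by (simp add: T_def b_def b'_def vec_eq_iff inner_axis) (auto simp: axis_def)
  have [measurable]: "T \<in> borel_measurable borel" unfolding T_def by measurable
  have upd: "basis_sum (x(b := y)) = y *\<^sub>R b + basis_sum (x(b := 0))" for x y
  proof -
    have "basis_sum (x(b := y)) = y *\<^sub>R b + (\<Sum>c\<in>I. x c *\<^sub>R c)" for y
    proof -
      have "basis_sum (x(b := y)) = (\<Sum>c\<in>insert b I. (x(b := y)) c *\<^sub>R c)" by (simp add: basis_sum_def I)
      also have "\<dots> = y *\<^sub>R b + (\<Sum>c\<in>I. (x(b := y)) c *\<^sub>R c)"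
        by (subst sum.insert[OF I(1,2)]) simp
      also have "(\<Sum>c\<in>I. (x(b := y)) c *\<^sub>R c) = (\<Sum>c\<in>I. x c *\<^sub>R c)" using I by (intro sum.cong) auto
      finally show ?thesis .
    qed
    from this[of y] this[of 0] show ?thesis by simp
  qed
  have T_upd: "T (basis_sum (x(b := y))) = basis_sum (x(b := y + x b'))" for x y
  proof -
    have "basis_sum (x(b := y)) \<bullet> b' = x b'"
      using b by (simp add: basis_sum_def I_def)
    then have "T (basis_sum (x(b := y))) = y *\<^sub>R b + basis_sum (x(b := 0)) + x b' *\<^sub>R b"
      by (simp add: T_def upd[of x y])
    also have "\<dots> = basis_sum (x(b := y + x b'))"
      by (simp add: upd[of x "y + x b'"] algebra_simps)
    finally show ?thesis .
  qed
  have "(\<integral>\<^sup>+x. h (T x) \<partial>lborel) = (\<integral>\<^sup>+x. h (T (basis_sum x)) \<partial>?L (insert b I))"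
    unfolding I(3) by (rule nn_integral_lborel_basis_sum) measurable
  also have "\<dots> = (\<integral>\<^sup>+x. \<integral>\<^sup>+y. h (T (basis_sum (x(b := y)))) \<partial>lborel \<partial>?L I)"
    by (rule L.product_nn_integral_insert[OF I(1,2)]) (simp only: I, measurable)
  also have "\<dots> = (\<integral>\<^sup>+x. \<integral>\<^sup>+y. h (basis_sum (x(b := y))) \<partial>lborel \<partial>?L I)"
  proof (rule nn_integral_cong)
    fix x
    have "(\<lambda>y. h (basis_sum (x(b := y)))) \<in> borel_measurable borel"
      by (subst upd) measurable
    then show "(\<integral>\<^sup>+y. h (T (basis_sum (x(b := y)))) \<partial>lborel) = (\<integral>\<^sup>+y. h (basis_sum (x(b := y))) \<partial>lborel)"
      using nn_integral_real_affine[of "\<lambda>y. h (basis_sum (x(b := y)))" 1 "x b'"] by (simp add: T_upd add.commute)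
  qed
  also have "\<dots> = (\<integral>\<^sup>+x. h (basis_sum x) \<partial>?L (insert b I))"
    by (rule L.product_nn_integral_insert[OF I(1,2), symmetric]) (simp only: I, measurable)
  also have "\<dots> = (\<integral>\<^sup>+x. h x \<partial>lborel)"
    unfolding I(3) by (rule nn_integral_lborel_basis_sum[symmetric]) measurable
  finally show ?thesis by (simp add: T)
qed

text \<open>The library version requires an ordered index type.\<close>
lemma nn_integral_lborel_linear:
  fixes f :: "real^'n \<Rightarrow> real^'n" and h :: "real^'n \<Rightarrow> ennreal"
  assumes "linear f" "det (matrix f) \<noteq> 0" "h \<in> borel_measurable borel"
  shows "(\<integral>\<^sup>+x. h (f x) \<partial>lborel) * ennreal \<bar>det (matrix f)\<bar> = (\<integral>\<^sup>+x. h x \<partial>lborel)"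
proof -
  have "det (matrix f) \<noteq> 0 \<longrightarrow> (\<forall>h\<in>borel_measurable borel.
    (\<integral>\<^sup>+x. h (f x) \<partial>lborel) * ennreal \<bar>det (matrix f)\<bar> = (\<integral>\<^sup>+x. h x \<partial>lborel))"
  proof (rule induct_linear_elementary[OF \<open>linear f\<close>]; intro impI ballI)
    fix f g :: "real^'n \<Rightarrow> real^'n" and h :: "real^'n \<Rightarrow> ennreal"
    assume lin: "linear f" "linear g" and h[measurable]: "h \<in> borel_measurable borel"
      and f: "det (matrix f) \<noteq> 0 \<longrightarrow> (\<forall>h\<in>borel_measurable borel.
        (\<integral>\<^sup>+x. h (f x) \<partial>lborel) * ennreal \<bar>det (matrix f)\<bar> = (\<integral>\<^sup>+x. h x \<partial>lborel))"
      and g: "det (matrix g) \<noteq> 0 \<longrightarrow> (\<forall>h\<in>borel_measurable borel.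
        (\<integral>\<^sup>+x. h (g x) \<partial>lborel) * ennreal \<bar>det (matrix g)\<bar> = (\<integral>\<^sup>+x. h x \<partial>lborel))"
      and "det (matrix (f \<circ> g)) \<noteq> 0"
    then have d: "det (matrix (f \<circ> g)) = det (matrix f) * det (matrix g)" "det (matrix f) \<noteq> 0" "det (matrix g) \<noteq> 0"
      by (auto simp: matrix_compose det_mul)
    have [measurable]: "f \<in> borel_measurable borel"
      by (intro borel_measurable_continuous_onI linear_continuous_on linear_conv_bounded_linear[THEN iffD1] lin)
    have "(\<integral>\<^sup>+x. h ((f \<circ> g) x) \<partial>lborel) * ennreal \<bar>det (matrix (f \<circ> g))\<bar>
      = (\<integral>\<^sup>+x. (h \<circ> f) (g x) \<partial>lborel) * ennreal \<bar>det (matrix g)\<bar> * ennreal \<bar>det (matrix f)\<bar>"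
      by (simp add: d abs_mult ennreal_mult mult_ac)
    also have "(\<integral>\<^sup>+x. (h \<circ> f) (g x) \<partial>lborel) * ennreal \<bar>det (matrix g)\<bar> = (\<integral>\<^sup>+x. (h \<circ> f) x \<partial>lborel)"
      by (rule bspec[OF mp[OF g d(3)]]) (unfold o_def, measurable)
    also have "(\<integral>\<^sup>+x. (h \<circ> f) x \<partial>lborel) * ennreal \<bar>det (matrix f)\<bar> = (\<integral>\<^sup>+x. h x \<partial>lborel)"
      using f d h by (auto simp: o_def)
    finally show "(\<integral>\<^sup>+x. h ((f \<circ> g) x) \<partial>lborel) * ennreal \<bar>det (matrix (f \<circ> g))\<bar> = (\<integral>\<^sup>+x. h x \<partial>lborel)" .
  next
    fix f :: "real^'n \<Rightarrow> real^'n" and i and h :: "real^'n \<Rightarrow> ennreal"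
    assume "linear f" and 0: "\<And>x. f x $ i = 0" and d: "det (matrix f) \<noteq> 0"
    then have "surj f" using det_nz_iff_inj linear_injective_imp_surjective by blast
    then obtain x where "f x = axis i 1" by (metis surjD)
    then have False using 0[of x] by (simp add: axis_def)
    then show "(\<integral>\<^sup>+x. h (f x) \<partial>lborel) * ennreal \<bar>det (matrix f)\<bar> = (\<integral>\<^sup>+x. h x \<partial>lborel)" ..
  next
    fix c and h :: "real^'n \<Rightarrow> ennreal"
    assume d: "det (matrix (\<lambda>x. \<chi> i. c i * x $ i :: real^'n)) \<noteq> 0" and h: "h \<in> borel_measurable borel"
    have e: "det (matrix (\<lambda>x. \<chi> i. c i * x $ i :: real^'n)) = (\<Prod>i\<in>UNIV. c i)"
      by (simp add: axis_def matrix_def det_diagonal)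
    show "(\<integral>\<^sup>+x. h (\<chi> i. c i * x $ i) \<partial>lborel) * ennreal \<bar>det (matrix (\<lambda>x. \<chi> i. c i * x $ i :: real^'n))\<bar> = (\<integral>\<^sup>+x. h x \<partial>lborel)"
      unfolding e using d h unfolding e by (intro nn_integral_lborel_stretch) auto
  next
    fix m n :: 'n and h :: "real^'n \<Rightarrow> ennreal"
    assume "m \<noteq> n" and h: "h \<in> borel_measurable borel"
    let ?h = "\<lambda>v::real^'n. \<chi> i. v $ Transposition.transpose m n i"
    have "(\<chi> i j. if Transposition.transpose m n i = j then 1 else 0) = (\<chi> i j. if j = Transposition.transpose m n i then 1 else (0::real))"
      by (auto intro!: Cart_lambda_cong)
    then have "matrix ?h = transpose (\<chi> i j. mat 1 $ i $ Transposition.transpose m n j)"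
      by (auto simp: matrix_eq transpose_def axis_def mat_def matrix_def)
    then have "\<bar>det (matrix ?h)\<bar> = 1"
      by (simp add: det_permute_columns permutes_swap_id sign_swap_id abs_mult)
    then show "(\<integral>\<^sup>+x. h (?h x) \<partial>lborel) * ennreal \<bar>det (matrix ?h)\<bar> = (\<integral>\<^sup>+x. h x \<partial>lborel)"
      using nn_integral_lborel_swap[OF h] by simp
  next
    fix m n :: 'n and h :: "real^'n \<Rightarrow> ennreal"
    assume mn: "m \<noteq> n" and h: "h \<in> borel_measurable borel"
    let ?h = "\<lambda>v::real^'n. \<chi> i. if i = m then v $ m + v $ n else v $ i"
    have "matrix ?h = (\<chi> k. if k = m then row m (mat 1) + 1 *s row n (mat 1) else row k (mat 1))"
      using mn by (auto simp: matrix_def axis_def mat_def row_def vec_eq_iff)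
    then have "det (matrix ?h) = 1"
      by (simp only: det_row_operation[OF mn] det_I)
    then show "(\<integral>\<^sup>+x. h (?h x) \<partial>lborel) * ennreal \<bar>det (matrix ?h)\<bar> = (\<integral>\<^sup>+x. h x \<partial>lborel)"
      using nn_integral_lborel_shear[OF h mn] by simp
  qed
  then show ?thesis using assms by auto
qed

section \<open>Positive definite matrices and the spectral norm\<close>

lemma invertible_matrix_inv:
  fixes A :: "real^'n^'n"
  assumes "invertible A"
  shows "A ** matrix_inv A = mat 1" "matrix_inv A ** A = mat 1"
  using someI_ex[OF assms[unfolded invertible_def]] by (auto simp: matrix_inv_def)

lemma matrix_inv_unique:
  fixes A :: "real^'n^'n"
  assumes "A ** B = mat 1"
  shows "matrix_inv A = B"
proof -
  have "invertible A" using assms by (auto simp: invertible_right_inverse)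
  then have "matrix_inv A ** (A ** B) = B"
    by (simp add: matrix_mul_assoc invertible_matrix_inv)
  then show ?thesis by (simp add: assms)
qed

lemma inner_transpose_matrix: "x \<bullet> (transpose A *v y) = (A *v x) \<bullet> (y :: real^'n)"
  for A :: "real^'m^'n"
  by (metis dot_lmul_matrix inner_commute vector_transpose_matrix transpose_transpose)

context
  fixes A :: "real^'n^'n"
  assumes A: "positive_definite A"
begin

lemma positive_definite_symmetric: "x \<bullet> (A *v y) = (A *v x) \<bullet> y"
proof -
  have t: "transpose A = A" using A by (simp add: positive_definite_def)
  show ?thesis by (rule inner_transpose_matrix[of x A y, unfolded t])
qed

lemma positive_definite_nonneg: "0 \<le> x \<bullet> (A *v x)"
  using A by (cases "x = 0") (auto simp: positive_definite_def less_imp_le)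

lemma positive_definite_invertible: "invertible A"
proof -
  have "x = 0" if "A *v x = 0" for x
    using A that by (force simp: positive_definite_def)
  then show ?thesis
    by (simp add: invertible_left_inverse matrix_left_invertible_ker)
qed

lemma positive_definite_inv_mult[simp]:
  "A *v (matrix_inv A *v x) = x" "matrix_inv A *v (A *v x) = x"
  by (simp_all add: matrix_vector_mul_assoc invertible_matrix_inv[OF positive_definite_invertible])

lemma positive_definite_matrix_inv: "positive_definite (matrix_inv A)"
  unfolding positive_definite_def
proof (intro conjI allI impI)
  have "transpose (matrix_inv A) ** transpose A = mat 1"
    by (simp add: matrix_transpose_mul[symmetric] invertible_matrix_inv[OF positive_definite_invertible])
  then have "transpose (matrix_inv A) ** A = mat 1" using A by (simp add: positive_definite_def)
  then have "transpose (matrix_inv A) ** (A ** matrix_inv A) = matrix_inv A"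
    by (simp add: matrix_mul_assoc)
  then show "transpose (matrix_inv A) = matrix_inv A"
    by (simp add: invertible_matrix_inv[OF positive_definite_invertible])
  fix v :: "real^'n" assume "v \<noteq> 0"
  define w where "w = matrix_inv A *v v"
  have v: "v = A *v w" by (simp add: w_def)
  then have "w \<noteq> 0" using \<open>v \<noteq> 0\<close> by auto
  then have "0 < w \<bullet> (A *v w)" using A by (simp add: positive_definite_def)
  then show "0 < v \<bullet> (matrix_inv A *v v)" unfolding w_def[symmetric] by (simp add: v inner_commute)
qed

lemma matrix_inv_matrix_inv: "matrix_inv (matrix_inv A) = A"
  by (rule matrix_inv_unique) (rule invertible_matrix_inv[OF positive_definite_invertible])

text \<open>Expand the nonnegative form of \<open>A\<close> at w minus the inverse of
  \<open>A\<close> applied to v.\<close>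

lemma young_positive_definite: "2 * (w \<bullet> v) \<le> w \<bullet> (A *v w) + v \<bullet> (matrix_inv A *v v)"
proof -
  define z where "z = matrix_inv A *v v"
  have v: "v = A *v z" by (simp add: z_def)
  have "0 \<le> (w - z) \<bullet> (A *v (w - z))" by (rule positive_definite_nonneg)
  also have "\<dots> = w \<bullet> (A *v w) + z \<bullet> (A *v z) - w \<bullet> (A *v z) - z \<bullet> (A *v w)"
    by (simp add: matrix_vector_mult_diff_distrib inner_diff_left inner_diff_right)
  also have "z \<bullet> (A *v w) = w \<bullet> (A *v z)"
    using positive_definite_symmetric[of z w] by (simp only: inner_commute)
  finally show ?thesis unfolding z_def[symmetric] by (simp add: v inner_commute)
qed

end

lemma norm_matrix_vector_le: "norm (A *v x) \<le> spectral_norm A * norm x" for A :: "real^'n^'n"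
  unfolding spectral_norm_def by (rule onorm[OF matrix_vector_mul_bounded_linear])

lemma spectral_norm_nonneg: "0 \<le> spectral_norm A" for A :: "real^'n^'n"
  unfolding spectral_norm_def by (rule onorm_pos_le[OF matrix_vector_mul_bounded_linear])

lemma spectral_norm_pos:
  fixes A :: "real^'n^'n"
  assumes "invertible A" shows "0 < spectral_norm A"
proof -
  obtain x :: "real^'n" where x: "x \<noteq> 0" by (metis axis_eq_0_iff one_neq_zero)
  have "A *v x \<noteq> 0"
  proof
    assume "A *v x = 0"
    then have "matrix_inv A *v (A *v x) = 0" by simp
    then show False using x by (simp add: matrix_vector_mul_assoc invertible_matrix_inv[OF assms])
  qed
  then have "0 < norm (A *v x)" by simp
  also have "\<dots> \<le> spectral_norm A * norm x" by (rule norm_matrix_vector_le)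
  finally show ?thesis using spectral_norm_nonneg[of A] by (cases "spectral_norm A = 0") auto
qed

lemma inner_matrix_vector_le: "w \<bullet> (A *v w) \<le> spectral_norm A * (norm w)\<^sup>2" for A :: "real^'n^'n"
proof -
  have "w \<bullet> (A *v w) \<le> norm w * norm (A *v w)" by (rule norm_cauchy_schwarz)
  also have "\<dots> \<le> norm w * (spectral_norm A * norm w)" by (intro mult_left_mono norm_matrix_vector_le) auto
  finally show ?thesis by (simp add: power2_eq_square mult_ac)
qed

lemma norm_transpose_vector_le: "norm (transpose A *v x) \<le> spectral_norm A * norm x" for A :: "real^'n^'n"
proof (cases "transpose A *v x = 0")
  case True
  then show ?thesis using spectral_norm_nonneg[of A] by simp
next
  case False
  let ?z = "transpose A *v x"
  have "norm ?z * norm ?z = ?z \<bullet> ?z" by (simp add: power2_norm_eq_inner[symmetric] power2_eq_square)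
  also have "\<dots> = (A *v ?z) \<bullet> x" by (rule inner_transpose_matrix)
  also have "\<dots> \<le> norm (A *v ?z) * norm x" by (rule norm_cauchy_schwarz)
  also have "\<dots> \<le> (spectral_norm A * norm ?z) * norm x" by (intro mult_right_mono norm_matrix_vector_le) auto
  finally have "norm ?z * norm ?z \<le> norm ?z * (spectral_norm A * norm x)" by (simp add: mult_ac)
  then show ?thesis using False by simp
qed

text \<open>Optimising over the multiples \<open>w = s v\<close> in Young's inequality.\<close>
lemma norm_le_of_young:
  fixes P :: "real^'n^'n"
  assumes P: "0 < spectral_norm P" and young: "\<And>w. 2 * (w \<bullet> v) \<le> w \<bullet> (P *v w) + Q"
  shows "(norm v)\<^sup>2 / spectral_norm P \<le> Q"
proof -
  define s where "s = 1 / spectral_norm P"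
  have s: "0 < s" "spectral_norm P * s = 1" using P by (auto simp: s_def)
  have "2 * (s * (norm v)\<^sup>2) = 2 * ((s *\<^sub>R v) \<bullet> v)" by (simp add: power2_norm_eq_inner)
  also have "\<dots> \<le> (s *\<^sub>R v) \<bullet> (P *v (s *\<^sub>R v)) + Q" by (rule young)
  also have "\<dots> \<le> spectral_norm P * (norm (s *\<^sub>R v))\<^sup>2 + Q" by (intro add_right_mono inner_matrix_vector_le)
  also have "spectral_norm P * (norm (s *\<^sub>R v))\<^sup>2 = s * (norm v)\<^sup>2"
    using s by (simp add: power_mult_distrib power2_eq_square)
  finally show ?thesis by (simp add: s_def)
qed

text \<open>This turns lower bounds by inverse matrices into scalar convexity constants and is how
  spectral norms enter the rates.\<close>

lemma inner_matrix_inv_ge: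
  fixes A :: "real^'n^'n"
  assumes A: "positive_definite A"
  shows "(norm v)\<^sup>2 / spectral_norm A \<le> v \<bullet> (matrix_inv A *v v)"
  by (intro norm_le_of_young spectral_norm_pos positive_definite_invertible[OF A] young_positive_definite[OF A])

text \<open>Gram-Schmidt for the inner product defined by \<open>A\<close>. The images of the
  vectors chosen so far are fewer than the dimension, so some nonzero vector is orthogonal to all of
  them; it is then normalised.\<close>

lemma conjugate_orthonormal_basis:
  fixes A :: "real^'n^'n" and S :: "'n set"
  assumes A: "positive_definite A" and "finite S"
  shows "\<exists>b. \<forall>i\<in>S. \<forall>j\<in>S. b i \<bullet> (A *v b j) = (if i = j then 1 else 0)"
  using \<open>finite S\<close>
proof induction
  case (insert k S)
  then obtain b where b: "\<And>i j. i \<in> S \<Longrightarrow> j \<in> S \<Longrightarrow> b i \<bullet> (A *v b j) = (if i = j then 1 else 0)" by auto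
  have "dim ((\<lambda>i. A *v b i) ` S) \<le> card ((\<lambda>i. A *v b i) ` S)" using insert by (intro dim_le_card') auto
  also have "\<dots> \<le> card S" using insert by (intro card_image_le)
  also have "\<dots> < card (insert k S)" using insert by simp
  also have "\<dots> \<le> DIM(real^'n)" by (simp add: card_mono)
  finally obtain x where x: "x \<noteq> 0" "\<And>y. y \<in> span ((\<lambda>i. A *v b i) ` S) \<Longrightarrow> orthogonal x y"
    by (rule orthogonal_to_subspace_exists) blast
  have xb: "x \<bullet> (A *v b i) = 0" if "i \<in> S" for i
    using x(2)[of "A *v b i"] that by (auto simp: orthogonal_def span_base)
  have bx: "b i \<bullet> (A *v x) = 0" if "i \<in> S" for i
    using xb[OF that] positive_definite_symmetric[OF A, of "b i" x] by (simp add: inner_commute)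
  define r where "r = sqrt (x \<bullet> (A *v x))"
  have "0 < x \<bullet> (A *v x)" using A x(1) by (simp add: positive_definite_def)
  then have r: "0 < r" "x \<bullet> (A *v x) = r * r" by (auto simp: r_def)
  have "\<forall>i\<in>insert k S. \<forall>j\<in>insert k S. (b(k := (1 / r) *\<^sub>R x)) i \<bullet> (A *v (b(k := (1 / r) *\<^sub>R x)) j) = (if i = j then 1 else 0)"
    using insert.hyps b xb bx r by (auto simp: scaleR_matrix_vector_assoc[symmetric] matrix_vector_mult_scaleR)
  then show ?case by blast
qed simp

text \<open>The vectors of \<open>conjugate_orthonormal_basis\<close> are the columns of
  \<open>C\<close>, which serves as a square root of the inverse of \<open>A\<close>.\<close>

lemma conjugate_to_identity:
  fixes A :: "real^'n^'n"
  assumes A: "positive_definite A"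
  obtains C :: "real^'n^'n" where "transpose C ** A ** C = mat 1"
proof -
  obtain b :: "'n \<Rightarrow> real^'n" where b: "\<And>i j. b i \<bullet> (A *v b j) = (if i = j then 1 else 0)"
    using conjugate_orthonormal_basis[OF A, of UNIV] by auto
  define C :: "real^'n^'n" where "C = (\<chi> i j. b j $ i)"
  have C: "C *v axis j 1 = b j" for j
    by (simp add: C_def vec_eq_iff matrix_vector_mult_def axis_def if_distrib cong: if_cong)
  have "(transpose C ** A ** C) $ i $ j = mat 1 $ i $ j" for i j
  proof -
    have "(transpose C ** A ** C) $ i $ j = axis i 1 \<bullet> ((transpose C ** A ** C) *v axis j 1)"
      by (simp add: inner_axis' matrix_vector_mult_basis column_def)
    also have "\<dots> = axis i 1 \<bullet> (transpose C *v (A *v (C *v axis j 1)))"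
      by (simp add: matrix_vector_mul_assoc matrix_mul_assoc)
    also have "\<dots> = b i \<bullet> (A *v b j)" by (simp only: inner_transpose_matrix C)
    finally show ?thesis by (simp add: b mat_def)
  qed
  then show thesis by (intro that[of C]) (simp add: vec_eq_iff)
qed

section \<open>Gaussian integrals\<close>

lemma nn_integral_standard_gaussian:
  "(\<integral>\<^sup>+x. ennreal (exp (- (1/2) * (x \<bullet> x))) \<partial>(lborel :: 'a::euclidean_space measure)) = ennreal (sqrt (2 * pi) ^ DIM('a))"
proof -
  have one: "(\<integral>\<^sup>+x. ennreal (exp (- x\<^sup>2 / 2)) \<partial>lborel) = ennreal (sqrt (2 * pi))"
  proof -
    interpret prob_space "density lborel (\<lambda>x. ennreal (std_normal_density x))"
      by (rule prob_space_normal_density) simp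
    have "(\<integral>\<^sup>+x. ennreal (exp (- x\<^sup>2 / 2)) \<partial>lborel) = (\<integral>\<^sup>+x. ennreal (sqrt (2 * pi)) * ennreal (std_normal_density x) \<partial>lborel)"
      by (intro nn_integral_cong) (simp add: std_normal_density_def ennreal_mult[symmetric])
    also have "\<dots> = ennreal (sqrt (2 * pi))"
      using emeasure_space_1 by (simp add: nn_integral_cmult emeasure_density)
    finally show ?thesis .
  qed
  have "ennreal (exp (- (1/2) * (x \<bullet> x))) = (\<Prod>b\<in>Basis. ennreal (exp (- (x \<bullet> b)\<^sup>2 / 2)))" for x :: 'a
  proof -
    have "- (1/2) * (x \<bullet> x) = (\<Sum>b\<in>Basis. - (x \<bullet> b)\<^sup>2 / 2)"
      by (subst euclidean_inner) (simp add: sum_negf sum_divide_distrib[symmetric] power2_eq_square)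
    then show ?thesis by (simp add: exp_sum prod_ennreal)
  qed
  then have "(\<integral>\<^sup>+x. ennreal (exp (- (1/2) * (x \<bullet> x))) \<partial>(lborel::'a measure)) = (\<integral>\<^sup>+x. (\<Prod>b\<in>Basis. ennreal (exp (- (x \<bullet> b)\<^sup>2 / 2))) \<partial>(lborel::'a measure))" by simp
  also have "\<dots> = (\<Prod>b\<in>(Basis::'a set). ennreal (sqrt (2 * pi)))"
    by (subst nn_integral_lborel_prod[where f="\<lambda>_ x. ennreal (exp (- x\<^sup>2 / 2))"]) (simp_all only: one, measurable)
  finally show ?thesis by (simp add: ennreal_power)
qed

lemma measurable_matrix_vector[measurable]:
  "f \<in> borel_measurable M \<Longrightarrow> (\<lambda>x. (A :: real^'n^'m) *v f x) \<in> borel_measurable M"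
  by (rule measurable_compose[where N=borel])
    (auto intro!: borel_measurable_continuous_onI linear_continuous_on matrix_vector_mul_bounded_linear)

text \<open>Substituting z = C w, where \<open>C\<close> conjugates the inverse of \<tau> to the
  identity, reduces to the standard Gaussian. The same relation gives det \<tau> = (det C)^2, which
  is positive and identifies the Jacobian with the normalising constant.\<close>

lemma
  fixes \<tau> :: "real^'n^'n"
  assumes \<tau>: "positive_definite \<tau>"
  shows gauss_density_pos: "0 < gauss_density \<tau> z"
    and nn_integral_gauss_density: "(\<integral>\<^sup>+y. ennreal (gauss_density \<tau> (y - m)) \<partial>lborel) = 1"
    and det_positive_definite: "0 < det \<tau>"
proof -
  define A where "A = matrix_inv \<tau>"
  have A: "positive_definite A" unfolding A_def by (rule positive_definite_matrix_inv[OF \<tau>])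
  obtain C :: "real^'n^'n" where C: "transpose C ** A ** C = mat 1" by (rule conjugate_to_identity[OF A])
  have "det (transpose C ** A ** C) = 1" by (simp add: C)
  then have dC: "det C * det A * det C = 1" by (simp add: det_mul)
  have "det (A ** \<tau>) = 1"
    unfolding A_def by (simp add: invertible_matrix_inv[OF positive_definite_invertible[OF \<tau>]])
  then have dA: "det A * det \<tau> = 1" by (simp add: det_mul)
  have d: "det \<tau> = (det C)\<^sup>2"
    using dC dA by (metis (no_types, opaque_lifting) mult.assoc mult.commute mult.right_neutral power2_eq_square)
  have C0: "det C \<noteq> 0" using dC by auto
  then show det: "0 < det \<tau>" by (simp add: d)
  define c where "c = sqrt ((2 * pi) ^ CARD('n) * det \<tau>)"
  have c: "0 < c" unfolding c_def using det by simp
  have gd: "gauss_density \<tau> z = exp (- (1/2) * (z \<bullet> (A *v z))) / c" for z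
    unfolding gauss_density_def A_def c_def ..
  then show "0 < gauss_density \<tau> z" using c by simp
  define h where "h = (\<lambda>z. ennreal (exp (- (1/2) * (z \<bullet> (A *v z)))))"
  have [measurable]: "h \<in> borel_measurable borel" unfolding h_def by measurable
  have "h (C *v w) = ennreal (exp (- (1/2) * (w \<bullet> w)))" for w
  proof -
    have "(C *v w) \<bullet> (A *v (C *v w)) = w \<bullet> ((transpose C ** A ** C) *v w)"
      by (simp add: inner_transpose_matrix[symmetric] matrix_vector_mul_assoc matrix_mul_assoc)
    then show ?thesis by (simp add: h_def C)
  qed
  then have "(\<integral>\<^sup>+z. h z \<partial>lborel) = ennreal (sqrt (2 * pi) ^ CARD('n)) * ennreal \<bar>det C\<bar>"
    using nn_integral_lborel_linear[of "(*v) C" h] C0 nn_integral_standard_gaussian[where 'a="real^'n"] by simp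
  also have "\<dots> = ennreal c"
  proof -
    have "c = sqrt (2 * pi) ^ CARD('n) * \<bar>det C\<bar>"
      unfolding c_def d real_sqrt_mult[of "(2 * pi) ^ CARD('n)"] real_sqrt_power[of "2 * pi"] real_sqrt_abs ..
    then show ?thesis by (simp only: ennreal_mult[symmetric] abs_ge_zero zero_le_power real_sqrt_ge_zero pi_ge_zero zero_le_mult_iff zero_le_numeral simp_thms)
  qed
  finally have h: "(\<integral>\<^sup>+z. h z \<partial>lborel) = ennreal c" .
  have "(\<integral>\<^sup>+y. ennreal (gauss_density \<tau> (y - m)) \<partial>lborel) = (\<integral>\<^sup>+y. ennreal (1 / c) * h (y - m) \<partial>lborel)"
    using c by (intro nn_integral_cong) (simp add: gd h_def ennreal_mult[symmetric])
  also have "\<dots> = ennreal (1 / c) * (\<integral>\<^sup>+y. h (y - m) \<partial>lborel)"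
    by (rule nn_integral_cmult) measurable
  also have "(\<integral>\<^sup>+y. h (y - m) \<partial>lborel) = (\<integral>\<^sup>+y. h (y - m) \<partial>distr lborel borel ((+) m))"
    by (simp add: lborel_distr_plus)
  also have "\<dots> = (\<integral>\<^sup>+y. h y \<partial>lborel)"
    by (subst nn_integral_distr) auto
  finally show "(\<integral>\<^sup>+y. ennreal (gauss_density \<tau> (y - m)) \<partial>lborel) = 1"
    using c by (simp add: h ennreal_mult[symmetric])
qed

section \<open>Rules for strong convexity\<close>

lemma strongly_convex_mono:
  assumes "strongly_convex q V" and "\<And>v. q' v \<le> q v"
  shows "strongly_convex q' V"
  unfolding strongly_convex_def
proof (intro allI impI)
  fix x y and t :: real assume t: "0 < t" "t < 1"
  have "t * (1 - t) / 2 * q' (x - y) \<le> t * (1 - t) / 2 * q (x - y)"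
    using t assms(2) by (intro mult_left_mono) auto
  moreover have "V ((1 - t) *\<^sub>R x + t *\<^sub>R y) \<le> (1 - t) * V x + t * V y - t * (1 - t) / 2 * q (x - y)"
    using assms(1) t by (simp add: strongly_convex_def)
  ultimately show "V ((1 - t) *\<^sub>R x + t *\<^sub>R y) \<le> (1 - t) * V x + t * V y - t * (1 - t) / 2 * q' (x - y)" by linarith
qed

lemma strongly_convex_add:
  assumes "strongly_convex q V" "strongly_convex q' V'"
  shows "strongly_convex (\<lambda>v. q v + q' v) (\<lambda>x. V x + V' x)"
  unfolding strongly_convex_def
proof (intro allI impI)
  fix x y and t :: real assume t: "0 < t" "t < 1"
  have "V ((1 - t) *\<^sub>R x + t *\<^sub>R y) \<le> (1 - t) * V x + t * V y - t * (1 - t) / 2 * q (x - y)"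
    "V' ((1 - t) *\<^sub>R x + t *\<^sub>R y) \<le> (1 - t) * V' x + t * V' y - t * (1 - t) / 2 * q' (x - y)"
    using assms t by (auto simp: strongly_convex_def)
  then show "V ((1 - t) *\<^sub>R x + t *\<^sub>R y) + V' ((1 - t) *\<^sub>R x + t *\<^sub>R y)
      \<le> (1 - t) * (V x + V' x) + t * (V y + V' y) - t * (1 - t) / 2 * (q (x - y) + q' (x - y))"
    unfolding distrib_left by linarith
qed

lemma strongly_convex_linear_comp:
  assumes "strongly_convex q V" "linear L"
  shows "strongly_convex (\<lambda>v. q (L v)) (\<lambda>x. V (L x))"
  using assms unfolding strongly_convex_def
  by (simp add: linear_add linear_scale linear_diff)

text \<open>For a quadratic form the defining inequality is an identity, obtained by
  expanding.\<close>

lemma strongly_convex_quadratic: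
  fixes A :: "real^'n^'n"
  shows "strongly_convex (\<lambda>v. v \<bullet> (A *v v)) (\<lambda>x. 1/2 * ((x - m) \<bullet> (A *v (x - m))) + r)"
  unfolding strongly_convex_def
proof (intro allI impI)
  fix x y :: "real^'n" and t :: real
  define a b where "a = x - m" and "b = y - m"
  have e: "(1 - t) *\<^sub>R x + t *\<^sub>R y - m = (1 - t) *\<^sub>R a + t *\<^sub>R b" "x - y = a - b"
    by (simp_all add: a_def b_def algebra_simps)
  show "1/2 * (((1 - t) *\<^sub>R x + t *\<^sub>R y - m) \<bullet> (A *v ((1 - t) *\<^sub>R x + t *\<^sub>R y - m))) + r
    \<le> (1 - t) * (1/2 * ((x - m) \<bullet> (A *v (x - m))) + r) + t * (1/2 * ((y - m) \<bullet> (A *v (y - m))) + r)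
      - t * (1 - t) / 2 * ((x - y) \<bullet> (A *v (x - y)))"
    unfolding e a_def[symmetric] b_def[symmetric]
    by (simp add: matrix_vector_right_distrib matrix_vector_mult_diff_distrib matrix_vector_mult_scaleR
        inner_add_left inner_add_right inner_diff_left inner_diff_right field_simps)
qed

lemma derivative_along_line:
  fixes f :: "real^'n \<Rightarrow> real"
  assumes "\<And>x. f differentiable (at x)"
  shows "((\<lambda>s. f (x + s *\<^sub>R v)) has_real_derivative (\<Sum>i\<in>UNIV. v $ i * partial_deriv i f (x + s *\<^sub>R v))) (at s)"
proof -
  define D where "D = frechet_derivative f (at (x + s *\<^sub>R v))"
  have D: "(f has_derivative D) (at (x + s *\<^sub>R v))"
    unfolding D_def using assms by (simp add: frechet_derivative_works)
  have lin: "linear D" using D by (rule has_derivative_linear)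
  have pd: "D (axis i 1) = partial_deriv i f (x + s *\<^sub>R v)" for i
    by (simp add: partial_deriv_def D_def)
  have "D v = D (\<Sum>i\<in>UNIV. v $ i *\<^sub>R axis i 1)"
    using basis_expansion[of v] by (simp add: scalar_mult_eq_scaleR)
  also have "\<dots> = (\<Sum>i\<in>UNIV. v $ i * partial_deriv i f (x + s *\<^sub>R v))"
    by (simp add: linear_sum[OF lin] linear_scale[OF lin] pd)
  finally have Dv: "D v = (\<Sum>i\<in>UNIV. v $ i * partial_deriv i f (x + s *\<^sub>R v))" .
  have "((\<lambda>s. x + s *\<^sub>R v) has_derivative (\<lambda>h. h *\<^sub>R v)) (at s)"
    by (auto intro!: derivative_eq_intros)
  from has_derivative_compose[OF this D]
  have "((\<lambda>s. f (x + s *\<^sub>R v)) has_derivative (\<lambda>h. D (h *\<^sub>R v))) (at s)" .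
  moreover have "(\<lambda>h. D (h *\<^sub>R v)) = (*) (D v)" by (simp add: linear_scale[OF lin] fun_eq_iff)
  ultimately show ?thesis
    unfolding has_field_derivative_def Dv[symmetric] by simp
qed

text \<open>Along the segment from x to y, subtracting half of the quadratic lower bound from
  \<open>U\<close> leaves a function \<open>G\<close> of one variable with nonnegative second
  derivative, hence a convex one.\<close>

lemma strongly_convex_hessian:
  fixes U :: "real^'n \<Rightarrow> real"
  assumes U: "smooth U" and H: "\<And>x. loewner_le H (hessian U x)"
  shows "strongly_convex (\<lambda>v. v \<bullet> (H *v v)) U"
  unfolding strongly_convex_def
proof (intro allI impI)
  fix x y :: "real^'n" and t :: real assume t: "0 < t" "t < 1"
  define v where "v = y - x"
  define q where "q = v \<bullet> (H *v v)"
  have "Ck (Suc (Suc 0)) U" using U unfolding smooth_def by blast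
  then have d1: "\<And>x. U differentiable (at x)" and d2: "\<And>i x. partial_deriv i U differentiable (at x)" by auto
  define g1 where "g1 = (\<lambda>s. \<Sum>i\<in>UNIV. v $ i * partial_deriv i U (x + s *\<^sub>R v))"
  define g2 where "g2 = (\<lambda>s. \<Sum>i\<in>UNIV. v $ i * (\<Sum>j\<in>UNIV. v $ j * partial_deriv j (partial_deriv i U) (x + s *\<^sub>R v)))"
  define G where "G = (\<lambda>s. U (x + s *\<^sub>R v) - s\<^sup>2 / 2 * q)"
  have g2: "g2 s = v \<bullet> (hessian U (x + s *\<^sub>R v) *v v)" for s
    unfolding g2_def inner_vec_def matrix_vector_mult_def hessian_def
    by (simp add: sum_distrib_left mult_ac) (subst sum.swap, intro sum.cong refl, simp)
  have "convex_on UNIV G"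
  proof (rule f''_ge0_imp_convex)
    fix s :: real
    show "DERIV G s :> (g1 s - s * q)"
      unfolding G_def g1_def by (auto intro!: derivative_eq_intros derivative_along_line d1)
    show "DERIV (\<lambda>s. g1 s - s * q) s :> (g2 s - q)"
    proof -
      have "(g1 has_real_derivative g2 s) (at s)"
        unfolding g1_def g2_def by (intro DERIV_sum DERIV_cmult derivative_along_line d2)
      then show ?thesis by (auto intro!: derivative_eq_intros)
    qed
    show "0 \<le> g2 s - q" using H[of "x + s *\<^sub>R v"] by (simp add: g2 q_def loewner_le_def)
  qed simp
  then have "G ((1 - t) *\<^sub>R 0 + t *\<^sub>R 1) \<le> (1 - t) * G 0 + t * G 1"
    using t by (intro convex_onD) auto
  then have G: "U (x + t *\<^sub>R v) - t\<^sup>2 / 2 * q \<le> (1 - t) * U x + t * (U y - q / 2)"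
    by (simp add: G_def v_def)
  have z: "(1 - t) *\<^sub>R x + t *\<^sub>R y = x + t *\<^sub>R v" by (simp add: v_def algebra_simps)
  have "x - y = - v" by (simp add: v_def)
  then have q: "(x - y) \<bullet> (H *v (x - y)) = q"
    using matrix_vector_mult_scaleR[of H "-1" v] by (simp add: q_def)
  show "U ((1 - t) *\<^sub>R x + t *\<^sub>R y) \<le> (1 - t) * U x + t * U y - t * (1 - t) / 2 * ((x - y) \<bullet> (H *v (x - y)))"
    unfolding z q using G by (simp add: field_simps power2_eq_square)
qed

section \<open>The Gibbs sampler\<close>

text \<open>Evaluates the joint laws in the form in which \<open>backward_transition\<close> states
  them.\<close>

lemma nn_integral_bind_return:
  assumes L[measurable]: "L \<in> measurable M (prob_algebra N)"
    and f[measurable]: "(\<lambda>(x, y). f x y) \<in> measurable (M \<Otimes>\<^sub>M N) R"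
    and F[measurable]: "F \<in> borel_measurable R"
  shows "(\<integral>\<^sup>+z. F z \<partial>(M \<bind> (\<lambda>x. L x \<bind> (\<lambda>y. return R (f x y))))) = (\<integral>\<^sup>+x. \<integral>\<^sup>+y. F (f x y) \<partial>L x \<partial>M)"
proof -
  have L2: "(\<lambda>x. L x \<bind> (\<lambda>y. return R (f x y))) \<in> measurable M (prob_algebra R)"
    by measurable
  have "(\<integral>\<^sup>+z. F z \<partial>(M \<bind> (\<lambda>x. L x \<bind> (\<lambda>y. return R (f x y)))))
      = (\<integral>\<^sup>+x. \<integral>\<^sup>+z. F z \<partial>(L x \<bind> (\<lambda>y. return R (f x y))) \<partial>M)"
    by (rule nn_integral_bind[OF F measurable_prob_algebraD[OF L2]])
  also have "\<dots> = (\<integral>\<^sup>+x. \<integral>\<^sup>+y. F (f x y) \<partial>L x \<partial>M)"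
  proof (rule nn_integral_cong)
    fix x assume x: "x \<in> space M"
    have sL: "sets (L x) = sets N" using measurable_space[OF L x] by (simp add: space_prob_algebra)
    have fx: "f x \<in> measurable N R" using measurable_Pair2[OF f x] by simp
    have "(\<lambda>y. return R (f x y)) \<in> measurable (L x) (subprob_algebra R)"
      using measurable_compose[OF fx return_measurable] by (simp cong: measurable_cong_sets add: sL)
    then have "(\<integral>\<^sup>+z. F z \<partial>(L x \<bind> (\<lambda>y. return R (f x y)))) = (\<integral>\<^sup>+y. \<integral>\<^sup>+z. F z \<partial>return R (f x y) \<partial>L x)"
      by (rule nn_integral_bind[OF F])
    also have "\<dots> = (\<integral>\<^sup>+y. F (f x y) \<partial>L x)"
      using measurable_space[OF fx] sets_eq_imp_space_eq[OF sL]
      by (intro nn_integral_cong nn_integral_return) auto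
    finally show "(\<integral>\<^sup>+z. F z \<partial>(L x \<bind> (\<lambda>y. return R (f x y)))) = (\<integral>\<^sup>+y. F (f x y) \<partial>L x)" .
  qed
  finally show ?thesis .
qed

lemma talagrand_transport_cost:
  fixes V g :: "'a::euclidean_space \<Rightarrow> real"
  assumes [measurable]: "V \<in> borel_measurable borel" "g \<in> borel_measurable borel"
    and g: "\<And>x. 0 \<le> g x" "(\<integral>\<^sup>+x. ennreal (g x) \<partial>lborel) = 1"
    and V: "(\<integral>\<^sup>+x. ennreal (exp (- V x)) \<partial>lborel) = 1"
    and r: "0 < r" and sc: "strongly_convex (\<lambda>v. (norm v)\<^sup>2 / r) V"
  shows "transport_cost (density lborel g) (density lborel (\<lambda>x. exp (- V x))) \<le> ennreal (2 * r) * kl g (\<lambda>x. exp (- V x))"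
proof -
  obtain \<gamma> where \<gamma>: "\<gamma> \<in> couplings (density lborel g) (density lborel (\<lambda>x. exp (- V x)))"
    and le: "(\<integral>\<^sup>+p. ennreal ((norm (snd p - fst p))\<^sup>2 / r) \<partial>\<gamma>) \<le> 2 * kl g (\<lambda>x. exp (- V x))"
    by (rule talagrand_coupling[of V "\<lambda>v. (norm v)\<^sup>2 / r" g]) (use g V r sc in auto)
  have [measurable_cong]: "sets \<gamma> = sets (borel \<Otimes>\<^sub>M borel)" using \<gamma> by (auto simp: couplings_def)
  have "transport_cost (density lborel g) (density lborel (\<lambda>x. exp (- V x))) \<le> (\<integral>\<^sup>+p. ennreal ((norm (fst p - snd p))\<^sup>2) \<partial>\<gamma>)"
    by (rule transport_cost_le[OF \<gamma>])
  also have "\<dots> = (\<integral>\<^sup>+p. ennreal r * ennreal ((norm (snd p - fst p))\<^sup>2 / r) \<partial>\<gamma>)"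
    using r by (intro nn_integral_cong) (simp add: ennreal_mult[symmetric] norm_minus_commute)
  also have "\<dots> = ennreal r * (\<integral>\<^sup>+p. ennreal ((norm (snd p - fst p))\<^sup>2 / r) \<partial>\<gamma>)"
    by (rule nn_integral_cmult) measurable
  also have "\<dots> \<le> ennreal r * (2 * kl g (\<lambda>x. exp (- V x)))" by (intro mult_left_mono le) auto
  also have "\<dots> = ennreal (2 * r) * kl g (\<lambda>x. exp (- V x))"
    using r by (simp add: ennreal_mult mult_ac)
  finally show ?thesis .
qed

section \<open>The forward and backward kernels as exponential families\<close>

locale gaussian_gibbs =
  fixes U :: "real^'d::finite \<Rightarrow> real" and \<alpha> :: "real^'d" and \<beta> \<tau> u :: "real^'d^'d"
  assumes tau: "positive_definite \<tau>" and beta: "invertible \<beta>" and U_smooth: "smooth U"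
    and U_prob: "prob_space (gibbs_measure U)" and u_pd: "positive_definite u"
    and hess: "\<And>x. loewner_le (matrix_inv u) (hessian U x)"
begin

abbreviation "T \<equiv> matrix_inv \<tau>"
abbreviation "\<mu> \<equiv> gibbs_measure U"

definition "\<kappa> = spectral_norm (T ** \<beta>)"
definition "\<rho>\<^sub>0 = spectral_norm \<tau>"
definition "\<rho>\<^sub>1 = spectral_norm (matrix_inv (matrix_inv u + transpose \<beta> ** T ** \<beta>))"
definition "\<rho>\<^sub>\<pi> = spectral_norm (\<tau> + \<beta> ** u ** transpose \<beta>)"
definition "\<rho>\<^sub>u = spectral_norm u"

definition "norm_const = sqrt ((2 * pi) ^ CARD('d) * det \<tau>)"

definition forward :: "real^'d \<Rightarrow> real^'d \<Rightarrow> real" where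
  "forward x y = gauss_density \<tau> (y - (\<alpha> + \<beta> *v x))"

lemma T_pd: "positive_definite T"
  by (rule positive_definite_matrix_inv[OF tau])

lemma T_sym: "x \<bullet> (T *v y) = y \<bullet> (T *v x)"
  using positive_definite_symmetric[OF T_pd, of x y] by (simp add: inner_commute)

lemma norm_const_pos: "0 < norm_const"
  using det_positive_definite[OF tau] by (simp add: norm_const_def)

lemma forward_eq: "forward x y = exp (- (1/2 * ((y - (\<alpha> + \<beta> *v x)) \<bullet> (T *v (y - (\<alpha> + \<beta> *v x)))) + ln norm_const))"
proof -
  have "forward x y = exp (- (1/2) * ((y - (\<alpha> + \<beta> *v x)) \<bullet> (T *v (y - (\<alpha> + \<beta> *v x))))) / norm_const"
    unfolding forward_def gauss_density_def norm_const_def ..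
  moreover have "exp (- (e + ln norm_const)) = exp (- e) / norm_const" for e
    using norm_const_pos exp_diff[of "- e" "ln norm_const"] by simp
  ultimately show ?thesis by (simp only: mult_minus_left)
qed

lemma forward_pos: "0 < forward x y" by (simp add: forward_eq)

text \<open>Boundedness makes the integral defining the intermediate density finite at every point,
  so the backward kernel can be normalised for each y rather than for almost every y.\<close>

lemma forward_le: "forward x y \<le> 1 / norm_const"
proof -
  have "forward x y \<le> exp (- ln norm_const)"
    unfolding forward_eq using positive_definite_nonneg[OF T_pd] by simp
  then show ?thesis using norm_const_pos by (simp add: exp_minus divide_inverse)
qed

lemma U_continuous: "continuous_on UNIV U"
  using U_smooth unfolding smooth_def by (metis Ck.simps(1))

lemma U_measurable[measurable]: "U \<in> borel_measurable borel"
  by (rule borel_measurable_continuous_onI[OF U_continuous])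

lemma U_convex: "strongly_convex (\<lambda>v. v \<bullet> (matrix_inv u *v v)) U"
  by (rule strongly_convex_hessian[OF U_smooth hess])

lemma int_U: "(\<integral>\<^sup>+x. ennreal (exp (- U x)) \<partial>lborel) = 1"
proof -
  interpret prob_space \<mu> by (rule U_prob)
  show ?thesis using emeasure_space_1 by (simp add: gibbs_measure_def emeasure_density)
qed

lemma sets_\<mu>[simp, measurable_cong]: "sets \<mu> = sets borel"
  by (simp add: gibbs_measure_def)

lemma kappa_pos: "0 < \<kappa>"
  unfolding \<kappa>_def
  by (intro spectral_norm_pos invertible_mult positive_definite_invertible[OF T_pd] beta)

lemma rho0_pos: "0 < \<rho>\<^sub>0" unfolding \<rho>\<^sub>0_def by (intro spectral_norm_pos positive_definite_invertible[OF tau])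

lemma rho_u_pos: "0 < \<rho>\<^sub>u" unfolding \<rho>\<^sub>u_def by (intro spectral_norm_pos positive_definite_invertible[OF u_pd])

text \<open>Expanding the square around y - \<alpha>, with \<beta> x as the shift: the mixed term
  with y is the interaction, and the terms in x alone, including the one with \<alpha>, are
  collected in \<open>\<Lambda>\<^sub>F\<close>.\<close>

definition "V\<^sub>F y = 1/2 * ((y - \<alpha>) \<bullet> (T *v (y - \<alpha>))) + ln norm_const"
definition "\<Lambda>\<^sub>F x = 1/2 * ((\<beta> *v x) \<bullet> (T *v (\<beta> *v x))) + \<alpha> \<bullet> (T *v (\<beta> *v x))"

lemma forward_k:
  "forward x y = exp (((T ** \<beta>) *v x) \<bullet> y - V\<^sub>F y - \<Lambda>\<^sub>F x)"
proof -
  define b where "b = \<beta> *v x"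
  have "((T ** \<beta>) *v x) \<bullet> y = y \<bullet> (T *v b)"
    by (simp add: b_def matrix_vector_mul_assoc inner_commute)
  moreover have "y - (\<alpha> + b) = (y - \<alpha>) - b" by simp
  moreover have "((y - \<alpha>) - b) \<bullet> (T *v ((y - \<alpha>) - b))
      = (y - \<alpha>) \<bullet> (T *v (y - \<alpha>)) - 2 * ((y - \<alpha>) \<bullet> (T *v b)) + b \<bullet> (T *v b)"
    using T_sym[of b "y - \<alpha>"]
    by (simp add: matrix_vector_mult_diff_distrib[of T "y - \<alpha>" b] inner_diff_left[of "y - \<alpha>" b] inner_diff_right)
  ultimately show ?thesis
    unfolding forward_eq V\<^sub>F_def \<Lambda>\<^sub>F_def b_def[symmetric] by (simp add: inner_diff_left[of y \<alpha> "T *v b"] algebra_simps)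
qed

sublocale F: exp_family_kernel "\<lambda>x. (T ** \<beta>) *v x" V\<^sub>F \<Lambda>\<^sub>F "1 / \<rho>\<^sub>0" \<kappa>
proof (rule exp_family_kernel.intro)
  show "linear (\<lambda>x. (T ** \<beta>) *v x)" by (rule matrix_vector_mul_linear)
  show "norm ((T ** \<beta>) *v v) \<le> \<kappa> * norm v" for v unfolding \<kappa>_def by (rule norm_matrix_vector_le)
  show "V\<^sub>F \<in> borel_measurable borel" unfolding V\<^sub>F_def[abs_def] by measurable
  show "\<Lambda>\<^sub>F \<in> borel_measurable borel" unfolding \<Lambda>\<^sub>F_def[abs_def] by measurable
  show "strongly_convex (\<lambda>v. 1 / \<rho>\<^sub>0 * (norm v)\<^sup>2) V\<^sub>F"
    unfolding V\<^sub>F_def[abs_def] by (rule strongly_convex_mono[OF strongly_convex_quadratic])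
      (use inner_matrix_inv_ge[OF tau] in \<open>simp add: \<rho>\<^sub>0_def\<close>)
  show "(\<integral>\<^sup>+y. ennreal (exp (((T ** \<beta>) *v x) \<bullet> y - V\<^sub>F y - \<Lambda>\<^sub>F x)) \<partial>lborel) = 1" for x
    unfolding forward_k[symmetric] forward_def by (rule nn_integral_gauss_density[OF tau])
qed (use kappa_pos rho0_pos in auto)

lemma F_k: "F.k x y = forward x y"
  unfolding F.k_def forward_k ..

lemma F_K: "F.K = gibbs_kernel (\<lambda>x y. - ln (gauss_density \<tau> (y - (\<alpha> + \<beta> *v x))))"
  unfolding F.K_def[abs_def] gibbs_kernel_def F_k forward_def
  using gauss_density_pos[OF tau] by simp

lemma measurable_forward[measurable]: "(\<lambda>(x, y). forward x y) \<in> borel_measurable (borel \<Otimes>\<^sub>M borel)"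
  using F.measurable_k by (simp add: F_k)

abbreviation "Z \<equiv> F.mixture \<mu>"

lemma \<mu>_prob: "prob_space \<mu>" "sets \<mu> = sets borel" by (simp_all add: U_prob)

lemma ennreal_Z: "ennreal (Z y) = (\<integral>\<^sup>+x. ennreal (exp (- U x)) * ennreal (forward x y) \<partial>lborel)"
proof -
  interpret prob_space \<mu> by (rule U_prob)
  have [measurable]: "(\<lambda>x. ennreal (forward x y)) \<in> borel_measurable borel" by measurable
  have "(\<integral>\<^sup>+x. ennreal (forward x y) \<partial>\<mu>) \<le> (\<integral>\<^sup>+x. ennreal (1 / norm_const) \<partial>\<mu>)"
    by (intro nn_integral_mono ennreal_leI forward_le)
  also have "\<dots> < \<infinity>" using emeasure_space_1 by (simp add: ennreal_mult_less_top)
  finally have "ennreal (Z y) = (\<integral>\<^sup>+x. ennreal (forward x y) \<partial>\<mu>)"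
    by (simp add: F.mixture_def F_k)
  also have "\<dots> = (\<integral>\<^sup>+x. ennreal (exp (- U x)) * ennreal (forward x y) \<partial>lborel)"
    by (simp add: gibbs_measure_def nn_integral_density)
  finally show ?thesis .
qed

text \<open>A Gaussian density vanishes nowhere, so a zero would force the density of \<mu> to
  vanish almost everywhere.\<close>

lemma Z_pos: "0 < Z y"
proof (rule ccontr)
  assume "\<not> 0 < Z y"
  then have "(\<integral>\<^sup>+x. ennreal (exp (- U x)) * ennreal (forward x y) \<partial>lborel) = 0"
    unfolding ennreal_Z[symmetric] by (simp add: ennreal_neg)
  then have "AE x in lborel. ennreal (exp (- U x)) * ennreal (forward x y) = 0"
    by (subst (asm) nn_integral_0_iff_AE) auto
  then have "AE x in (lborel :: (real^'d) measure). False"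
    by (rule eventually_mono) (use forward_pos[of _ y] in \<open>simp add: ennreal_eq_0_iff not_le[symmetric]\<close>)
  then have "(\<integral>\<^sup>+x. ennreal (exp (- U x)) \<partial>lborel) = (\<integral>\<^sup>+x. 0 \<partial>(lborel :: (real^'d) measure))"
    by (intro nn_integral_cong_AE) auto
  then show False using int_U by simp
qed

lemma Z_measurable[measurable]: "Z \<in> borel_measurable borel"
  by (rule F.measurable_mixture[OF \<mu>_prob])

text \<open>A lower bound for the Hessian of the backward potential: the curvature of
  \<open>U\<close> plus that of the Gaussian term in x. \<open>\<rho>\<^sub>1\<close> is the norm of
  its inverse.\<close>

definition "M1 = matrix_inv u + transpose \<beta> ** T ** \<beta>"

lemma inner_M1: "v \<bullet> (M1 *v v) = v \<bullet> (matrix_inv u *v v) + (\<beta> *v v) \<bullet> (T *v (\<beta> *v v))"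
proof -
  have "M1 *v v = matrix_inv u *v v + transpose \<beta> *v (T *v (\<beta> *v v))"
    unfolding M1_def by (simp only: matrix_vector_mult_add_rdistrib matrix_vector_mul_assoc matrix_mul_assoc)
  then show ?thesis by (simp only: inner_add_right inner_transpose_matrix)
qed

lemma M1_pd: "positive_definite M1"
  unfolding positive_definite_def
proof (intro conjI allI impI)
  have "transpose T = T" "transpose (matrix_inv u) = matrix_inv u"
    using T_pd positive_definite_matrix_inv[OF u_pd] by (auto simp: positive_definite_def)
  moreover have "transpose (X + Y) = transpose X + transpose Y" for X Y :: "real^'d^'d"
    by (simp add: transpose_def vec_eq_iff)
  ultimately show "transpose M1 = M1"
    by (simp add: M1_def matrix_transpose_mul matrix_mul_assoc)
  fix v :: "real^'d" assume "v \<noteq> 0"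
  then have "0 < v \<bullet> (matrix_inv u *v v)"
    using positive_definite_matrix_inv[OF u_pd] by (simp add: positive_definite_def)
  then show "0 < v \<bullet> (M1 *v v)"
    unfolding inner_M1 using positive_definite_nonneg[OF T_pd] by (simp add: add_pos_nonneg)
qed

lemma rho1_pos: "0 < \<rho>\<^sub>1"
  unfolding \<rho>\<^sub>1_def M1_def[symmetric]
  by (intro spectral_norm_pos positive_definite_invertible positive_definite_matrix_inv M1_pd)

lemma M1_lower: "(norm v)\<^sup>2 / \<rho>\<^sub>1 \<le> v \<bullet> (matrix_inv u *v v) + (\<beta> *v v) \<bullet> (T *v (\<beta> *v v))"
  using inner_matrix_inv_ge[OF positive_definite_matrix_inv[OF M1_pd], of v]
  by (simp add: matrix_inv_matrix_inv[OF M1_pd] inner_M1 \<rho>\<^sub>1_def M1_def[symmetric])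

text \<open>By Bayes' rule the same exponent is now read as a function of x: the interaction is
  transposed, which keeps the bound \<kappa>, and \<open>Z\<close> enters the normaliser. The - (-
  \<alpha>) and + 0 in \<open>V\<^sub>G\<close> fit it to \<open>strongly_convex_quadratic\<close>
  composed with \<beta>.\<close>

definition "B\<^sub>G y = transpose (T ** \<beta>) *v y"
definition "V\<^sub>G x = U x + (1/2 * ((\<beta> *v x - (- \<alpha>)) \<bullet> (T *v (\<beta> *v x - (- \<alpha>)))) + 0)"
definition "\<Lambda>\<^sub>G y = 1/2 * (y \<bullet> (T *v y)) - y \<bullet> (T *v \<alpha>) + ln norm_const + ln (Z y)"

lemma backward_k:
  "exp (B\<^sub>G y \<bullet> x - V\<^sub>G x - \<Lambda>\<^sub>G y)
    = exp (- U x) * forward x y / Z y"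
proof -
  define m where "m = \<alpha> + \<beta> *v x"
  have "(transpose (T ** \<beta>) *v y) \<bullet> x = ((T ** \<beta>) *v x) \<bullet> y"
    using inner_transpose_matrix[of x "T ** \<beta>" y] by (simp only: inner_commute)
  then have 1: "(transpose (T ** \<beta>) *v y) \<bullet> x = y \<bullet> (T *v (\<beta> *v x))"
    by (simp only: inner_commute matrix_vector_mul_assoc)
  have 2: "\<beta> *v x - (- \<alpha>) = m" by (simp add: m_def)
  have 3: "y \<bullet> (T *v m) = y \<bullet> (T *v \<alpha>) + y \<bullet> (T *v (\<beta> *v x))"
    by (simp add: m_def matrix_vector_right_distrib inner_add_right)
  have 4: "(y - m) \<bullet> (T *v (y - m)) = y \<bullet> (T *v y) - 2 * (y \<bullet> (T *v m)) + m \<bullet> (T *v m)"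
    using T_sym[of m y] by (simp add: matrix_vector_mult_diff_distrib inner_diff_left inner_diff_right)
  have "exp (- U x) * forward x y / Z y
      = exp (- U x) * exp (- (1/2 * ((y - m) \<bullet> (T *v (y - m))) + ln norm_const)) * exp (- ln (Z y))"
    unfolding forward_eq m_def[symmetric] using Z_pos[of y] by (simp only: exp_minus exp_ln divide_inverse)
  also have "\<dots> = exp (- U x - (1/2 * ((y - m) \<bullet> (T *v (y - m))) + ln norm_const) - ln (Z y))"
    by (simp only: exp_add[symmetric] diff_conv_add_uminus)
  finally show ?thesis unfolding B\<^sub>G_def V\<^sub>G_def \<Lambda>\<^sub>G_def 1 2 4 3 by (simp add: algebra_simps)
qed

sublocale G: exp_family_kernel B\<^sub>G V\<^sub>G \<Lambda>\<^sub>G "1 / \<rho>\<^sub>1" \<kappa>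
proof (rule exp_family_kernel.intro)
  show "linear B\<^sub>G" unfolding B\<^sub>G_def[abs_def] by (rule matrix_vector_mul_linear)
  show "norm (B\<^sub>G v) \<le> \<kappa> * norm v" for v
    unfolding \<kappa>_def B\<^sub>G_def by (rule norm_transpose_vector_le)
  show "V\<^sub>G \<in> borel_measurable borel" unfolding V\<^sub>G_def[abs_def] by measurable
  show "\<Lambda>\<^sub>G \<in> borel_measurable borel" unfolding \<Lambda>\<^sub>G_def[abs_def] by measurable
  show "strongly_convex (\<lambda>v. 1 / \<rho>\<^sub>1 * (norm v)\<^sup>2) V\<^sub>G"
    unfolding V\<^sub>G_def[abs_def]
    by (rule strongly_convex_mono[OF strongly_convex_add[OF U_convex
        strongly_convex_linear_comp[OF strongly_convex_quadratic[of T "- \<alpha>" 0] matrix_vector_mul_linear[of \<beta>]]]])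
      (use M1_lower in simp)
  show "(\<integral>\<^sup>+x. ennreal (exp (B\<^sub>G y \<bullet> x - V\<^sub>G x - \<Lambda>\<^sub>G y)) \<partial>lborel) = 1" for y
  proof -
    have [measurable]: "(\<lambda>x. ennreal (forward x y)) \<in> borel_measurable borel" by measurable
    have "ennreal (exp (- U x) * forward x y / Z y) = ennreal (1 / Z y) * (ennreal (exp (- U x)) * ennreal (forward x y))" for x
      using Z_pos[of y] forward_pos[of x y] by (simp add: ennreal_mult[symmetric] less_imp_le)
    then have "(\<integral>\<^sup>+x. ennreal (exp (- U x) * forward x y / Z y) \<partial>lborel) = ennreal (1 / Z y) * ennreal (Z y)"
      unfolding ennreal_Z by (simp add: nn_integral_cmult)
    then show ?thesis unfolding backward_k using Z_pos[of y] by (simp add: ennreal_mult[symmetric])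
  qed
qed (use kappa_pos rho1_pos in auto)

lemma G_k: "G.k y x = exp (- U x) * forward x y / Z y"
  unfolding G.k_def backward_k ..

end

lemma enn2ereal_le_mult:
  assumes "a \<le> ennreal r * b" "0 \<le> r"
  shows "enn2ereal a \<le> ereal r * enn2ereal b"
proof -
  have "enn2ereal a \<le> enn2ereal (ennreal r * b)" using assms(1) by (simp add: less_eq_ennreal.rep_eq)
  then show ?thesis using assms(2) by (simp add: times_ennreal.rep_eq enn2ereal_ennreal)
qed

lemma ereal_pos_mult_infinity: "0 < r \<Longrightarrow> ereal r * \<infinity> = \<infinity>"
  by simp

lemma ennreal_min_mult_le:
  fixes a b :: ennreal
  assumes "a \<le> b" "a \<le> ennreal r * b" "0 \<le> r"
  shows "a \<le> ennreal (min 1 r) * b"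
  using assms by (cases "r \<le> 1") (auto simp: min_def)

section \<open>Bayes' rule and transport inequalities for the two marginals\<close>

context gaussian_gibbs
begin

definition "\<pi> = \<mu> \<bind> F.K"

lemma \<mu>_density: "\<mu> = density lborel (\<lambda>x. ennreal (exp (- U x)))"
  by (simp add: gibbs_measure_def)

lemma \<pi>_density: "\<pi> = density lborel (\<lambda>y. ennreal (Z y))"
  unfolding \<pi>_def by (rule F.bind_K_eq[OF \<mu>_prob])

lemma int_Z: "(\<integral>\<^sup>+y. ennreal (Z y) \<partial>lborel) = 1"
  by (rule F.int_mixture[OF \<mu>_prob])

lemma \<pi>_prob: "prob_space \<pi>" "sets \<pi> = sets borel"
  unfolding \<pi>_def by (rule F.prob_space_bind_K[OF \<mu>_prob], rule F.sets_bind_K[OF \<mu>_prob])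

text \<open>Minimised over x, the right side is the form of the inverse of \<open>P\<close> at y,
  where \<open>P\<close> is the covariance of the second marginal in the purely Gaussian case. Only
  a lower bound is needed, so duality replaces the minimisation.\<close>

lemma rho_pi_lower: "(norm y)\<^sup>2 / \<rho>\<^sub>\<pi> \<le> x \<bullet> (matrix_inv u *v x) + (y - \<beta> *v x) \<bullet> (T *v (y - \<beta> *v x))"
  and rho_pi_pos: "0 < \<rho>\<^sub>\<pi>"
proof -
  define P where "P = \<tau> + \<beta> ** u ** transpose \<beta>"
  have P: "w \<bullet> (P *v w) = w \<bullet> (\<tau> *v w) + (transpose \<beta> *v w) \<bullet> (u *v (transpose \<beta> *v w))" for w
  proof -
    have "P *v w = \<tau> *v w + \<beta> *v (u *v (transpose \<beta> *v w))"
      unfolding P_def by (simp only: matrix_vector_mult_add_rdistrib matrix_vector_mul_assoc matrix_mul_assoc)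
    moreover have "w \<bullet> (\<beta> *v z) = (transpose \<beta> *v w) \<bullet> z" for z
      using inner_transpose_matrix[of w "transpose \<beta>" z] by (simp only: transpose_transpose)
    ultimately show ?thesis by (simp only: inner_add_right)
  qed
  have "invertible P"
  proof -
    have "x = 0" if "P *v x = 0" for x
    proof (rule ccontr)
      assume "x \<noteq> 0"
      then have "0 < x \<bullet> (\<tau> *v x)" using tau by (simp add: positive_definite_def)
      then have "0 < x \<bullet> (P *v x)" unfolding P using positive_definite_nonneg[OF u_pd] by (simp add: add_pos_nonneg)
      then show False using that by simp
    qed
    then show ?thesis by (simp add: invertible_left_inverse matrix_left_invertible_ker)
  qed
  then show pos: "0 < \<rho>\<^sub>\<pi>" unfolding \<rho>\<^sub>\<pi>_def P_def by (rule spectral_norm_pos)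
  show "(norm y)\<^sup>2 / \<rho>\<^sub>\<pi> \<le> x \<bullet> (matrix_inv u *v x) + (y - \<beta> *v x) \<bullet> (T *v (y - \<beta> *v x))"
    unfolding \<rho>\<^sub>\<pi>_def P_def[symmetric]
  proof (rule norm_le_of_young)
    show "0 < spectral_norm P" using pos by (simp add: \<rho>\<^sub>\<pi>_def P_def)
    fix w
    \<comment> \<open>Splitting y into \<beta> x and the residual: one Young inequality for each
      part, and the two dual forms add up to \<open>P\<close>.\<close>
    have "w \<bullet> y = (transpose \<beta> *v w) \<bullet> x + w \<bullet> (y - \<beta> *v x)"
      using inner_transpose_matrix[of x \<beta> w] by (simp only: inner_commute inner_diff_right)
    then show "2 * (w \<bullet> y) \<le> w \<bullet> (P *v w) + (x \<bullet> (matrix_inv u *v x) + (y - \<beta> *v x) \<bullet> (T *v (y - \<beta> *v x)))"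
      using young_positive_definite[OF u_pd, of "transpose \<beta> *v w" x]
        young_positive_definite[OF tau, of w "y - \<beta> *v x"] unfolding P by linarith
  qed
qed

lemma bayes_density: "ennreal (Z y) * ennreal (G.k y x) = ennreal (exp (- U x)) * ennreal (forward x y)"
  using Z_pos[of y] forward_pos[of x y] by (simp add: G_k ennreal_mult[symmetric] less_imp_le)

text \<open>The two disintegrations of the joint law, \<mu> followed by the forward kernel and \<pi>
  followed by the backward kernel, have the same density by \<open>bayes_density\<close>.\<close>

lemma nn_integral_joint:
  assumes H[measurable]: "H \<in> borel_measurable (borel \<Otimes>\<^sub>M borel)"
  shows "(\<integral>\<^sup>+x. \<integral>\<^sup>+y. H (x, y) \<partial>F.K x \<partial>\<mu>) = (\<integral>\<^sup>+y. \<integral>\<^sup>+x. H (x, y) \<partial>G.K y \<partial>\<pi>)"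
proof -
  have [measurable]: "(\<lambda>(y, x). ennreal (G.k y x)) \<in> borel_measurable (borel \<Otimes>\<^sub>M borel)"
    using G.measurable_k by measurable
  have "(\<integral>\<^sup>+y. H (x, y) \<partial>F.K x) = (\<integral>\<^sup>+y. ennreal (forward x y) * H (x, y) \<partial>lborel)" for x
    unfolding F.K_def F_k by (intro nn_integral_density) measurable
  then have "(\<integral>\<^sup>+x. \<integral>\<^sup>+y. H (x, y) \<partial>F.K x \<partial>\<mu>)
      = (\<integral>\<^sup>+x. \<integral>\<^sup>+y. ennreal (exp (- U x)) * (ennreal (forward x y) * H (x, y)) \<partial>lborel \<partial>lborel)"
    unfolding \<mu>_density by (simp add: nn_integral_density nn_integral_cmult)
  also have "\<dots> = (\<integral>\<^sup>+y. \<integral>\<^sup>+x. ennreal (exp (- U x)) * (ennreal (forward x y) * H (x, y)) \<partial>lborel \<partial>lborel)"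
    by (rule lborel_pair.Fubini'[symmetric]) measurable
  also have "\<dots> = (\<integral>\<^sup>+y. ennreal (Z y) * (\<integral>\<^sup>+x. ennreal (G.k y x) * H (x, y) \<partial>lborel) \<partial>lborel)"
    by (simp add: mult.assoc[symmetric] bayes_density[symmetric])
      (simp add: mult.assoc nn_integral_cmult)
  also have "\<dots> = (\<integral>\<^sup>+y. \<integral>\<^sup>+x. ennreal (G.k y x) * H (x, y) \<partial>lborel \<partial>\<pi>)"
    unfolding \<pi>_density by (rule nn_integral_density[symmetric]) measurable
  also have "\<dots> = (\<integral>\<^sup>+y. \<integral>\<^sup>+x. H (x, y) \<partial>G.K y \<partial>\<pi>)"
    unfolding G.K_def by (intro nn_integral_cong nn_integral_density[symmetric]) measurable
  finally show ?thesis .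
qed

lemma \<pi>_bind_G: "\<pi> \<bind> G.K = \<mu>"
proof (rule measure_eqI)
  show "sets (\<pi> \<bind> G.K) = sets \<mu>" by (simp add: G.sets_bind_K[OF \<pi>_prob])
  fix A assume "A \<in> sets (\<pi> \<bind> G.K)"
  then have A[measurable]: "A \<in> sets borel" by (simp add: G.sets_bind_K[OF \<pi>_prob])
  have \<pi>: "\<pi> \<in> space (prob_algebra borel)" using \<pi>_prob by (simp add: space_prob_algebra)
  have "emeasure (\<pi> \<bind> G.K) A = (\<integral>\<^sup>+y. emeasure (G.K y) A \<partial>\<pi>)"
    by (rule emeasure_bind_prob_algebra[OF \<pi> G.K_measurable A])
  also have "\<dots> = (\<integral>\<^sup>+x. \<integral>\<^sup>+y. indicator A x \<partial>F.K x \<partial>\<mu>)"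
    using nn_integral_joint[of "\<lambda>(x, y). indicator A x"] by simp
  also have "\<dots> = emeasure \<mu> A"
    using prob_space.emeasure_space_1[OF F.prob_space_K] by simp
  finally show "emeasure (\<pi> \<bind> G.K) A = emeasure \<mu> A" .
qed

context
  fixes e :: "real^'d \<Rightarrow> real"
  assumes e_measurable[measurable]: "e \<in> borel_measurable borel" and e_nonneg: "\<And>y. 0 \<le> e y"
    and int_e: "(\<integral>\<^sup>+y. ennreal (e y) \<partial>lborel) = 1"
begin

lemma talagrand_\<mu>: "transport_cost (density lborel e) \<mu> \<le> ennreal (2 * \<rho>\<^sub>u) * kl e (\<lambda>x. exp (- U x))"
  unfolding \<mu>_density
  by (rule talagrand_transport_cost[OF _ _ e_nonneg int_e int_U rho_u_pos])
    (auto intro: strongly_convex_mono[OF U_convex] inner_matrix_inv_ge[OF u_pd] simp: \<rho>\<^sub>u_def)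

text \<open>The second marginal \<open>\<pi>\<close> inherits a transport inequality from the joint law on the product space,
  applied to the lift of the density \<open>e / Z\<close>.\<close>
lemma talagrand_\<pi>: "transport_cost (density lborel e) \<pi> \<le> ennreal (2 * \<rho>\<^sub>\<pi>) * kl e Z"
proof -
  define J where "J = (\<lambda>z. U (fst z) + (1/2 * ((snd z - \<beta> *v fst z - \<alpha>) \<bullet> (T *v (snd z - \<beta> *v fst z - \<alpha>))) + ln norm_const))"
  \<comment> \<open>The cost ignores the first component. The joint potential is strongly convex
    with this degenerate modulus by \<open>rho_pi_lower\<close>.\<close>
  define q where "q = (\<lambda>z :: (real^'d) \<times> (real^'d). (norm (snd z))\<^sup>2 / \<rho>\<^sub>\<pi>)"
  define h where "h = (\<lambda>y. e y / Z y)"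
  \<comment> \<open>The lift changes the law of the second component to \<open>e\<close> and keeps
    the conditional law of the first, so that no entropy is added in \<open>kl_g\<close>.\<close>
  define g where "g = (\<lambda>z. h (snd z) * exp (- J z))"
  have h0: "0 \<le> h y" for y using e_nonneg[of y] Z_pos[of y] by (simp add: h_def)
  have hZ: "ennreal (Z y) * ennreal (h y) = ennreal (e y)" for y
    using e_nonneg[of y] Z_pos[of y] by (simp add: h_def ennreal_mult[symmetric] less_imp_le)
  have [measurable]: "(fst :: (real^'d) \<times> (real^'d) \<Rightarrow> real^'d) \<in> borel_measurable borel"
    "(snd :: (real^'d) \<times> (real^'d) \<Rightarrow> real^'d) \<in> borel_measurable borel"
    by (auto intro!: borel_measurable_continuous_onI continuous_intros)
  have Jm[measurable]: "J \<in> borel_measurable borel" unfolding J_def by measurable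
  have qm[measurable]: "q \<in> borel_measurable borel" unfolding q_def by measurable
  have [measurable]: "h \<in> borel_measurable borel" unfolding h_def by measurable
  have gm[measurable]: "g \<in> borel_measurable borel" unfolding g_def by measurable
  have expJ: "exp (- J (x, y)) = exp (- U x) * forward x y" for x y
    by (simp add: J_def forward_eq exp_add[symmetric] diff_diff_eq add.commute[of \<alpha>])
  have int_J: "(\<integral>\<^sup>+z. ennreal (exp (- J z)) * w (snd z) \<partial>lborel) = (\<integral>\<^sup>+y. ennreal (Z y) * w y \<partial>lborel)"
    if [measurable]: "w \<in> borel_measurable borel" for w
  proof -
    have "(\<integral>\<^sup>+z. ennreal (exp (- J z)) * w (snd z) \<partial>lborel)
      = (\<integral>\<^sup>+z. ennreal (exp (- J z)) * w (snd z) \<partial>(lborel \<Otimes>\<^sub>M lborel))" by (simp add: lborel_prod)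
    also have "\<dots> = (\<integral>\<^sup>+y. \<integral>\<^sup>+x. ennreal (exp (- J (x, y))) * w y \<partial>lborel \<partial>lborel)"
    proof -
      have "(\<lambda>z. ennreal (exp (- J z)) * w (snd z)) \<in> borel_measurable borel" by measurable
      then have "(\<lambda>z. ennreal (exp (- J z)) * w (snd z)) \<in> borel_measurable (lborel \<Otimes>\<^sub>M lborel)"
        by (simp add: lborel_prod)
      from lborel_pair.nn_integral_snd[OF this] show ?thesis by simp
    qed
    also have "\<dots> = (\<integral>\<^sup>+y. ennreal (Z y) * w y \<partial>lborel)"
    proof (rule nn_integral_cong)
      fix y :: "real^'d"
      have [measurable]: "(\<lambda>x. ennreal (forward x y)) \<in> borel_measurable borel" by measurable
      show "(\<integral>\<^sup>+x. ennreal (exp (- J (x, y))) * w y \<partial>lborel) = ennreal (Z y) * w y"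
        unfolding expJ ennreal_Z using forward_pos[of _ y] by (simp add: ennreal_mult less_imp_le nn_integral_multc)
    qed
    finally show ?thesis .
  qed
  have int_g: "(\<integral>\<^sup>+z. ennreal (g z) * w (snd z) \<partial>lborel) = (\<integral>\<^sup>+y. ennreal (e y) * w y \<partial>lborel)"
    if [measurable]: "w \<in> borel_measurable borel" for w
    using int_J[of "\<lambda>y. ennreal (h y) * w y"] h0
    by (simp add: g_def ennreal_mult mult_ac hZ[symmetric])
  have kl_g: "kl g (\<lambda>z. exp (- J z)) = kl e Z"
  proof -
    have 1: "kl_integrand (g z) (exp (- J z)) = exp (- J z) * kl_integrand (h (snd z)) 1" for z
      by (simp add: g_def kl_integrand_def algebra_simps)
    have 2: "Z y * kl_integrand (h y) 1 = kl_integrand (e y) (Z y)" for y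
      using Z_pos[of y] by (simp add: kl_integrand_def h_def field_simps)
    have 3: "0 \<le> kl_integrand (h y) 1" for y using h0 by (intro kl_integrand_nonneg) auto
    have "kl g (\<lambda>z. exp (- J z)) = (\<integral>\<^sup>+z. ennreal (exp (- J z)) * ennreal (kl_integrand (h (snd z)) 1) \<partial>lborel)"
      unfolding kl_def 1 using 3 by (simp add: ennreal_mult)
    also have "\<dots> = (\<integral>\<^sup>+y. ennreal (Z y) * ennreal (kl_integrand (h y) 1) \<partial>lborel)"
      by (rule int_J) measurable
    also have "\<dots> = kl e Z"
      unfolding kl_def 2[symmetric] using 3 Z_pos by (simp add: ennreal_mult less_imp_le)
    finally show ?thesis .
  qed
  have sc: "strongly_convex q J"
    unfolding J_def q_def
  proof (rule strongly_convex_mono[OF strongly_convex_add[OF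
      strongly_convex_linear_comp[OF U_convex, of fst]
      strongly_convex_linear_comp[OF strongly_convex_quadratic[of T \<alpha> "ln norm_const"], of "\<lambda>z. snd z - \<beta> *v fst z"]]])
    show "linear (fst :: (real^'d) \<times> (real^'d) \<Rightarrow> real^'d)" by (rule linear_fst)
    show "linear (\<lambda>z :: (real^'d) \<times> (real^'d). snd z - \<beta> *v fst z)"
      by (rule linearI) (simp_all add: matrix_vector_right_distrib matrix_vector_mult_scaleR algebra_simps)
  qed (rule rho_pi_lower)
  have J1: "(\<integral>\<^sup>+z. ennreal (exp (- J z)) \<partial>lborel) = 1" using int_J[of "\<lambda>_. 1"] int_Z by simp
  have g1: "(\<integral>\<^sup>+z. ennreal (g z) \<partial>lborel) = 1" using int_g[of "\<lambda>_. 1"] int_e by simp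
  have g0: "0 \<le> g z" for z using h0 by (simp add: g_def)
  have q0: "0 \<le> q z" for z using rho_pi_pos by (simp add: q_def)
  obtain \<gamma> where \<gamma>: "\<gamma> \<in> couplings (density lborel g) (density lborel (\<lambda>z. exp (- J z)))"
    and le: "(\<integral>\<^sup>+p. ennreal (q (snd p - fst p)) \<partial>\<gamma>) \<le> 2 * kl g (\<lambda>z. exp (- J z))"
    by (rule talagrand_coupling[OF Jm qm gm g0 q0 sc J1 g1])
  have sets_\<gamma>[measurable_cong]: "sets \<gamma> = sets (borel \<Otimes>\<^sub>M borel)" and \<gamma>_prob: "prob_space \<gamma>"
    and marg: "distr \<gamma> borel fst = density lborel g" "distr \<gamma> borel snd = density lborel (\<lambda>z. exp (- J z))"
    using \<gamma> by (auto simp: couplings_def)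
  \<comment> \<open>Projecting the coupling of the pairs to second components preserves its cost,
    since \<open>q\<close> sees nothing else.\<close>
  define \<gamma>' where "\<gamma>' = distr \<gamma> (borel \<Otimes>\<^sub>M borel) (\<lambda>p. (snd (fst p), snd (snd p)))"
  have "\<gamma>' \<in> couplings (density lborel e) \<pi>"
  proof -
    have "distr \<gamma>' borel fst = distr \<gamma> borel (snd \<circ> fst)"
      unfolding \<gamma>'_def by (subst distr_distr) (auto simp: comp_def)
    also have "\<dots> = distr (distr \<gamma> borel fst) borel snd" by (rule distr_distr[symmetric]) measurable
    also have "\<dots> = density lborel e" unfolding marg
      by (rule distr_eq_densityI) (auto simp: nn_integral_density int_g)
    finally have 1: "distr \<gamma>' borel fst = density lborel e" .
    have "distr \<gamma>' borel snd = distr \<gamma> borel (snd \<circ> snd)"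
      unfolding \<gamma>'_def by (subst distr_distr) (auto simp: comp_def)
    also have "\<dots> = distr (distr \<gamma> borel snd) borel snd" by (rule distr_distr[symmetric]) measurable
    also have "\<dots> = \<pi>" unfolding marg \<pi>_density
      by (rule distr_eq_densityI) (auto simp: nn_integral_density int_J)
    finally have 2: "distr \<gamma>' borel snd = \<pi>" .
    have "prob_space \<gamma>'" unfolding \<gamma>'_def by (rule prob_space.prob_space_distr[OF \<gamma>_prob]) measurable
    then show ?thesis using 1 2 by (simp add: couplings_def) (simp add: \<gamma>'_def)
  qed
  then have "transport_cost (density lborel e) \<pi> \<le> (\<integral>\<^sup>+ p. ennreal ((norm (fst p - snd p))\<^sup>2) \<partial>\<gamma>')"
    by (rule transport_cost_le)
  also have "\<dots> = (\<integral>\<^sup>+p. ennreal ((norm (snd (fst p) - snd (snd p)))\<^sup>2) \<partial>\<gamma>)"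
    unfolding \<gamma>'_def by (subst nn_integral_distr) auto
  also have "\<dots> = (\<integral>\<^sup>+p. ennreal \<rho>\<^sub>\<pi> * ennreal (q (snd p - fst p)) \<partial>\<gamma>)"
    using rho_pi_pos by (intro nn_integral_cong) (simp add: q_def ennreal_mult[symmetric] norm_minus_commute)
  also have "\<dots> = ennreal \<rho>\<^sub>\<pi> * (\<integral>\<^sup>+p. ennreal (q (snd p - fst p)) \<partial>\<gamma>)"
    by (rule nn_integral_cmult) measurable
  also have "\<dots> \<le> ennreal \<rho>\<^sub>\<pi> * (2 * kl e Z)"
    using le unfolding kl_g by (rule mult_left_mono) simp
  also have "\<dots> = ennreal (2 * \<rho>\<^sub>\<pi>) * kl e Z" using rho_pi_pos by (simp add: ennreal_mult mult_ac)
  finally show ?thesis .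
qed

lemma prob_density_e: "prob_space (density lborel e)" "sets (density lborel e) = sets borel"
  by (auto intro!: prob_spaceI simp: emeasure_density int_e)

text \<open>The entropy is turned into distance by Talagrand's inequality for \<mu> and back by the
  smoothing of the forward kernel; 2 and 1/2 cancel. Data processing accounts for the minimum with
  1.\<close>

lemma kl_forward_le:
  "kl (F.mixture (density lborel e)) Z \<le> ennreal (min 1 (\<kappa>\<^sup>2 * \<rho>\<^sub>0 * \<rho>\<^sub>u)) * kl e (\<lambda>x. exp (- U x))"
proof (rule ennreal_min_mult_le)
  show "kl (F.mixture (density lborel e)) Z \<le> kl e (\<lambda>x. exp (- U x))"
    unfolding \<mu>_density by (rule F.kl_bind_le) (use e_nonneg int_U int_e in auto)
  have "kl (F.mixture (density lborel e)) Z \<le> ennreal (\<kappa>\<^sup>2 / (2 * (1 / \<rho>\<^sub>0))) * transport_cost (density lborel e) \<mu>"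
    by (rule F.kl_bind_le_transport_cost[OF \<mu>_prob prob_density_e])
  also have "\<dots> \<le> ennreal (\<kappa>\<^sup>2 / (2 * (1 / \<rho>\<^sub>0))) * (ennreal (2 * \<rho>\<^sub>u) * kl e (\<lambda>x. exp (- U x)))"
    by (intro mult_left_mono talagrand_\<mu>) auto
  also have "\<dots> = ennreal (\<kappa>\<^sup>2 * \<rho>\<^sub>0 * \<rho>\<^sub>u) * kl e (\<lambda>x. exp (- U x))"
    using rho0_pos rho_u_pos by (simp add: mult.assoc[symmetric] ennreal_mult[symmetric])
  finally show "kl (F.mixture (density lborel e)) Z \<le> ennreal (\<kappa>\<^sup>2 * \<rho>\<^sub>0 * \<rho>\<^sub>u) * kl e (\<lambda>x. exp (- U x))" .
  show "0 \<le> \<kappa>\<^sup>2 * \<rho>\<^sub>0 * \<rho>\<^sub>u" using rho0_pos rho_u_pos by simp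
qed

lemma kl_backward_data_processing:
  "kl (G.mixture (density lborel e)) (G.mixture \<pi>) \<le> kl e Z"
  unfolding \<pi>_density by (rule G.kl_bind_le) (use e_nonneg Z_pos int_Z int_e in auto)

text \<open>The same round trip, with Talagrand's inequality for \<pi> and the smoothing of the
  backward kernel.\<close>

lemma kl_backward_le:
  "kl (G.mixture (density lborel e)) (G.mixture \<pi>) \<le> ennreal (min 1 (\<kappa>\<^sup>2 * \<rho>\<^sub>\<pi> * \<rho>\<^sub>1)) * kl e Z"
proof (rule ennreal_min_mult_le[OF kl_backward_data_processing])
  have "kl (G.mixture (density lborel e)) (G.mixture \<pi>) \<le> ennreal (\<kappa>\<^sup>2 / (2 * (1 / \<rho>\<^sub>1))) * transport_cost (density lborel e) \<pi>"
    by (rule G.kl_bind_le_transport_cost[OF \<pi>_prob prob_density_e])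
  also have "\<dots> \<le> ennreal (\<kappa>\<^sup>2 / (2 * (1 / \<rho>\<^sub>1))) * (ennreal (2 * \<rho>\<^sub>\<pi>) * kl e Z)"
    by (intro mult_left_mono talagrand_\<pi>) auto
  also have "\<dots> = ennreal (\<kappa>\<^sup>2 * \<rho>\<^sub>\<pi> * \<rho>\<^sub>1) * kl e Z"
  proof -
    have "\<kappa>\<^sup>2 / (2 * (1 / \<rho>\<^sub>1)) * (2 * \<rho>\<^sub>\<pi>) = \<kappa>\<^sup>2 * \<rho>\<^sub>\<pi> * \<rho>\<^sub>1" by simp
    moreover have "0 \<le> \<kappa>\<^sup>2 / (2 * (1 / \<rho>\<^sub>1))" "0 \<le> 2 * \<rho>\<^sub>\<pi>" using rho1_pos rho_pi_pos by simp_all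
    ultimately show ?thesis by (simp only: mult.assoc[symmetric] ennreal_mult[symmetric])
  qed
  finally show "kl (G.mixture (density lborel e)) (G.mixture \<pi>) \<le> ennreal (\<kappa>\<^sup>2 * \<rho>\<^sub>\<pi> * \<rho>\<^sub>1) * kl e Z" .
  show "0 \<le> \<kappa>\<^sup>2 * \<rho>\<^sub>\<pi> * \<rho>\<^sub>1" using rho1_pos rho_pi_pos by simp
qed

text \<open>A backward transition is determined only \<open>\<pi>\<close>-almost everywhere, but \<open>density lborel e\<close> is
  absolutely continuous with respect to \<open>\<pi>\<close>.\<close>
lemma bind_backward_transition:
  assumes L: "backward_transition \<mu> F.K L"
  shows "density lborel e \<bind> L = density lborel e \<bind> G.K"
proof (rule measure_eqI)
  let ?\<eta> = "density lborel (\<lambda>y. ennreal (e y))"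
  have Lm: "L \<in> measurable borel (prob_algebra borel)"
    using L by (simp add: backward_transition_def markov_kernel_def)
  have \<eta>: "?\<eta> \<in> space (prob_algebra borel)" using prob_density_e by (simp add: space_prob_algebra)
  have sL: "sets (?\<eta> \<bind> L) = sets borel" by (rule sets_bind'[OF \<eta> Lm])
  show "sets (?\<eta> \<bind> L) = sets (?\<eta> \<bind> G.K)" by (simp add: sL G.sets_bind_K[OF prob_density_e])
  define h where "h = (\<lambda>y. e y / Z y)"
  have [measurable]: "h \<in> borel_measurable borel" unfolding h_def by measurable
  have hZ: "ennreal (Z y) * ennreal (h y) = ennreal (e y)" for y
    using e_nonneg[of y] Z_pos[of y] by (simp add: h_def ennreal_mult[symmetric] less_imp_le)
  have Lm': "L \<in> measurable \<pi> (prob_algebra borel)" using Lm by (simp add: measurable_cong_sets[OF \<pi>_prob(2) refl])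
  have Fm': "F.K \<in> measurable \<mu> (prob_algebra borel)" using F.K_measurable by (simp add: measurable_cong_sets[OF sets_\<mu> refl])
  have joint: "\<mu> \<bind> (\<lambda>x. F.K x \<bind> (\<lambda>y. return (borel \<Otimes>\<^sub>M borel) (x, y)))
      = \<pi> \<bind> (\<lambda>y. L y \<bind> (\<lambda>x. return (borel \<Otimes>\<^sub>M borel) (x, y)))"
    using L by (simp add: backward_transition_def \<pi>_def)
  fix A assume "A \<in> sets (?\<eta> \<bind> L)"
  then have A[measurable]: "A \<in> sets borel" by (simp add: sL)
  \<comment> \<open>The weight h = e/Z turns integration against \<pi> into integration against the
    given law, so testing the joint laws with this function compares the two mixtures on
    \<open>A\<close>.\<close>
  define Fn where "Fn = (\<lambda>(x, y). ennreal (h y) * indicator A x :: ennreal)"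
  have Fn[measurable]: "Fn \<in> borel_measurable (borel \<Otimes>\<^sub>M borel)" unfolding Fn_def by measurable
  have \<pi>_e: "(\<integral>\<^sup>+y. ennreal (h y) * emeasure (R y) A \<partial>\<pi>) = (\<integral>\<^sup>+y. emeasure (R y) A \<partial>?\<eta>)"
    if R: "R \<in> measurable borel (prob_algebra borel)" for R
  proof -
    have [measurable]: "(\<lambda>y. emeasure (R y) A) \<in> borel_measurable borel"
      by (rule measurable_compose[OF measurable_prob_algebraD[OF R] measurable_emeasure_subprob_algebra[OF A]])
    show ?thesis unfolding \<pi>_density by (simp add: nn_integral_density hZ[symmetric] mult.assoc)
  qed
  have "emeasure (?\<eta> \<bind> L) A = (\<integral>\<^sup>+y. emeasure (L y) A \<partial>?\<eta>)"
    by (rule emeasure_bind_prob_algebra[OF \<eta> Lm A])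
  also have "\<dots> = (\<integral>\<^sup>+y. ennreal (h y) * emeasure (L y) A \<partial>\<pi>)"
    by (rule \<pi>_e[OF Lm, symmetric])
  also have "\<dots> = (\<integral>\<^sup>+y. \<integral>\<^sup>+x. Fn (x, y) \<partial>L y \<partial>\<pi>)"
  proof (rule nn_integral_cong)
    fix y
    have [simp]: "sets (L y) = sets borel" using measurable_space[OF Lm, of y] by (simp add: space_prob_algebra)
    then have [measurable]: "A \<in> sets (L y)" by simp
    show "ennreal (h y) * emeasure (L y) A = (\<integral>\<^sup>+x. Fn (x, y) \<partial>L y)"
      by (simp add: Fn_def nn_integral_cmult)
  qed
  also have "\<dots> = (\<integral>\<^sup>+z. Fn z \<partial>(\<pi> \<bind> (\<lambda>y. L y \<bind> (\<lambda>x. return (borel \<Otimes>\<^sub>M borel) (x, y)))))"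
    by (rule nn_integral_bind_return[OF Lm' _ Fn, symmetric]) (simp cong: measurable_cong_sets add: \<pi>_prob)
  also have "\<dots> = (\<integral>\<^sup>+x. \<integral>\<^sup>+y. Fn (x, y) \<partial>F.K x \<partial>\<mu>)"
    unfolding joint[symmetric] by (rule nn_integral_bind_return[OF Fm' _ Fn]) (simp cong: measurable_cong_sets)
  also have "\<dots> = (\<integral>\<^sup>+y. \<integral>\<^sup>+x. Fn (x, y) \<partial>G.K y \<partial>\<pi>)"
    by (rule nn_integral_joint) measurable
  also have "\<dots> = (\<integral>\<^sup>+y. ennreal (h y) * emeasure (G.K y) A \<partial>\<pi>)"
    by (simp add: Fn_def nn_integral_cmult_indicator)
  also have "\<dots> = (\<integral>\<^sup>+y. emeasure (G.K y) A \<partial>?\<eta>)"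
    by (rule \<pi>_e) (rule G.K_measurable)
  also have "\<dots> = emeasure (?\<eta> \<bind> G.K) A"
    by (rule emeasure_bind_prob_algebra[OF \<eta> G.K_measurable A, symmetric])
  finally show "emeasure (?\<eta> \<bind> L) A = emeasure (?\<eta> \<bind> G.K) A" .
qed

end

section \<open>Contraction of the sampler and of its iterates\<close>

context
  fixes L S :: "real^'d \<Rightarrow> (real^'d) measure"
  assumes L: "backward_transition \<mu> F.K L" and S: "S = kernel_comp F.K L"
begin

lemma L_measurable: "L \<in> measurable borel (prob_algebra borel)"
  using L by (simp add: backward_transition_def markov_kernel_def)

lemma S_measurable: "S \<in> measurable borel (prob_algebra borel)"
  unfolding S kernel_comp_def by (rule measurable_bind_prob_space[OF F.K_measurable L_measurable])

context
  fixes \<nu> :: "(real^'d) measure"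
  assumes \<nu>: "prob_space \<nu>" "sets \<nu> = sets borel"
begin

text \<open>After the forward step every law has a Lebesgue density, so the given version of the
  backward transition may be exchanged for the exponential family \<open>G.K\<close>.\<close>

lemma bind_S: "\<nu> \<bind> S = (\<nu> \<bind> F.K) \<bind> G.K"
proof -
  have "F.K \<in> measurable \<nu> (prob_algebra borel)"
    using F.K_measurable by (simp add: measurable_cong_sets[OF \<nu>(2) refl])
  then have "\<nu> \<bind> S = (\<nu> \<bind> F.K) \<bind> L"
    unfolding S kernel_comp_def
    by (intro bind_assoc[symmetric, where N=borel and R=borel] measurable_prob_algebraD L_measurable)
  also have "\<dots> = (\<nu> \<bind> F.K) \<bind> G.K"
    unfolding F.bind_K_eq[OF \<nu>]
    by (rule bind_backward_transition[OF F.measurable_mixture[OF \<nu>] F.mixture_nonneg F.int_mixture[OF \<nu>] L])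
  finally show ?thesis .
qed

lemma bind_F_prob: "prob_space (\<nu> \<bind> F.K)" "sets (\<nu> \<bind> F.K) = sets borel"
  by (rule F.prob_space_bind_K[OF \<nu>], rule F.sets_bind_K[OF \<nu>])

text \<open>As \<mu> moves to \<pi> and back to \<mu>, each half step compares with its own
  stationary law, and the two contraction factors multiply.\<close>

lemma transport_cost_S: "transport_cost (\<nu> \<bind> S) \<mu> \<le> ennreal ((\<kappa>\<^sup>2 * \<rho>\<^sub>0 * \<rho>\<^sub>1)\<^sup>2) * transport_cost \<nu> \<mu>"
proof -
  have "transport_cost (\<nu> \<bind> S) \<mu> = transport_cost ((\<nu> \<bind> F.K) \<bind> G.K) (\<pi> \<bind> G.K)"
    by (simp add: bind_S \<pi>_bind_G)
  also have "\<dots> \<le> ennreal ((\<kappa> / (1 / \<rho>\<^sub>1))\<^sup>2) * transport_cost (\<nu> \<bind> F.K) \<pi>"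
    by (rule G.transport_cost_bind_le[OF \<pi>_prob bind_F_prob])
  also have "\<dots> \<le> ennreal ((\<kappa> / (1 / \<rho>\<^sub>1))\<^sup>2) * (ennreal ((\<kappa> / (1 / \<rho>\<^sub>0))\<^sup>2) * transport_cost \<nu> \<mu>)"
    unfolding \<pi>_def by (intro mult_left_mono F.transport_cost_bind_le[OF \<mu>_prob \<nu>]) auto
  also have "\<dots> = ennreal ((\<kappa>\<^sup>2 * \<rho>\<^sub>0 * \<rho>\<^sub>1)\<^sup>2) * transport_cost \<nu> \<mu>"
  proof -
    have "(\<kappa> / (1 / \<rho>\<^sub>1))\<^sup>2 * (\<kappa> / (1 / \<rho>\<^sub>0))\<^sup>2 = (\<kappa>\<^sup>2 * \<rho>\<^sub>0 * \<rho>\<^sub>1)\<^sup>2"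
      by (simp add: power2_eq_square)
    then show ?thesis by (simp only: mult.assoc[symmetric] ennreal_mult[symmetric] zero_le_power2)
  qed
  finally show ?thesis .
qed

lemma rel_entropy_S: "rel_entropy (\<nu> \<bind> S) \<mu> = enn2ereal (kl (G.mixture (\<nu> \<bind> F.K)) (G.mixture \<pi>))"
  unfolding bind_S by (subst \<pi>_bind_G[symmetric]) (rule G.rel_entropy_bind[OF \<pi>_prob bind_F_prob])

text \<open>The forward half step alone turns distance into entropy; the backward half step enters
  through data processing. This produces the factor \<open>\<rho>\<^sub>0\<close> in
  \<open>a\<close>.\<close>

lemma kl_S_le_transport_cost:
  "kl (G.mixture (\<nu> \<bind> F.K)) (G.mixture \<pi>) \<le> ennreal (\<kappa>\<^sup>2 * \<rho>\<^sub>0 / 2) * transport_cost \<nu> \<mu>"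
proof -
  have "kl (G.mixture (\<nu> \<bind> F.K)) (G.mixture \<pi>) \<le> kl (F.mixture \<nu>) Z"
    unfolding F.bind_K_eq[OF \<nu>]
    by (rule kl_backward_data_processing[OF F.measurable_mixture[OF \<nu>] F.mixture_nonneg F.int_mixture[OF \<nu>]])
  also have "\<dots> \<le> ennreal (\<kappa>\<^sup>2 / (2 * (1 / \<rho>\<^sub>0))) * transport_cost \<nu> \<mu>"
    by (rule F.kl_bind_le_transport_cost[OF \<mu>_prob \<nu>])
  finally show ?thesis by simp
qed

text \<open>With infinite entropy the bounds below are trivial, but only because their factors are
  strictly positive: 0 times infinity is 0 in \<open>ereal\<close>.\<close>

lemma rel_entropy_cases:
  obtains "rel_entropy \<nu> \<mu> = \<infinity>"
  | g where "g \<in> borel_measurable borel" "\<And>x. 0 \<le> g x" "(\<integral>\<^sup>+x. ennreal (g x) \<partial>lborel) = 1"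
      "\<nu> = density lborel (\<lambda>x. ennreal (g x))" "rel_entropy \<nu> \<mu> = enn2ereal (kl g (\<lambda>x. exp (- U x)))"
proof (cases "rel_entropy \<nu> \<mu> = \<infinity>")
  case False
  then have fin: "rel_entropy \<nu> (density lborel (\<lambda>x. exp (- U x))) \<noteq> \<infinity>" by (simp add: \<mu>_density)
  have Um: "(\<lambda>x. exp (- U x)) \<in> borel_measurable borel" by measurable
  obtain g where g[measurable]: "g \<in> borel_measurable borel" and g0: "\<And>x. 0 \<le> g x" and \<nu>g: "\<nu> = density lborel (\<lambda>x. ennreal (g x))"
    by (rule rel_entropy_finite_density[OF Um _ int_U \<nu> fin]) (simp, rule that)
  interpret prob_space \<nu> by (rule \<nu>)
  have int_g: "(\<integral>\<^sup>+x. ennreal (g x) \<partial>lborel) = 1"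
    using emeasure_space_1 by (simp add: \<nu>g emeasure_density)
  have "rel_entropy \<nu> \<mu> = enn2ereal (kl g (\<lambda>x. exp (- U x)))"
    unfolding \<mu>_density \<nu>g by (rule rel_entropy_density) (use g0 int_U int_g in auto)
  then show thesis using g g0 int_g \<nu>g that(2) by blast
qed

lemma rel_entropy_S_le:
  "rel_entropy (\<nu> \<bind> S) \<mu>
    \<le> ereal (min 1 (\<kappa>\<^sup>2 * \<rho>\<^sub>\<pi> * \<rho>\<^sub>1) * min 1 (\<kappa>\<^sup>2 * \<rho>\<^sub>0 * \<rho>\<^sub>u)) * rel_entropy \<nu> \<mu>"
proof -
  let ?a = "min 1 (\<kappa>\<^sup>2 * \<rho>\<^sub>\<pi> * \<rho>\<^sub>1)" and ?b = "min 1 (\<kappa>\<^sup>2 * \<rho>\<^sub>0 * \<rho>\<^sub>u)"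
  have pos: "0 < ?a" "0 < ?b"
    using kappa_pos rho_pi_pos rho1_pos rho0_pos rho_u_pos by auto
  show ?thesis
  proof (cases rule: rel_entropy_cases)
    case 1
    then show ?thesis using pos by (simp del: min_less_iff_conj)
  next
    case (2 g)
    have "kl (G.mixture (\<nu> \<bind> F.K)) (G.mixture \<pi>) \<le> ennreal ?a * kl (F.mixture \<nu>) Z"
      unfolding F.bind_K_eq[OF \<nu>]
      by (rule kl_backward_le[OF F.measurable_mixture[OF \<nu>] F.mixture_nonneg F.int_mixture[OF \<nu>]])
    also have "\<dots> \<le> ennreal ?a * (ennreal ?b * kl g (\<lambda>x. exp (- U x)))"
      unfolding 2(4) by (intro mult_left_mono kl_forward_le 2) auto
    also have "\<dots> = ennreal (?a * ?b) * kl g (\<lambda>x. exp (- U x))"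
      using pos by (simp only: ennreal_mult less_imp_le mult.assoc)
    finally show ?thesis
      unfolding rel_entropy_S 2(5) using pos by (intro enn2ereal_le_mult) (auto intro: less_imp_le mult_nonneg_nonneg)
  qed
qed

end

lemma kernel_pow_measurable: "kernel_pow S n \<in> measurable borel (prob_algebra borel)"
proof (induction n)
  case (Suc n)
  then show ?case
    by (simp add: kernel_comp_def measurable_bind_prob_space[OF _ S_measurable])
qed simp

context
  fixes \<nu> :: "(real^'d) measure"
  assumes \<nu>: "prob_space \<nu>" "sets \<nu> = sets borel"
begin

lemma bind_kernel_pow_Suc: "\<nu> \<bind> kernel_pow S (Suc n) = (\<nu> \<bind> kernel_pow S n) \<bind> S"
proof -
  have "kernel_pow S n \<in> measurable \<nu> (prob_algebra borel)"
    using kernel_pow_measurable by (simp add: measurable_cong_sets[OF \<nu>(2) refl])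
  then show ?thesis
    unfolding kernel_pow.simps kernel_comp_def
    by (intro bind_assoc[symmetric, where N=borel and R=borel] measurable_prob_algebraD S_measurable)
qed

lemma bind_kernel_pow_prob: "prob_space (\<nu> \<bind> kernel_pow S n)" "sets (\<nu> \<bind> kernel_pow S n) = sets borel"
proof -
  have "\<nu> \<in> space (prob_algebra borel)" using \<nu> by (simp add: space_prob_algebra)
  then show "prob_space (\<nu> \<bind> kernel_pow S n)" "sets (\<nu> \<bind> kernel_pow S n) = sets borel"
    by (rule prob_space_bind'[OF _ kernel_pow_measurable], rule sets_bind'[OF _ kernel_pow_measurable])
qed

lemma transport_cost_kernel_pow:
  "transport_cost (\<nu> \<bind> kernel_pow S n) \<mu> \<le> ennreal ((\<kappa>\<^sup>2 * \<rho>\<^sub>0 * \<rho>\<^sub>1) ^ (2 * n)) * transport_cost \<nu> \<mu>"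
proof (induction n)
  case 0
  then show ?case using \<nu> by (simp add: bind_return'')
next
  case (Suc n)
  let ?b = "\<kappa>\<^sup>2 * \<rho>\<^sub>0 * \<rho>\<^sub>1"
  have b: "0 \<le> ?b" using rho0_pos rho1_pos by simp
  have "transport_cost (\<nu> \<bind> kernel_pow S (Suc n)) \<mu> \<le> ennreal (?b\<^sup>2) * transport_cost (\<nu> \<bind> kernel_pow S n) \<mu>"
    unfolding bind_kernel_pow_Suc by (rule transport_cost_S[OF bind_kernel_pow_prob])
  also have "\<dots> \<le> ennreal (?b\<^sup>2) * (ennreal (?b ^ (2 * n)) * transport_cost \<nu> \<mu>)"
    by (intro mult_left_mono Suc.IH) auto
  also have "\<dots> = ennreal (?b ^ (2 * Suc n)) * transport_cost \<nu> \<mu>"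
  proof -
    have "?b\<^sup>2 * ?b ^ (2 * n) = ?b ^ (2 * Suc n)" by (simp only: power_add[symmetric]) simp
    then show ?thesis using b by (simp only: mult.assoc[symmetric] ennreal_mult[symmetric] zero_le_power zero_le_power2)
  qed
  finally show ?case .
qed

text \<open>Talagrand's inequality is used once, for the initial law; n steps contract the squared
  distance; the last step returns to entropy. Hence n + 1 steps on the left and the exponent 2n on
  the right.\<close>

lemma rel_entropy_kernel_pow_le:
  "rel_entropy (\<nu> \<bind> kernel_pow S (n + 1)) \<mu>
    \<le> ereal (\<kappa>\<^sup>2 * \<rho>\<^sub>0 * \<rho>\<^sub>u * (\<kappa>\<^sup>2 * \<rho>\<^sub>0 * \<rho>\<^sub>1) ^ (2 * n)) * rel_entropy \<nu> \<mu>"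
proof -
  let ?b = "\<kappa>\<^sup>2 * \<rho>\<^sub>0 * \<rho>\<^sub>1" and ?\<eta> = "\<nu> \<bind> kernel_pow S n"
  have pos: "0 < ?b" "0 < \<kappa>\<^sup>2 * \<rho>\<^sub>0 * \<rho>\<^sub>u"
    using kappa_pos rho1_pos rho0_pos rho_u_pos by auto
  show ?thesis
  proof (cases rule: rel_entropy_cases[OF \<nu>])
    case 1
    have "0 < \<kappa>\<^sup>2 * \<rho>\<^sub>0 * \<rho>\<^sub>u * ?b ^ (2 * n)"
      by (rule mult_pos_pos[OF pos(2) zero_less_power[OF pos(1)]])
    then have "ereal (\<kappa>\<^sup>2 * \<rho>\<^sub>0 * \<rho>\<^sub>u * ?b ^ (2 * n)) * rel_entropy \<nu> \<mu> = \<infinity>"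
      unfolding 1 by (rule ereal_pos_mult_infinity)
    then show ?thesis by (simp only: ereal_less_eq)
  next
    case (2 g)
    have "kl (G.mixture (?\<eta> \<bind> F.K)) (G.mixture \<pi>) \<le> ennreal (\<kappa>\<^sup>2 * \<rho>\<^sub>0 / 2) * transport_cost ?\<eta> \<mu>"
      by (rule kl_S_le_transport_cost[OF bind_kernel_pow_prob])
    also have "\<dots> \<le> ennreal (\<kappa>\<^sup>2 * \<rho>\<^sub>0 / 2) * (ennreal (?b ^ (2 * n)) * transport_cost \<nu> \<mu>)"
      by (intro mult_left_mono transport_cost_kernel_pow) auto
    also have "\<dots> \<le> ennreal (\<kappa>\<^sup>2 * \<rho>\<^sub>0 / 2) * (ennreal (?b ^ (2 * n)) * (ennreal (2 * \<rho>\<^sub>u) * kl g (\<lambda>x. exp (- U x))))"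
      unfolding 2(4) by (intro mult_left_mono talagrand_\<mu> 2) auto
    also have "\<dots> = ennreal (\<kappa>\<^sup>2 * \<rho>\<^sub>0 * \<rho>\<^sub>u * ?b ^ (2 * n)) * kl g (\<lambda>x. exp (- U x))"
    proof -
      have "\<kappa>\<^sup>2 * \<rho>\<^sub>0 / 2 * ?b ^ (2 * n) * (2 * \<rho>\<^sub>u) = \<kappa>\<^sup>2 * \<rho>\<^sub>0 * \<rho>\<^sub>u * ?b ^ (2 * n)" by simp
      moreover have "0 \<le> \<kappa>\<^sup>2 * \<rho>\<^sub>0 / 2" "0 \<le> ?b ^ (2 * n)" "0 \<le> 2 * \<rho>\<^sub>u"
        using rho0_pos rho_u_pos pos by simp_all
      moreover have "ennreal x * (ennreal y * (ennreal z * k)) = ennreal (x * y * z) * k"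
        if "0 \<le> x" "0 \<le> y" "0 \<le> z" for x y z k
        using that by (simp add: ennreal_mult mult_ac)
      ultimately show ?thesis by metis
    qed
    finally show ?thesis
      unfolding Suc_eq_plus1[symmetric] bind_kernel_pow_Suc rel_entropy_S[OF bind_kernel_pow_prob] 2(5)
      using pos by (intro enn2ereal_le_mult) auto
  qed
qed

end

end

end

theorem theorem8p5:
  fixes U :: "real^'d::finite \<Rightarrow> real"
    and W :: "real^'d \<Rightarrow> real^'d \<Rightarrow> real"
    and \<alpha> :: "real^'d"
    and \<beta> \<tau> u\<^sub>p :: "real^'d^'d"
    and \<mu> \<nu> :: "(real^'d) measure"
    and K\<^sub>0 K\<^sub>1 S\<^sub>1 :: "real^'d \<Rightarrow> (real^'d) measure"
    and \<kappa> \<rho>\<^sub>0 \<rho>\<^sub>1 \<rho>\<^sub>0\<pi> a b \<epsilon>\<^sub>0 \<epsilon>\<^sub>0\<pi> :: real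
  assumes tau: "positive_definite \<tau>"
    and beta: "invertible \<beta>"
    and W: "W = (\<lambda>x y. - ln (gauss_density \<tau> (y - (\<alpha> + \<beta> *v x))))"
    and U_smooth: "smooth U"
    and mu: "\<mu> = gibbs_measure U"
    and mu_prob: "prob_space \<mu>"
    and u_plus: "positive_definite u\<^sub>p"
    and hess: "\<And>x. loewner_le (matrix_inv u\<^sub>p) (hessian U x)"
    and K0: "K\<^sub>0 = gibbs_kernel W"
    and K1: "backward_transition \<mu> K\<^sub>0 K\<^sub>1"
    and S1: "S\<^sub>1 = kernel_comp K\<^sub>0 K\<^sub>1"
    and kappa: "\<kappa> = spectral_norm (matrix_inv \<tau> ** \<beta>)"
    and rho0: "\<rho>\<^sub>0 = spectral_norm \<tau>"
    and rho1: "\<rho>\<^sub>1 = spectral_norm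
           (matrix_inv (matrix_inv u\<^sub>p + transpose \<beta> ** matrix_inv \<tau> ** \<beta>))"
    and rho0_pi: "\<rho>\<^sub>0\<pi> = spectral_norm (\<tau> + \<beta> ** u\<^sub>p ** transpose \<beta>)"
    and a: "a = \<epsilon>\<^sub>0"
    and eps0: "\<epsilon>\<^sub>0 = \<kappa>\<^sup>2 * \<rho>\<^sub>0 * spectral_norm u\<^sub>p"
    and b: "b = \<kappa>\<^sup>2 * \<rho>\<^sub>0 * \<rho>\<^sub>1"
    and eps0_pi: "\<epsilon>\<^sub>0\<pi> = \<kappa>\<^sup>2 * \<rho>\<^sub>0\<pi> * \<rho>\<^sub>1"
    and nu_prob: "prob_space \<nu>"
    and nu_sets: "sets \<nu> = sets borel"
  shows "wasserstein2 (\<nu> \<bind> S\<^sub>1) \<mu> \<le> ennreal b * wasserstein2 \<nu> \<mu>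
    \<and> rel_entropy (\<nu> \<bind> S\<^sub>1) \<mu> \<le> ereal (min 1 \<epsilon>\<^sub>0\<pi> * min 1 \<epsilon>\<^sub>0) * rel_entropy \<nu> \<mu>
    \<and> (\<forall>n. rel_entropy (\<nu> \<bind> kernel_pow S\<^sub>1 (n + 1)) \<mu>
             \<le> ereal (a * b ^ (2 * n)) * rel_entropy \<nu> \<mu>)"
proof -
  interpret gaussian_gibbs U \<alpha> \<beta> \<tau> u\<^sub>p
    using tau beta U_smooth mu mu_prob u_plus hess by (simp add: gaussian_gibbs_def)
  have K0_eq: "K\<^sub>0 = F.K" by (simp add: K0 W F_K)
  have L: "backward_transition (gibbs_measure U) F.K K\<^sub>1" using K1 by (simp add: K0_eq mu)
  have S: "S\<^sub>1 = kernel_comp F.K K\<^sub>1" by (simp add: S1 K0_eq)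
  note \<nu> = nu_prob nu_sets
  note defs = a eps0 b eps0_pi kappa rho0 rho1 rho0_pi \<kappa>_def[symmetric] \<rho>\<^sub>0_def[symmetric] \<rho>\<^sub>1_def[symmetric] \<rho>\<^sub>\<pi>_def[symmetric] \<rho>\<^sub>u_def[symmetric]
  \<comment> \<open>Strict positivity is what lets \<open>b\<close> leave the square root even when
    the transport cost is infinite.\<close>
  have b_pos: "0 < b" unfolding defs using kappa_pos rho0_pos rho1_pos by simp
  have "wasserstein2 (\<nu> \<bind> S\<^sub>1) \<mu> \<le> ennreal_sqrt (ennreal (b\<^sup>2) * transport_cost \<nu> \<mu>)"
    unfolding wasserstein2_eq mu defs by (rule ennreal_sqrt_mono[OF transport_cost_S[OF L S \<nu>]])
  also have "\<dots> = ennreal b * wasserstein2 \<nu> \<mu>"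
    by (simp add: ennreal_sqrt_mult_power2[OF b_pos] wasserstein2_eq)
  finally show ?thesis
    using rel_entropy_S_le[OF L S \<nu>] rel_entropy_kernel_pow_le[OF L S \<nu>] unfolding mu defs by blast
qed

end
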